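(* Let $X\subset\mathbb{P}^4$ be a normal cubic threefold over $\mathbb{C}$ that is not a cone. Then $X$ is Pfaffian.
   Context: A cubic threefold is a hypersurface $X\subset\mathbb{P}^4=\mathbb{P}^4_{\mathbb{C}}$ defined by a homogeneous polynomial $F$ of degree $3$. $X$ is called Pfaffian if there is a $6\times 6$ skew-symmetric matrix $M$ whose entries are linear forms in $X_0,\dots,X_4$ such that $X$ is defined by the equation $\mathrm{Pf}(M)=0$. *)

theory Defs
  imports
    Complex_Main
    "HOL-Library.Poly_Mapping"
    "HOL-Library.Numeral_Type"
    "HOL-Algebra.QuotRing"
    "HOL-Algebra.Polynomials"
    "HOL-Algebra.Algebraic_Closure_Type"
    "HOL-Combinatorics.Permutations"
    "Jordan_Normal_Form.Matrix"
begin

section \<open>Polynomials, forms and projective hypersurfaces\<close>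

text \<open>
  Polynomials over the complex numbers in finitely many variables; the variables are the elements
  of the index type. The homogeneous coordinate ring of projective 4-space is the type
  \<open>5 mpoly\<close>. A hypersurface is represented by an equation, and two equations define the
  same hypersurface (as a scheme) iff they generate the same ideal.
\<close>

type_synonym 'v mpoly = "('v \<Rightarrow>\<^sub>0 nat) \<Rightarrow>\<^sub>0 complex"

definition var :: "'v \<Rightarrow> 'v mpoly" where
  "var i = Poly_Mapping.single (Poly_Mapping.single i 1) 1"

definition mpoly_eval :: "'v::finite mpoly \<Rightarrow> ('v \<Rightarrow> complex) \<Rightarrow> complex" where
  "mpoly_eval p x =
     (\<Sum>m\<in>Poly_Mapping.keys p. Poly_Mapping.lookup p m * (\<Prod>i\<in>UNIV. x i ^ Poly_Mapping.lookup m i))"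

text \<open>The zero polynomial is homogeneous of every degree.\<close>

definition homogeneous :: "nat \<Rightarrow> 'v::finite mpoly \<Rightarrow> bool" where
  "homogeneous d p \<longleftrightarrow> (\<forall>m\<in>Poly_Mapping.keys p. (\<Sum>i\<in>UNIV. Poly_Mapping.lookup m i) = d)"

abbreviation mpoly_ring :: "'v mpoly ring" where
  "mpoly_ring \<equiv> ring_of_type_algebra"

definition same_hypersurface :: "'v mpoly \<Rightarrow> 'v mpoly \<Rightarrow> bool" where
  "same_hypersurface F G \<longleftrightarrow> PIdl\<^bsub>mpoly_ring\<^esub> F = PIdl\<^bsub>mpoly_ring\<^esub> G"

definition cubic_form :: "'v::finite mpoly \<Rightarrow> bool" where
  "cubic_form F \<longleftrightarrow> F \<noteq> 0 \<and> homogeneous 3 F"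

section \<open>Localization and integrally closed domains\<close>

text \<open>
  \<open>fraction R S a s\<close> is the equivalence class \<open>a / s\<close>. The construction is meaningful for a
  commutative ring \<open>R\<close> and a subset \<open>S\<close> that contains one and is closed under multiplication;
  the operations below are then single-valued, so that the unions are over equal classes.
\<close>

definition fraction :: "('a, 'b) ring_scheme \<Rightarrow> 'a set \<Rightarrow> 'a \<Rightarrow> 'a \<Rightarrow> ('a \<times> 'a) set" where
  "fraction R S a s =
     {(b, t). b \<in> carrier R \<and> t \<in> S \<and>
        (\<exists>u\<in>S. u \<otimes>\<^bsub>R\<^esub> (a \<otimes>\<^bsub>R\<^esub> t \<ominus>\<^bsub>R\<^esub> b \<otimes>\<^bsub>R\<^esub> s) = \<zero>\<^bsub>R\<^esub>)}"

definition localization :: "('a, 'b) ring_scheme \<Rightarrow> 'a set \<Rightarrow> ('a \<times> 'a) set ring" where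
  "localization R S =
     \<lparr>carrier = {fraction R S a s | a s. a \<in> carrier R \<and> s \<in> S},
      monoid.mult = (\<lambda>x y. \<Union>(a, s)\<in>x. \<Union>(b, t)\<in>y. fraction R S (a \<otimes>\<^bsub>R\<^esub> b) (s \<otimes>\<^bsub>R\<^esub> t)),
      monoid.one = fraction R S \<one>\<^bsub>R\<^esub> \<one>\<^bsub>R\<^esub>,
      ring.zero = fraction R S \<zero>\<^bsub>R\<^esub> \<one>\<^bsub>R\<^esub>,
      ring.add = (\<lambda>x y. \<Union>(a, s)\<in>x. \<Union>(b, t)\<in>y.
               fraction R S (a \<otimes>\<^bsub>R\<^esub> t \<oplus>\<^bsub>R\<^esub> b \<otimes>\<^bsub>R\<^esub> s) (s \<otimes>\<^bsub>R\<^esub> t))\<rparr>"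

abbreviation fraction_field :: "('a, 'b) ring_scheme \<Rightarrow> ('a \<times> 'a) set ring" where
  "fraction_field R \<equiv> localization R (carrier R - {\<zero>\<^bsub>R\<^esub>})"

definition integral_over :: "('a, 'b) ring_scheme \<Rightarrow> 'a set \<Rightarrow> 'a \<Rightarrow> bool" where
  "integral_over L K x \<longleftrightarrow>
     (\<exists>p. polynomial\<^bsub>L\<^esub> K p \<and> p \<noteq> [] \<and> hd p = \<one>\<^bsub>L\<^esub> \<and> ring.eval L p x = \<zero>\<^bsub>L\<^esub>)"

definition integrally_closed_domain :: "('a, 'b) ring_scheme \<Rightarrow> bool" where
  "integrally_closed_domain R \<longleftrightarrow>
     domain R \<and>
     (let Q = fraction_field R;
          R' = (\<lambda>a. fraction R (carrier R - {\<zero>\<^bsub>R\<^esub>}) a \<one>\<^bsub>R\<^esub>) ` carrier R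
      in \<forall>x\<in>carrier Q. integral_over Q R' x \<longrightarrow> x \<in> R')"

section \<open>Normal hypersurfaces\<close>

text \<open>
  The points of the scheme \<open>X = Proj (S / (F))\<close>, as homogeneous prime ideals of the polynomial
  ring \<open>S\<close> that contain \<open>F\<close> but not the irrelevant ideal.
\<close>

definition homogeneous_ideal :: "'v::finite mpoly set \<Rightarrow> bool" where
  "homogeneous_ideal I \<longleftrightarrow>
     ideal I mpoly_ring \<and> I = Idl\<^bsub>mpoly_ring\<^esub> {p \<in> I. \<exists>d. homogeneous d p}"

definition hypersurface_points :: "'v::finite mpoly \<Rightarrow> 'v mpoly set set" where
  "hypersurface_points F =
     {P. primeideal P mpoly_ring \<and> homogeneous_ideal P \<and> F \<in> P \<and> (\<exists>i. var i \<notin> P)}"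

text \<open>
  The local ring of \<open>X\<close> at the point \<open>P\<close>: the fractions \<open>G / H\<close> with \<open>G\<close>, \<open>H\<close> homogeneous of the
  same degree and \<open>H\<close> not in \<open>P\<close>, inside the localization of \<open>S / (F)\<close> at the homogeneous elements
  outside of \<open>P\<close>.
\<close>

definition coordinate_ring :: "'v mpoly \<Rightarrow> 'v mpoly set ring" where
  "coordinate_ring F = mpoly_ring Quot (PIdl\<^bsub>mpoly_ring\<^esub> F)"

definition residue_class :: "'v mpoly \<Rightarrow> 'v mpoly \<Rightarrow> 'v mpoly set" where
  "residue_class F G = PIdl\<^bsub>mpoly_ring\<^esub> F +>\<^bsub>mpoly_ring\<^esub> G"

definition local_ring :: "'v::finite mpoly \<Rightarrow> 'v mpoly set \<Rightarrow> ('v mpoly set \<times> 'v mpoly set) set ring" where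
  "local_ring F P =
     (let T = {residue_class F H | H d. homogeneous d H \<and> H \<notin> P}
      in localization (coordinate_ring F) T
           \<lparr>carrier := {fraction (coordinate_ring F) T (residue_class F G) (residue_class F H)
                        | G H d. homogeneous d G \<and> homogeneous d H \<and> H \<notin> P}\<rparr>)"

definition normal_hypersurface :: "'v::finite mpoly \<Rightarrow> bool" where
  "normal_hypersurface F \<longleftrightarrow>
     (\<forall>P\<in>hypersurface_points F. integrally_closed_domain (local_ring F P))"

section \<open>Cones\<close>

text \<open>
  There is a point \<open>v\<close> of the hypersurface (a vertex) such that the line joining \<open>v\<close> to any other
  point \<open>x\<close> of the hypersurface lies on the hypersurface. Points of projective space are given by
  homogeneous coordinates; the case of \<open>x\<close> zero or proportional to \<open>v\<close> is harmless for a form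
  \<open>F\<close> of positive degree.
\<close>

definition is_cone :: "'v::finite mpoly \<Rightarrow> bool" where
  "is_cone F \<longleftrightarrow>
     (\<exists>v. v \<noteq> (\<lambda>_. 0) \<and> mpoly_eval F v = 0 \<and>
        (\<forall>x. mpoly_eval F x = 0 \<longrightarrow> (\<forall>a b. mpoly_eval F (\<lambda>i. a * v i + b * x i) = 0)))"

section \<open>Pfaffians\<close>

text \<open>
  The Pfaffian of a skew-symmetric matrix of size \<open>2n\<close>, as the signed sum over the perfect
  matchings of the index set. A matching is represented by the unique permutation listing its
  pairs with increasing entries and in order of increasing first entries.
\<close>

definition matching_permutations :: "nat \<Rightarrow> (nat \<Rightarrow> nat) set" where
  "matching_permutations n =
     {\<pi>. \<pi> permutes {..<2 * n} \<and>
         (\<forall>k<n. \<pi> (2 * k) < \<pi> (2 * k + 1)) \<and>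
         (\<forall>k l. k < l \<and> l < n \<longrightarrow> \<pi> (2 * k) < \<pi> (2 * l))}"

definition pfaffian :: "nat \<Rightarrow> 'a::comm_ring_1 mat \<Rightarrow> 'a" where
  "pfaffian n M =
     (\<Sum>\<pi>\<in>matching_permutations n.
        of_int (sign \<pi>) * (\<Prod>k<n. M $$ (\<pi> (2 * k), \<pi> (2 * k + 1))))"

definition is_pfaffian_cubic :: "'v::finite mpoly \<Rightarrow> bool" where
  "is_pfaffian_cubic F \<longleftrightarrow>
     (\<exists>M \<in> carrier_mat 6 6.
        transpose_mat M = - M \<and>
        (\<forall>i<6. \<forall>j<6. homogeneous 1 (M $$ (i, j))) \<and>
        same_hypersurface F (pfaffian 3 M))"

end

theory Submission
  imports Defs "HOL-Analysis.Analysis"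
begin

text \<open>Cut the threefold by a hyperplane \<open>W = 0\<close> that is tangent to it at a point \<open>p\<close>. The resulting singular
  cubic surface \<open>P (Z\<^sup>2 + q) + Z m + n = 0\<close> is the determinant of a 3 by 3 matrix of linear forms whose last
  column \<open>v, w, P\<close> vanishes at a single point \<open>z\<close>. Through \<open>z\<close> there is a line of the threefold, because a conic
  meets a cubic in the plane; if \<open>z\<close> lies on no line of the surface, this line leaves the hyperplane. Its
  direction taken as the last basis vector, the cubic becomes the determinant plus \<open>W\<close> times a combination of
  \<open>v, w, P\<close>, and such a form is a Pfaffian. A suitable section exists for every cubic that is not a cone and
  contains no plane; the cubics with a plane are treated directly, again with the help of a line.\<close>

section \<open>Pfaffians of skew-symmetric 6 by 6 matrices\<close>

text \<open>A skew 6 by 6 matrix with off-diagonal block \<open>M\<close> and diagonal blocks given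
  by vectors \<open>a\<close>, \<open>b\<close> of 3-space has the Pfaffian
  \<open>det M + a^T M b\<close> up to signs. If \<open>W\<close> is the only nonzero entry of
  \<open>a\<close>, the second term is \<open>W\<close> times any combination of one row of
  \<open>M\<close>. The cubic is the determinant plus \<open>W\<close> times a quadric, and that
  quadric is such a combination of \<open>v, w, P\<close> as soon as it vanishes where all three do,
  which is the line through \<open>z\<close>. Tangency at \<open>p\<close> makes the section linear
  in \<open>P\<close>, so that projection from \<open>p\<close> has a rational inverse, and a
  determinantal form reduces to factoring binary forms. The obstacle is the choice of
  \<open>z\<close>, off the tangent cone at \<open>p\<close> and off all lines of the section. If
  the tangent conic has rank two or three, projection from \<open>p\<close> turns this into avoiding
  the conic and finitely many lines, unless the cubic vanishes on a component of the conic; in that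
  case the threefold contains a plane. Everything is done with the polar form \<open>t\<close>. Not
  being a cone enters as: \<open>t p\<close> is nonzero for every nonzero vector
  \<open>p\<close>.\<close>

definition pfaffian6 :: "(nat \<Rightarrow> nat \<Rightarrow> 'a::comm_ring_1) \<Rightarrow> 'a" where
  "pfaffian6 a =
     a 0 1 * a 2 3 * a 4 5 - a 0 1 * a 2 4 * a 3 5 + a 0 1 * a 2 5 * a 3 4
     - a 0 2 * a 1 3 * a 4 5 + a 0 2 * a 1 4 * a 3 5 - a 0 2 * a 1 5 * a 3 4
     + a 0 3 * a 1 2 * a 4 5 - a 0 3 * a 1 4 * a 2 5 + a 0 3 * a 1 5 * a 2 4
     - a 0 4 * a 1 2 * a 3 5 + a 0 4 * a 1 3 * a 2 5 - a 0 4 * a 1 5 * a 2 3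
     + a 0 5 * a 1 2 * a 3 4 - a 0 5 * a 1 3 * a 2 4 + a 0 5 * a 1 4 * a 2 3"

definition perm6 :: "nat list \<Rightarrow> nat \<Rightarrow> nat" where
  "perm6 xs i = (if i < 6 then xs ! i else i)"

definition matchings6 :: "nat list list" where
  "matchings6 =
    [[0,1,2,3,4,5], [0,1,2,4,3,5], [0,1,2,5,3,4],
     [0,2,1,3,4,5], [0,2,1,4,3,5], [0,2,1,5,3,4],
     [0,3,1,2,4,5], [0,3,1,4,2,5], [0,3,1,5,2,4],
     [0,4,1,2,3,5], [0,4,1,3,2,5], [0,4,1,5,2,3],
     [0,5,1,2,3,4], [0,5,1,3,2,4], [0,5,1,4,2,3]]"

lemma less_3_iff: "(i::nat) < 3 \<longleftrightarrow> i = 0 \<or> i = 1 \<or> i = 2"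
  by linarith

lemma less_6_iff: "(i::nat) < 6 \<longleftrightarrow> i = 0 \<or> i = 1 \<or> i = 2 \<or> i = 3 \<or> i = 4 \<or> i = 5"
  by (simp add: less_Suc_eq eval_nat_numeral)

lemma lessThan_3: "{..<3::nat} = {0, 1, 2}"
  by (simp add: lessThan_nat_numeral lessThan_Suc insert_commute)

lemma lessThan_6: "{..<6::nat} = {0, 1, 2, 3, 4, 5}"
  by (simp add: lessThan_nat_numeral lessThan_Suc insert_commute)

lemma perm6_permutes:
  assumes "length xs = 6" "set xs = {0,1,2,3,4,5}"
  shows "perm6 xs permutes {..<6}"
proof -
  have "distinct xs" using assms by (simp add: card_distinct)
  hence "inj_on (perm6 xs) {..<6}"
    using assms(1) by (auto simp: inj_on_def perm6_def nth_eq_iff_index_eq)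
  moreover have "perm6 xs ` {..<6} = set xs"
    using assms(1) by (force simp: perm6_def in_set_conv_nth)
  hence "perm6 xs ` {..<6} = {..<6}" using assms(2) lessThan_6 by simp
  ultimately have "bij_betw (perm6 xs) {..<6} {..<6}" by (simp add: bij_betw_def)
  thus ?thesis by (rule bij_imp_permutes) (simp add: perm6_def)
qed

text \<open>Serves for positions 3, 4, 5 of a matching: the last pair is increasing, so the value at
  3 determines the other two.\<close>

lemma ordered_triple:
  fixes p q r :: nat
  assumes "p \<in> {a, b, c}" "q \<in> {a, b, c}" "r \<in> {a, b, c}" "a < b" "b < c" "q < r" "p \<noteq> q" "p \<noteq> r"
  shows "p = a \<and> q = b \<and> r = c \<or> p = b \<and> q = a \<and> r = c \<or> p = c \<and> q = a \<and> r = b"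
  using assms by (elim insertE emptyE) simp_all

text \<open>Position 0 must hold 0 and its partner is arbitrary; position 2 then holds the least
  index left and its partner is again arbitrary, which makes 5 times 3 matchings.\<close>

lemma matching_permutations_3: "matching_permutations 3 = perm6 ` set matchings6"
proof (intro Set.set_eqI iffI)
  fix \<pi> assume "\<pi> \<in> matching_permutations 3"
  hence p: "\<pi> permutes {..<6}" and
    a: "\<forall>k<3. \<pi> (2 * k) < \<pi> (2 * k + 1)" and b: "\<forall>k l. k < l \<and> l < 3 \<longrightarrow> \<pi> (2 * k) < \<pi> (2 * l)"
    by (auto simp: matching_permutations_def)
  have lt: "\<pi> i < 6" if "i < 6" for i using permutes_in_image[OF p] that by auto
  have a': "\<pi> 0 < \<pi> 1" "\<pi> 2 < \<pi> 3" "\<pi> 4 < \<pi> 5"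
    using a[rule_format, of 0] a[rule_format, of 1] a[rule_format, of 2] by simp_all
  have b': "\<pi> 0 < \<pi> 2" "\<pi> 2 < \<pi> 4"
    using b[rule_format, of 0 1] b[rule_format, of 1 2] by simp_all
  have inj: "\<pi> i = \<pi> j \<longleftrightarrow> i = j" for i j using permutes_inj[OF p] by (auto dest: injD)
  define xs where "xs = map \<pi> [0,1,2,3,4,5]"
  have "\<pi> = perm6 xs"
  proof
    fix i show "\<pi> i = perm6 xs i"
      using permutes_not_in[OF p, of i] by (auto simp: perm6_def xs_def less_6_iff)
  qed
  moreover have "xs \<in> set matchings6"
  proof -
    have im: "\<exists>i\<in>{0,1,2,3,4,5}. \<pi> i = k" if "k < 6" for k
      using permutes_image[OF p] that by (metis image_iff lessThan_6 lessThan_iff)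
    have z: "\<pi> 0 = 0" using im[of 0] a' b' by auto
    have r: "\<pi> i \<in> {1,2,3,4,5}" if "i \<in> {1,2,3,4,5}" for i
    proof -
      have "\<pi> i < 6" using that by (intro lt) auto
      moreover have "\<pi> i \<noteq> 0" using that inj[of i 0] z by auto
      ultimately show ?thesis by (auto simp: less_6_iff)
    qed
    have o: "\<pi> 1 = 1 \<or> \<pi> 2 = 1" using im[of 1] a' b' z by auto
    have o2: "\<pi> 2 = 2" if "\<pi> 1 = 1"
    proof -
      have "\<exists>i\<in>{0,1,2,3,4,5}. \<pi> i = 2" using im[of 2] by simp
      moreover have "\<pi> 2 \<noteq> 1" using inj[of 2 1] that by simp
      ultimately show ?thesis using a' b' z that by (elim bexE insertE emptyE; hypsubst) linarith+
    qed
    have ne: "\<pi> 1 \<noteq> \<pi> 2" "\<pi> 3 \<noteq> \<pi> 4" "\<pi> 3 \<noteq> \<pi> 5" by (simp_all add: inj)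
    have r3: "\<pi> i \<in> {1,2,3,4,5} - {\<pi> 1, \<pi> 2}" if "i \<in> {3,4,5}" for i
      using r[of i] that inj[of i 1] inj[of i 2] by (elim insertE emptyE) simp_all
    have lt: "(2::nat) < 3" "(3::nat) < 4" "(4::nat) < 5" "(2::nat) < 4" "(3::nat) < 5" by simp_all
    consider "\<pi> 1 = 1" "\<pi> 2 = 2" | "\<pi> 1 = 2" "\<pi> 2 = 1" | "\<pi> 1 = 3" "\<pi> 2 = 1" | "\<pi> 1 = 4" "\<pi> 2 = 1"
      | "\<pi> 1 = 5" "\<pi> 2 = 1" using o o2 r[of 1] ne(1) by (elim insertE disjE emptyE) auto
    hence "[0, \<pi> 1, \<pi> 2, \<pi> 3, \<pi> 4, \<pi> 5] \<in> set matchings6"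
    proof cases
      case 1
      have "\<pi> i \<in> {3,4,5}" if "i \<in> {3,4,5}" for i using r3[OF that] unfolding 1 by blast
      hence "\<pi> 3 \<in> {3,4,5}" "\<pi> 4 \<in> {3,4,5}" "\<pi> 5 \<in> {3,4,5}" by blast+
      from ordered_triple[OF this lt(2) lt(3) a'(3) ne(2,3)] show ?thesis
        by (elim disjE conjE) (simp_all add: matchings6_def 1[unfolded One_nat_def])
    next
      case 2
      have "\<pi> i \<in> {3,4,5}" if "i \<in> {3,4,5}" for i using r3[OF that] unfolding 2 by blast
      hence "\<pi> 3 \<in> {3,4,5}" "\<pi> 4 \<in> {3,4,5}" "\<pi> 5 \<in> {3,4,5}" by blast+
      from ordered_triple[OF this lt(2) lt(3) a'(3) ne(2,3)] show ?thesis
        by (elim disjE conjE) (simp_all add: matchings6_def 2[unfolded One_nat_def])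
    next
      case 3
      have "\<pi> i \<in> {2,4,5}" if "i \<in> {3,4,5}" for i using r3[OF that] unfolding 3 by blast
      hence "\<pi> 3 \<in> {2,4,5}" "\<pi> 4 \<in> {2,4,5}" "\<pi> 5 \<in> {2,4,5}" by blast+
      from ordered_triple[OF this lt(4) lt(3) a'(3) ne(2,3)] show ?thesis
        by (elim disjE conjE) (simp_all add: matchings6_def 3[unfolded One_nat_def])
    next
      case 4
      have "\<pi> i \<in> {2,3,5}" if "i \<in> {3,4,5}" for i using r3[OF that] unfolding 4 by blast
      hence "\<pi> 3 \<in> {2,3,5}" "\<pi> 4 \<in> {2,3,5}" "\<pi> 5 \<in> {2,3,5}" by blast+
      from ordered_triple[OF this lt(1) lt(5) a'(3) ne(2,3)] show ?thesis
        by (elim disjE conjE) (simp_all add: matchings6_def 4[unfolded One_nat_def])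
    next
      case 5
      have "\<pi> i \<in> {2,3,4}" if "i \<in> {3,4,5}" for i using r3[OF that] unfolding 5 by blast
      hence "\<pi> 3 \<in> {2,3,4}" "\<pi> 4 \<in> {2,3,4}" "\<pi> 5 \<in> {2,3,4}" by blast+
      from ordered_triple[OF this lt(1) lt(2) a'(3) ne(2,3)] show ?thesis
        by (elim disjE conjE) (simp_all add: matchings6_def 5[unfolded One_nat_def])
    qed
    thus ?thesis using z by (simp add: xs_def)
  qed
  ultimately show "\<pi> \<in> perm6 ` set matchings6" by simp
next
  fix \<pi> assume "\<pi> \<in> perm6 ` set matchings6"
  then obtain xs where xs: "xs \<in> set matchings6" "\<pi> = perm6 xs" by auto
  have "length xs = 6" "set xs = {0,1,2,3,4,5}"
    using xs(1) unfolding matchings6_def by (auto)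
  hence "\<pi> permutes {..<6}" using perm6_permutes xs(2) by simp
  moreover have "\<forall>k<3. \<pi> (2 * k) < \<pi> (2 * k + 1)" "\<forall>k l. k < l \<and> l < 3 \<longrightarrow> \<pi> (2 * k) < \<pi> (2 * l)"
    using xs unfolding matchings6_def by (auto simp: perm6_def less_3_iff)
  ultimately show "\<pi> \<in> matching_permutations 3" by (simp add: matching_permutations_def)
qed

lemma sign_transpose_comp:
  assumes "permutation f" "a \<noteq> b"
  shows "sign (Transposition.transpose a b \<circ> f) = - sign f"
  using assms by (simp add: sign_compose permutation_swap_id sign_swap_id)

fun swaps :: "(nat \<times> nat) list \<Rightarrow> nat \<Rightarrow> nat" where
  "swaps [] = id" | "swaps ((a,b)#r) = Transposition.transpose a b \<circ> swaps r"

lemma permutation_swaps: "permutation (swaps r)"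
  by (induction r rule: swaps.induct) (simp_all only: swaps.simps permutation_id permutation_compose permutation_swap_id)

lemma sign_swaps: "\<forall>(a,b)\<in>set r. a \<noteq> b \<Longrightarrow> sign (swaps r) = (-1)^length r"
  by (induction r rule: swaps.induct) (auto simp: sign_transpose_comp permutation_swaps)

text \<open>A word of transpositions that produces the list determines the sign by its length, so
  each of the fifteen signs is a matter of simplification.\<close>

lemma sign_perm6:
  assumes "\<forall>(a,b)\<in>set r. a \<noteq> b \<and> a < 6 \<and> b < 6" "length xs = 6" "map (swaps r) [0,1,2,3,4,5] = xs"
  shows "sign (perm6 xs) = (-1)^length r"
proof -
  have fix_ge: "\<forall>(a,b)\<in>set r. a < 6 \<and> b < 6 \<Longrightarrow> i \<ge> 6 \<Longrightarrow> swaps r i = i" for i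
    by (induction r rule: swaps.induct) (auto simp: transpose_apply_other)
  have "perm6 xs = swaps r"
  proof
    fix i show "perm6 xs i = swaps r i"
    proof (cases "i < 6")
      case True
      have "xs ! i = swaps r i"
        using True unfolding assms(3)[symmetric] less_6_iff by (elim disjE) simp_all
      thus ?thesis using True by (simp add: perm6_def)
    next
      case False
      moreover have "\<forall>(a, b)\<in>set r. a < 6 \<and> b < 6" using assms(1) by fast
      ultimately show ?thesis using fix_ge[of i] by (simp add: perm6_def)
    qed
  qed
  moreover have "\<forall>(a, b)\<in>set r. a \<noteq> b" using assms(1) by fast
  ultimately show ?thesis using sign_swaps[of r] by simp
qed

lemma sign_matchings6:
  "sign (perm6 [0,1,2,3,4,5]) = 1"
  "sign (perm6 [0,1,2,4,3,5]) = -1"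
  "sign (perm6 [0,1,2,5,3,4]) = 1"
  "sign (perm6 [0,2,1,3,4,5]) = -1"
  "sign (perm6 [0,2,1,4,3,5]) = 1"
  "sign (perm6 [0,2,1,5,3,4]) = -1"
  "sign (perm6 [0,3,1,2,4,5]) = 1"
  "sign (perm6 [0,3,1,4,2,5]) = -1"
  "sign (perm6 [0,3,1,5,2,4]) = 1"
  "sign (perm6 [0,4,1,2,3,5]) = -1"
  "sign (perm6 [0,4,1,3,2,5]) = 1"
  "sign (perm6 [0,4,1,5,2,3]) = -1"
  "sign (perm6 [0,5,1,2,3,4]) = 1"
  "sign (perm6 [0,5,1,3,2,4]) = -1"
  "sign (perm6 [0,5,1,4,2,3]) = 1"
  subgoal by (subst sign_perm6[of "[]"]) (simp_all add: Transposition.transpose_def)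
  subgoal by (subst sign_perm6[of "[(4,3)]"]) (simp_all add: Transposition.transpose_def)
  subgoal by (subst sign_perm6[of "[(5,3),(5,4)]"]) (simp_all add: Transposition.transpose_def)
  subgoal by (subst sign_perm6[of "[(2,1)]"]) (simp_all add: Transposition.transpose_def)
  subgoal by (subst sign_perm6[of "[(2,1),(4,3)]"]) (simp_all add: Transposition.transpose_def)
  subgoal by (subst sign_perm6[of "[(2,1),(5,3),(5,4)]"]) (simp_all add: Transposition.transpose_def)
  subgoal by (subst sign_perm6[of "[(3,1),(3,2)]"]) (simp_all add: Transposition.transpose_def)
  subgoal by (subst sign_perm6[of "[(3,1),(3,2),(4,3)]"]) (simp_all add: Transposition.transpose_def)
  subgoal by (subst sign_perm6[of "[(3,1),(3,2),(5,3),(5,4)]"]) (simp_all add: Transposition.transpose_def)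
  subgoal by (subst sign_perm6[of "[(4,1),(4,2),(4,3)]"]) (simp_all add: Transposition.transpose_def)
  subgoal by (subst sign_perm6[of "[(4,1),(4,2)]"]) (simp_all add: Transposition.transpose_def)
  subgoal by (subst sign_perm6[of "[(4,1),(4,2),(5,3)]"]) (simp_all add: Transposition.transpose_def)
  subgoal by (subst sign_perm6[of "[(5,1),(5,2),(5,3),(5,4)]"]) (simp_all add: Transposition.transpose_def)
  subgoal by (subst sign_perm6[of "[(5,1),(5,2),(5,4)]"]) (simp_all add: Transposition.transpose_def)
  subgoal by (subst sign_perm6[of "[(5,1),(5,2),(4,3),(5,4)]"]) (simp_all add: Transposition.transpose_def)
  done

lemma pfaffian_3: "pfaffian 3 M = pfaffian6 (\<lambda>i j. M $$ (i, j))"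
proof -
  have inj: "inj_on perm6 (set matchings6)"
  proof (rule inj_onI)
    fix xs ys assume "xs \<in> set matchings6" "ys \<in> set matchings6" and e: "perm6 xs = perm6 ys"
    hence "length xs = 6" "length ys = 6" by (auto simp: matchings6_def)
    thus "xs = ys" using fun_cong[OF e] by (intro nth_equalityI) (auto simp: perm6_def, metis)
  qed
  have "pfaffian 3 M = (\<Sum>xs\<in>set matchings6. of_int (sign (perm6 xs)) * (\<Prod>k<3. M $$ (perm6 xs (2 * k), perm6 xs (2 * k + 1))))"
    unfolding pfaffian_def matching_permutations_3 by (subst sum.reindex[OF inj]) simp
  also have "\<dots> = (\<Sum>xs\<leftarrow>matchings6. of_int (sign (perm6 xs)) * (\<Prod>k<3. M $$ (perm6 xs (2 * k), perm6 xs (2 * k + 1))))"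
    by (rule sum.distinct_set_conv_list) (simp add: matchings6_def)
  also have "\<dots> = pfaffian6 (\<lambda>i j. M $$ (i, j))"
    unfolding matchings6_def
    by (simp only: list.map sum_list.Cons sum_list.Nil sign_matchings6 lessThan_3)
       (simp add: perm6_def pfaffian6_def mult.assoc)
  finally show ?thesis .
qed

section \<open>Cubic forms as symmetric trilinear forms\<close>

lemma mpoly_eval_superset:
  assumes "finite S" "Poly_Mapping.keys p \<subseteq> S"
  shows "mpoly_eval p x = (\<Sum>m\<in>S. Poly_Mapping.lookup p m * (\<Prod>i\<in>UNIV. x i ^ Poly_Mapping.lookup m i))"
  unfolding mpoly_eval_def using assms by (intro sum.mono_neutral_left) (auto simp: in_keys_iff)

lemma mpoly_eval_add: "mpoly_eval (p + q) x = mpoly_eval p x + mpoly_eval q x"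
proof -
  let ?S = "Poly_Mapping.keys p \<union> Poly_Mapping.keys q"
  have "mpoly_eval (p + q) x = (\<Sum>m\<in>?S. Poly_Mapping.lookup (p + q) m * (\<Prod>i\<in>UNIV. x i ^ Poly_Mapping.lookup m i))"
    by (rule mpoly_eval_superset) (auto simp: Poly_Mapping.keys_add)
  thus ?thesis
    by (simp add: lookup_add distrib_right sum.distrib mpoly_eval_superset[of ?S p] mpoly_eval_superset[of ?S q])
qed

lemma mpoly_eval_zero [simp]: "mpoly_eval 0 x = 0"
  by (simp add: mpoly_eval_def)

lemma mpoly_eval_uminus: "mpoly_eval (- p) x = - mpoly_eval p x"
  using mpoly_eval_add[of p "- p" x] by (simp add: eq_neg_iff_add_eq_0 add.commute)

lemma mpoly_eval_diff: "mpoly_eval (p - q) x = mpoly_eval p x - mpoly_eval q x"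
  using mpoly_eval_add[of p "- q" x] by (simp add: mpoly_eval_uminus)

lemma mpoly_eval_sum: "mpoly_eval (\<Sum>i\<in>A. f i) x = (\<Sum>i\<in>A. mpoly_eval (f i) x)"
  by (induction A rule: infinite_finite_induct) (simp_all add: mpoly_eval_add)

lemma mpoly_eval_single:
  "mpoly_eval (Poly_Mapping.single m c) x = c * (\<Prod>i\<in>UNIV. x i ^ Poly_Mapping.lookup m i)"
  by (cases "c = 0") (simp_all add: mpoly_eval_def)

lemma mpoly_eval_var: "mpoly_eval (var i) x = x i"
proof -
  have "(\<Prod>j\<in>UNIV. x j ^ Poly_Mapping.lookup (Poly_Mapping.single i (1::nat)) j) = (\<Prod>j\<in>UNIV. if j = i then x i else 1)"
    by (rule prod.cong) (auto simp: lookup_single when_def)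
  thus ?thesis by (simp add: var_def mpoly_eval_single)
qed

lemma poly_mapping_sum_singles: "p = (\<Sum>m\<in>Poly_Mapping.keys p. Poly_Mapping.single m (Poly_Mapping.lookup p m))"
proof (rule poly_mapping_eqI)
  fix k
  have "Poly_Mapping.lookup (\<Sum>m\<in>Poly_Mapping.keys p. Poly_Mapping.single m (Poly_Mapping.lookup p m)) k =
    (\<Sum>m\<in>Poly_Mapping.keys p. if m = k then Poly_Mapping.lookup p k else 0)"
    unfolding lookup_sum by (intro sum.cong) (auto simp: lookup_single when_def)
  thus "Poly_Mapping.lookup p k = Poly_Mapping.lookup (\<Sum>m\<in>Poly_Mapping.keys p. Poly_Mapping.single m (Poly_Mapping.lookup p m)) k"
    by (simp add: in_keys_iff)
qed

lemma mpoly_eval_mult: "mpoly_eval (p * q) x = mpoly_eval p x * mpoly_eval q x"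
proof -
  have ss: "mpoly_eval (Poly_Mapping.single m a * Poly_Mapping.single n b) x =
     mpoly_eval (Poly_Mapping.single m a) x * mpoly_eval (Poly_Mapping.single n b) x" for m n a b
    by (simp add: mult_single mpoly_eval_single lookup_add power_add prod.distrib)
  have "p * q = (\<Sum>m\<in>Poly_Mapping.keys p. \<Sum>n\<in>Poly_Mapping.keys q.
      Poly_Mapping.single m (Poly_Mapping.lookup p m) * Poly_Mapping.single n (Poly_Mapping.lookup q n))"
    by (subst poly_mapping_sum_singles[of p], subst poly_mapping_sum_singles[of q], rule sum_product)
  also have "mpoly_eval \<dots> x = (\<Sum>m\<in>Poly_Mapping.keys p. mpoly_eval (Poly_Mapping.single m (Poly_Mapping.lookup p m)) x) *
      (\<Sum>n\<in>Poly_Mapping.keys q. mpoly_eval (Poly_Mapping.single n (Poly_Mapping.lookup q n)) x)"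
    by (simp add: mpoly_eval_sum ss sum_product)
  also have "\<dots> = mpoly_eval p x * mpoly_eval q x"
    by (simp add: mpoly_eval_sum[symmetric] poly_mapping_sum_singles[symmetric])
  finally show ?thesis .
qed

lemma poly_sum_monoms_nonzero:
  fixes e :: "'b \<Rightarrow> nat" and c :: "'b \<Rightarrow> 'a::comm_ring_1"
  assumes "finite A" "inj_on e A" "m \<in> A" "c m \<noteq> 0"
  shows "(\<Sum>k\<in>A. monom (c k) (e k)) \<noteq> 0"
proof -
  have "coeff (\<Sum>k\<in>A. monom (c k) (e k)) (e m) = (\<Sum>k\<in>A. if k = m then c k else 0)"
    unfolding coeff_sum using assms by (intro sum.cong) (auto simp: inj_on_def)
  thus ?thesis using assms by auto
qed

text \<open>Digits in base \<open>N\<close> are unique: division by \<open>N ^ k\<close> isolates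
  the top one.\<close>

lemma base_expansion_inj:
  fixes m n :: "nat \<Rightarrow> nat"
  assumes "\<And>i. m i < N" "\<And>i. n i < N" "(\<Sum>i<k. m i * N ^ i) = (\<Sum>i<k. n i * N ^ i)" "i < k"
  shows "m i = n i"
  using assms(3,4)
proof (induction k arbitrary: i)
  case (Suc k)
  have lt: "(\<Sum>i<k. f i * N ^ i) < N ^ k" if "\<And>i. f i < N" for f :: "nat \<Rightarrow> nat"
  proof (induction k)
    case (Suc k)
    have "f k * N ^ k + N ^ k \<le> N * N ^ k"
      using that[of k] by (metis Suc_leI add.commute mult_Suc mult_le_mono1)
    thus ?case using Suc by simp
  qed simp
  have N: "N ^ k > 0" using assms(1)[of 0] by simp
  have "m k = (\<Sum>i<Suc k. m i * N ^ i) div N ^ k" using lt[of m, OF assms(1)] N by simp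
  also have "\<dots> = n k" unfolding Suc.prems(1) using lt[of n, OF assms(2)] N by simp
  finally have k: "m k = n k" .
  show ?case
  proof (cases "i = k")
    case False
    thus ?thesis using Suc.IH[of i] Suc.prems k by simp
  qed (use k in simp)
qed simp

text \<open>Kronecker substitution: the variables are specialised to powers of one variable that separate
  the finitely many monomials.\<close>

lemma mpoly_eval_nonzero:
  fixes p :: "'v::finite mpoly"
  assumes "p \<noteq> 0"
  shows "\<exists>x. mpoly_eval p x \<noteq> 0"
proof -
  obtain h :: "'v \<Rightarrow> nat" where h: "bij_betw h UNIV {0..<CARD('v)}"
    using ex_bij_betw_finite_nat[of "UNIV::'v set"] by auto
  define g where "g = the_inv h"
  \<comment> \<open>Exceeds every exponent that occurs, so that exponents are digits in base
    \<open>N\<close>; the inserted 0 makes the maximum one of a nonempty set.\<close>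
  define N where "N = Suc (Max (insert 0 ((\<lambda>(m, i). Poly_Mapping.lookup m i) ` (Poly_Mapping.keys p \<times> UNIV))))"
  have N: "Poly_Mapping.lookup m i < N" if "m \<in> Poly_Mapping.keys p" for m i
    unfolding N_def less_Suc_eq_le using that by (intro Max_ge) force+
  define e where "e m = (\<Sum>i\<in>UNIV. Poly_Mapping.lookup m i * N ^ h i)" for m :: "'v \<Rightarrow>\<^sub>0 nat"
  have inj: "inj h" using h by (simp add: bij_betw_def)
  have e: "e m = (\<Sum>k<CARD('v). Poly_Mapping.lookup m (g k) * N ^ k)" for m
    unfolding e_def atLeast0LessThan[symmetric]
    by (subst sum.reindex_bij_betw[OF h, symmetric]) (simp add: g_def the_inv_f_f[OF inj])
  have "inj_on e (Poly_Mapping.keys p)"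
  proof (rule inj_onI)
    fix m n assume mn: "m \<in> Poly_Mapping.keys p" "n \<in> Poly_Mapping.keys p" "e m = e n"
    show "m = n"
    proof (rule poly_mapping_eqI)
      fix i
      have "h i < CARD('v)" using h by (auto simp: bij_betw_def)
      hence "Poly_Mapping.lookup m (g (h i)) = Poly_Mapping.lookup n (g (h i))"
        using mn N by (intro base_expansion_inj[of "\<lambda>k. Poly_Mapping.lookup m (g k)" N "\<lambda>k. Poly_Mapping.lookup n (g k)" "CARD('v)" "h i"]) (auto simp: e)
      thus "Poly_Mapping.lookup m i = Poly_Mapping.lookup n i" by (simp add: g_def the_inv_f_f[OF inj])
    qed
  qed
  moreover obtain m where "m \<in> Poly_Mapping.keys p" using assms by (metis ex_in_conv keys_eq_empty)
  ultimately have "(\<Sum>m\<in>Poly_Mapping.keys p. monom (Poly_Mapping.lookup p m) (e m)) \<noteq> 0"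
    by (intro poly_sum_monoms_nonzero) (auto simp: in_keys_iff)
  then obtain t where "poly (\<Sum>m\<in>Poly_Mapping.keys p. monom (Poly_Mapping.lookup p m) (e m)) t \<noteq> 0"
    using poly_all_0_iff_0 by blast
  moreover have "poly (\<Sum>m\<in>Poly_Mapping.keys p. monom (Poly_Mapping.lookup p m) (e m)) t = mpoly_eval p (\<lambda>i. t ^ N ^ h i)"
    by (simp add: mpoly_eval_def poly_sum poly_monom e_def power_sum power_mult[symmetric] mult.commute)
  ultimately show ?thesis by metis
qed

lemma mpoly_eqI: "(\<And>x. mpoly_eval p x = mpoly_eval q x) \<Longrightarrow> p = q"
  using mpoly_eval_nonzero[of "p - q"] by (auto simp: mpoly_eval_diff)

lemma homogeneous_add: "homogeneous d p \<Longrightarrow> homogeneous d q \<Longrightarrow> homogeneous d (p + q)"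
  unfolding homogeneous_def using Poly_Mapping.keys_add[of p q] by blast

lemma homogeneous_uminus: "homogeneous d (- p) \<longleftrightarrow> homogeneous d p"
  by (simp add: homogeneous_def)

lemma homogeneous_zero: "homogeneous d 0"
  by (simp add: homogeneous_def)

lemma homogeneous_linear: "homogeneous 1 (\<Sum>i\<in>A. Poly_Mapping.single (Poly_Mapping.single i 1) (c i))"
proof (induction A rule: infinite_finite_induct)
  case (insert i A)
  have "homogeneous 1 (Poly_Mapping.single (Poly_Mapping.single i 1) (c i))"
    unfolding homogeneous_def by (auto simp: lookup_single when_def)
  thus ?case using insert by (simp add: homogeneous_add)
qed (simp_all add: homogeneous_zero)

section \<open>Linear forms and Pfaffians of linear forms\<close>

no_notation vec_index (infixl "$" 100)

definition linear_form :: "('a::field ^ 'n \<Rightarrow> 'a) \<Rightarrow> bool" where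
  "linear_form f \<longleftrightarrow> (\<forall>x y. f (x + y) = f x + f y) \<and> (\<forall>c x. f (c *s x) = c * f x)"

lemma linear_form_add: "linear_form f \<Longrightarrow> f (x + y) = f x + f y"
  and linear_form_scale: "linear_form f \<Longrightarrow> f (c *s x) = c * f x"
  by (simp_all add: linear_form_def)

lemma linear_form_zero: "linear_form f \<Longrightarrow> f 0 = 0"
  using linear_form_scale[of f 0 0] by simp

lemma linear_form_sum: "linear_form f \<Longrightarrow> f (\<Sum>i\<in>A. g i) = (\<Sum>i\<in>A. f (g i))"
  by (induction A rule: infinite_finite_induct) (simp_all add: linear_form_add linear_form_zero)

lemma linear_form_intros [simp, intro]:
  "linear_form (\<lambda>x. 0)"
  "linear_form f \<Longrightarrow> linear_form g \<Longrightarrow> linear_form (\<lambda>x. f x + g x)"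
  "linear_form f \<Longrightarrow> linear_form g \<Longrightarrow> linear_form (\<lambda>x. f x - g x)"
  "linear_form f \<Longrightarrow> linear_form (\<lambda>x. - f x)"
  "linear_form f \<Longrightarrow> linear_form (\<lambda>x. c * f x)"
  "linear_form f \<Longrightarrow> linear_form (\<lambda>x. f x * c)"
  "linear_form f \<Longrightarrow> linear_form (\<lambda>x. f x / c)"
  "linear_form (\<lambda>x. vec_nth x i)"
  by (simp_all add: linear_form_def algebra_simps add_divide_distrib)

lemma linear_form_expand:
  assumes "linear_form f"
  shows "f x = (\<Sum>k\<in>UNIV. f (axis k 1) * vec_nth x k)"
proof -
  have "f x = f (\<Sum>k\<in>UNIV. vec_nth x k *s axis k 1)" by (simp add: basis_expansion)
  thus ?thesis using assms by (simp add: linear_form_sum linear_form_scale mult.commute)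
qed

text \<open>No skew-symmetry is imposed on \<open>a\<close>, because \<open>pfaffian6\<close> reads
  only the entries above the diagonal.\<close>

definition pfaffian_function :: "(complex ^ 'n \<Rightarrow> complex) \<Rightarrow> bool" where
  "pfaffian_function f \<longleftrightarrow>
     (\<exists>a. (\<forall>i j. linear_form (a i j)) \<and> (\<forall>x. f x = pfaffian6 (\<lambda>i j. a i j x)))"

text \<open>A polynomial is determined by its values, so a representation of the function by linear
  forms lifts to an equality of polynomials.\<close>

lemma is_pfaffian_cubicI:
  fixes F :: "'n::finite mpoly"
  assumes "pfaffian_function (\<lambda>x::complex^'n. mpoly_eval F (vec_nth x))"
  shows "is_pfaffian_cubic F"
proof -
  obtain a where a: "\<And>i j. linear_form (a i j)"
    "\<And>x::complex^'n. mpoly_eval F (vec_nth x) = pfaffian6 (\<lambda>i j. a i j x)"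
    using assms by (auto simp: pfaffian_function_def)
  define L where "L i j = (\<Sum>k\<in>UNIV. Poly_Mapping.single (Poly_Mapping.single k 1) (a i j (axis k 1)) :: 'n mpoly)" for i j
  have L: "mpoly_eval (L i j) (vec_nth x) = a i j x" for i j x
  proof -
    have "mpoly_eval (Poly_Mapping.single (Poly_Mapping.single k 1) c) y = c * y k" for k :: 'n and c y
      using mpoly_eval_var[of k y] by (simp add: mpoly_eval_single var_def)
    thus ?thesis by (simp add: L_def mpoly_eval_sum linear_form_expand[OF a(1), of i j x])
  qed
  define M where "M = Matrix.mat 6 6 (\<lambda>(i, j). if i < j then L i j else if j < i then - L j i else 0)"
  have M: "M \<in> carrier_mat 6 6" by (simp add: M_def)
  have Mij: "M $$ (i, j) = L i j" if "i < j" "j < 6" for i j using that by (simp add: M_def)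
  have "transpose_mat M = - M"
  proof (rule eq_matI)
    fix i j assume "i < dim_row (- M)" "j < dim_col (- M)"
    hence "i < 6" "j < 6" by (simp_all add: M_def)
    thus "transpose_mat M $$ (i, j) = (- M) $$ (i, j)"
      by (cases i j rule: linorder_cases) (simp_all add: M_def)
  qed (simp_all add: M_def)
  moreover have "homogeneous 1 (M $$ (i, j))" if "i < 6" "j < 6" for i j
  proof -
    have "homogeneous 1 (L i j)" for i j unfolding L_def by (rule homogeneous_linear)
    thus ?thesis using that by (simp add: M_def homogeneous_uminus homogeneous_zero)
  qed
  moreover have "F = pfaffian 3 M"
  proof (rule mpoly_eqI)
    fix x
    have "pfaffian 3 M = pfaffian6 L" by (simp add: pfaffian_3 pfaffian6_def Mij)
    hence "mpoly_eval (pfaffian 3 M) (vec_nth (vec_lambda x)) = mpoly_eval F (vec_nth (vec_lambda x))"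
      unfolding a(2) by (simp only: pfaffian6_def L mpoly_eval_add mpoly_eval_diff mpoly_eval_mult)
    thus "mpoly_eval F x = mpoly_eval (pfaffian 3 M) x" by (simp add: vec_lambda_inverse)
  qed
  hence "same_hypersurface F (pfaffian 3 M)" by (simp add: same_hypersurface_def)
  ultimately show ?thesis using M unfolding is_pfaffian_cubic_def by blast
qed

locale symmetric_trilinear =
  fixes t :: "complex ^ 'n \<Rightarrow> complex ^ 'n \<Rightarrow> complex ^ 'n \<Rightarrow> complex"
  assumes add1: "t (x + y) u v = t x u v + t y u v"
    and scale1: "t (c *s x) u v = c * t x u v"
    and sym12: "t x y z = t y x z"
    and sym23: "t x y z = t x z y"

text \<open>Peels one variable off a monomial; three applications turn a cubic monomial into
  \<open>x i * x j * x k\<close>.\<close>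

lemma monomial_split:
  fixes m :: "'v::finite \<Rightarrow>\<^sub>0 nat"
  assumes "(\<Sum>i\<in>UNIV. Poly_Mapping.lookup m i) = Suc d"
  obtains i m' where "(\<Sum>i\<in>UNIV. Poly_Mapping.lookup m' i) = d"
    "\<And>x :: 'v \<Rightarrow> complex. (\<Prod>j\<in>UNIV. x j ^ Poly_Mapping.lookup m j) = x i * (\<Prod>j\<in>UNIV. x j ^ Poly_Mapping.lookup m' j)"
proof -
  obtain i where i: "Poly_Mapping.lookup m i > 0"
    using assms by (metis Zero_not_Suc gr0I sum.neutral)
  define m' where "m' = m - Poly_Mapping.single i 1"
  have m: "Poly_Mapping.lookup m j = (if j = i then 1 else 0) + Poly_Mapping.lookup m' j" for j
    using i by (auto simp: m'_def lookup_minus lookup_single when_def)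
  have "(\<Sum>i\<in>UNIV. Poly_Mapping.lookup m' i) = d"
    using assms by (simp add: m sum.distrib)
  moreover have "(\<Prod>j\<in>UNIV. x j ^ Poly_Mapping.lookup m j) = x i * (\<Prod>j\<in>UNIV. x j ^ Poly_Mapping.lookup m' j)"
    for x :: "'v \<Rightarrow> complex"
  proof -
    have "(\<Prod>j\<in>UNIV. x j ^ (if j = i then 1 else 0 :: nat)) = (\<Prod>j\<in>UNIV. if j = i then x j else 1)"
      by (intro prod.cong) auto
    thus ?thesis by (simp add: m power_add prod.distrib)
  qed
  ultimately show ?thesis using that by blast
qed

text \<open>Polarisation of each monomial: its trilinear version is the average over the six
  orderings of the arguments, which coincide on the diagonal.\<close>

lemma cubic_form_trilinear:
  fixes F :: "'n::finite mpoly"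
  assumes "homogeneous 3 F"
  obtains t where "symmetric_trilinear t" "\<And>x::complex^'n. mpoly_eval F (vec_nth x) = t x x x"
proof -
  have "\<exists>i j k. \<forall>x :: 'n \<Rightarrow> complex. (\<Prod>l\<in>UNIV. x l ^ Poly_Mapping.lookup m l) = x i * x j * x k"
    if m: "m \<in> Poly_Mapping.keys F" for m
  proof -
    have "(\<Sum>i\<in>UNIV. Poly_Mapping.lookup m i) = Suc (Suc (Suc 0))"
      using assms m by (simp add: homogeneous_def)
    then obtain i m1 where 1: "(\<Sum>i\<in>UNIV. Poly_Mapping.lookup m1 i) = Suc (Suc 0)"
      "\<And>x :: 'n \<Rightarrow> complex. (\<Prod>j\<in>UNIV. x j ^ Poly_Mapping.lookup m j) = x i * (\<Prod>j\<in>UNIV. x j ^ Poly_Mapping.lookup m1 j)"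
      using monomial_split by blast
    then obtain j m2 where 2: "(\<Sum>i\<in>UNIV. Poly_Mapping.lookup m2 i) = Suc 0"
      "\<And>x :: 'n \<Rightarrow> complex. (\<Prod>j\<in>UNIV. x j ^ Poly_Mapping.lookup m1 j) = x j * (\<Prod>j\<in>UNIV. x j ^ Poly_Mapping.lookup m2 j)"
      using monomial_split by blast
    then obtain k m3 where 3: "(\<Sum>i\<in>UNIV. Poly_Mapping.lookup m3 i) = 0"
      "\<And>x :: 'n \<Rightarrow> complex. (\<Prod>j\<in>UNIV. x j ^ Poly_Mapping.lookup m2 j) = x k * (\<Prod>j\<in>UNIV. x j ^ Poly_Mapping.lookup m3 j)"
      using monomial_split by blast
    show ?thesis using 1(2) 2(2) 3 by (auto simp: mult.assoc)
  qed
  then obtain i j k where ijk: "\<And>m x. m \<in> Poly_Mapping.keys F \<Longrightarrow>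
      (\<Prod>l\<in>UNIV. x l ^ Poly_Mapping.lookup m l) = x (i m) * x (j m) * (x (k m) :: complex)"
    by metis
  define c where "c m = Poly_Mapping.lookup F m / 6" for m
  define t :: "complex^'n \<Rightarrow> complex^'n \<Rightarrow> complex^'n \<Rightarrow> complex" where
    "t x y z = (\<Sum>m\<in>Poly_Mapping.keys F. c m *
      (vec_nth x (i m) * (vec_nth y (j m) * vec_nth z (k m) + vec_nth z (j m) * vec_nth y (k m)) +
       vec_nth y (i m) * (vec_nth x (j m) * vec_nth z (k m) + vec_nth z (j m) * vec_nth x (k m)) +
       vec_nth z (i m) * (vec_nth x (j m) * vec_nth y (k m) + vec_nth y (j m) * vec_nth x (k m))))" for x y z
  have "symmetric_trilinear t"
  proof
    show "t (x + y) u v = t x u v + t y u v" for x y u v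
      unfolding t_def sum.distrib[symmetric] by (intro sum.cong refl) (simp add: algebra_simps)
    show "t (a *s x) u v = a * t x u v" for a x u v
      unfolding t_def sum_distrib_left by (intro sum.cong refl) (simp add: algebra_simps)
    show "t x y z = t y x z" for x y z
      unfolding t_def by (intro sum.cong refl) (simp add: algebra_simps)
    show "t x y z = t x z y" for x y z
      unfolding t_def by (intro sum.cong refl) (simp add: algebra_simps)
  qed
  moreover have "mpoly_eval F (vec_nth x) = t x x x" for x :: "complex^'n"
    unfolding mpoly_eval_def t_def by (intro sum.cong refl) (simp add: ijk c_def)
  ultimately show ?thesis using that by blast
qed

section \<open>Spans and zeros of forms in few variables\<close>

lemma span_insert_iff: "v \<in> vec.span (insert a S) \<longleftrightarrow> (\<exists>k w. w \<in> vec.span S \<and> v = k *s a + w)"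
  for v a :: "complex ^ 'n"
proof
  assume "v \<in> vec.span (insert a S)"
  then obtain k where "v - k *s a \<in> vec.span S" by (auto simp: vec.span_insert)
  thus "\<exists>k w. w \<in> vec.span S \<and> v = k *s a + w"
    by (intro exI[of _ k] exI[of _ "v - k *s a"]) simp
next
  assume "\<exists>k w. w \<in> vec.span S \<and> v = k *s a + w"
  then obtain k w where "w \<in> vec.span S" "v = k *s a + w" by blast
  thus "v \<in> vec.span (insert a S)" by (auto simp: vec.span_insert intro!: exI[of _ k])
qed

lemma span1_iff: "v \<in> vec.span {a} \<longleftrightarrow> (\<exists>i. v = i *s a)" for v a :: "complex ^ 'n"
  by (simp add: span_insert_iff)

lemma span2_iff: "v \<in> vec.span {a, b} \<longleftrightarrow> (\<exists>i j. v = i *s a + j *s b)" for v a b :: "complex ^ 'n"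
  unfolding span_insert_iff[of v a] span1_iff by blast

lemma span3_iff: "v \<in> vec.span {a, b, c} \<longleftrightarrow> (\<exists>i j k. v = i *s a + j *s b + k *s c)"
  for v a b c :: "complex ^ 'n"
  unfolding span_insert_iff[of v a] span2_iff add.assoc by blast

lemma span4_iff: "v \<in> vec.span {a, b, c, d} \<longleftrightarrow> (\<exists>i j k l. v = i *s a + j *s b + k *s c + l *s d)"
  for v a b c d :: "complex ^ 'n"
  unfolding span_insert_iff[of v a] span3_iff add.assoc by blast

lemma dim_kernel:
  fixes f :: "complex ^ 'n \<Rightarrow> complex"
  assumes f: "linear_form f" and K: "vec.subspace K"
  shows "vec.dim K \<le> Suc (vec.dim (K \<inter> {x. f x = 0}))"
proof (cases "\<exists>v\<in>K. f v \<noteq> 0")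
  case True
  then obtain v where v: "v \<in> K" "f v \<noteq> 0" by blast
  have "K \<subseteq> vec.span (insert v (K \<inter> {x. f x = 0}))"
  proof
    fix x assume x: "x \<in> K"
    have "x - (f x / f v) *s v \<in> K \<inter> {x. f x = 0}"
      using x v K linear_form_add[OF f, of "x - (f x / f v) *s v" "(f x / f v) *s v"]
      by (simp add: vec.subspace_diff vec.subspace_scale linear_form_scale[OF f])
    thus "x \<in> vec.span (insert v (K \<inter> {x. f x = 0}))"
      by (auto simp: vec.span_insert intro: vec.span_base)
  qed
  hence "vec.dim K \<le> vec.dim (insert v (K \<inter> {x. f x = 0}))"
    by (metis vec.dim_span vec.dim_subset)
  also have "\<dots> \<le> Suc (vec.dim (K \<inter> {x. f x = 0}))"
    by (simp add: vec.dim_insert)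
  finally show ?thesis .
next
  case False
  hence "K \<inter> {x. f x = 0} = K" by auto
  thus ?thesis by simp
qed

lemma dim_common_kernel:
  fixes fs :: "(complex ^ 'n \<Rightarrow> complex) list"
  assumes "\<forall>f\<in>set fs. linear_form f"
  shows "vec.subspace {x. \<forall>f\<in>set fs. f x = 0} \<and> CARD('n) \<le> length fs + vec.dim {x. \<forall>f\<in>set fs. f x = 0}"
  using assms
proof (induction fs)
  case Nil
  show ?case using vec_dim_card[where ?'n = 'n and ?'a = complex] by (simp add: vec.subspace_UNIV)
next
  case (Cons f fs)
  let ?K = "{x. \<forall>f\<in>set fs. f x = 0}"
  have e: "{x. \<forall>f\<in>set (f # fs). f x = 0} = ?K \<inter> {x. f x = 0}" by auto
  have "vec.subspace {x. f x = 0}"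
    using Cons.prems by (auto simp: vec.subspace_def linear_form_add linear_form_scale linear_form_zero)
  moreover have "vec.dim ?K \<le> Suc (vec.dim (?K \<inter> {x. f x = 0}))"
    using dim_kernel[of f ?K] Cons by simp
  ultimately show ?case unfolding e using Cons by (auto intro: vec.subspace_inter)
qed

text \<open>The common kernel has too large a dimension to fit into the span. Auxiliary basis
  vectors in prescribed hyperplanes come from here.\<close>

lemma ex_kernel_not_in_span:
  fixes fs :: "(complex ^ 'n \<Rightarrow> complex) list"
  assumes "\<forall>f\<in>set fs. linear_form f" "finite S" "card S + length fs < CARD('n)"
  obtains v where "v \<notin> vec.span S" "\<And>f. f \<in> set fs \<Longrightarrow> f v = 0"
proof -
  let ?K = "{x. \<forall>f\<in>set fs. f x = 0}"
  have "\<not> ?K \<subseteq> vec.span S"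
  proof
    assume "?K \<subseteq> vec.span S"
    hence "vec.dim ?K \<le> card S" using assms(2) by (rule vec.dim_le_card)
    thus False using dim_common_kernel[OF assms(1)] assms(3) by linarith
  qed
  thus ?thesis using that by blast
qed

lemma ex_kernel_not_in_span1:
  fixes f g h :: "complex ^ 5 \<Rightarrow> complex"
  assumes "linear_form f" "linear_form g" "linear_form h"
  obtains v where "v \<notin> vec.span {a}" "f v = 0" "g v = 0" "h v = 0"
proof -
  obtain v where "v \<notin> vec.span {a}" "\<And>k. k \<in> set [f, g, h] \<Longrightarrow> k v = 0"
    by (rule ex_kernel_not_in_span[of "[f, g, h]" "{a}"]) (use assms in auto)
  thus ?thesis using that by simp
qed

lemma ex_kernel_not_in_span2:
  fixes f g :: "complex ^ 5 \<Rightarrow> complex"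
  assumes "linear_form f" "linear_form g"
  obtains v where "v \<notin> vec.span {a, b}" "f v = 0" "g v = 0"
proof -
  have "card {a, b} + length [f, g] < CARD(5)" using card_length[of "[a, b]"] by simp
  then obtain v where "v \<notin> vec.span {a, b}" "\<And>k. k \<in> set [f, g] \<Longrightarrow> k v = 0"
    by (rule ex_kernel_not_in_span[rotated 2]) (use assms in auto)
  thus ?thesis using that by simp
qed

lemma ex_kernel_not_in_span3:
  fixes f :: "complex ^ 5 \<Rightarrow> complex"
  assumes "linear_form f"
  obtains v where "v \<notin> vec.span {a, b, c}" "f v = 0"
proof -
  have "card {a, b, c} + length [f] < CARD(5)" using card_length[of "[a, b, c]"] by simp
  then obtain v where "v \<notin> vec.span {a, b, c}" "\<And>k. k \<in> set [f] \<Longrightarrow> k v = 0"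
    by (rule ex_kernel_not_in_span[rotated 2]) (use assms in auto)
  thus ?thesis using that by simp
qed

lemma ex_not_in_span4:
  fixes a b c d :: "complex ^ 5"
  obtains v where "v \<notin> vec.span {a, b, c, d}"
proof -
  have "card {a, b, c, d} < CARD(5)" using card_length[of "[a, b, c, d]"] by simp
  thus ?thesis using ex_kernel_not_in_span[of "[]" "{a, b, c, d}"] that by auto
qed

text \<open>Stated through coefficients and not as independence of a set, since a set forgets
  repetitions among the five vectors.\<close>

definition independent_tuple :: "complex ^ 5 \<Rightarrow> complex ^ 5 \<Rightarrow> complex ^ 5 \<Rightarrow> complex ^ 5 \<Rightarrow> complex ^ 5 \<Rightarrow> bool" where
  "independent_tuple a b c d e \<longleftrightarrow>
     (\<forall>i j k l m. i *s a + j *s b + k *s c + l *s d + m *s e = 0 \<longrightarrow> i = 0 \<and> j = 0 \<and> k = 0 \<and> l = 0 \<and> m = 0)"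

lemma coefficient_zero:
  fixes v w :: "complex ^ 'n"
  assumes "w + k *s v = 0" "w \<in> vec.span S" "v \<notin> vec.span S"
  shows "k = 0"
proof (rule ccontr)
  assume k: "k \<noteq> 0"
  have "k *s v = - w" using assms(1) by (simp add: eq_neg_iff_add_eq_0 add.commute)
  moreover have "v = (1 / k) *s (k *s v)" using k by simp
  ultimately have "v = (1 / k) *s (- w)" by simp
  thus False using assms(2,3) by (metis vec.span_neg vec.span_scale)
qed

lemma independent_tupleI:
  assumes "a \<noteq> 0" "b \<notin> vec.span {a}" "c \<notin> vec.span {a, b}" "d \<notin> vec.span {a, b, c}" "e \<notin> vec.span {a, b, c, d}"
  shows "independent_tuple a b c d e"
  unfolding independent_tuple_def
proof (intro allI impI)
  fix i j k l m assume *: "i *s a + j *s b + k *s c + l *s d + m *s e = 0"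
  have m: "m = 0" using coefficient_zero[OF * _ assms(5)] unfolding span4_iff by blast
  have l: "l = 0"
    by (rule coefficient_zero[OF _ _ assms(4), where w = "i *s a + j *s b + k *s c"])
       (use * m in \<open>simp\<close>, unfold span3_iff, blast)
  have k: "k = 0"
    by (rule coefficient_zero[OF _ _ assms(3), where w = "i *s a + j *s b"]) (use * l m in \<open>simp\<close>, unfold span2_iff, blast)
  have j: "j = 0"
    by (rule coefficient_zero[OF _ _ assms(2), where w = "i *s a"]) (use * k l m in \<open>simp\<close>, unfold span1_iff, blast)
  show "i = 0 \<and> j = 0 \<and> k = 0 \<and> l = 0 \<and> m = 0" using * j k l m assms(1) by simp
qed

text \<open>Coordinates are chosen separately for each vector; uniqueness of the coefficients makes
  them linear.\<close>

lemma independent_tuple_coordinates: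
  assumes "independent_tuple a b c d e"
  obtains x1 x2 x3 x4 x5 where
    "linear_form x1" "linear_form x2" "linear_form x3" "linear_form x4" "linear_form x5"
    "\<And>v. v = x1 v *s a + x2 v *s b + x3 v *s c + x4 v *s d + x5 v *s e"
proof -
  have ind: "i = 0 \<and> j = 0 \<and> k = 0 \<and> l = 0 \<and> m = 0"
    if "i *s a + j *s b + k *s c + l *s d + m *s e = 0" for i j k l m
    using assms that unfolding independent_tuple_def by blast
  have e0: "e \<noteq> 0" using ind[of 0 0 0 0 1] by auto
  have d: "d \<notin> vec.span {e}"
  proof
    assume "d \<in> vec.span {e}"
    then obtain i where "d = i *s e" by (auto simp: span1_iff)
    thus False using ind[of 0 0 0 1 "-i"] by simp
  qed
  have c: "c \<notin> vec.span {d, e}"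
  proof
    assume "c \<in> vec.span {d, e}"
    then obtain i j where "c = i *s d + j *s e" by (auto simp: span2_iff)
    thus False using ind[of 0 0 1 "-i" "-j"] by simp
  qed
  have b: "b \<notin> vec.span {c, d, e}"
  proof
    assume "b \<in> vec.span {c, d, e}"
    then obtain i j k where "b = i *s c + j *s d + k *s e" by (auto simp: span3_iff)
    thus False using ind[of 0 1 "-i" "-j" "-k"] by simp
  qed
  have a: "a \<notin> vec.span {b, c, d, e}"
  proof
    assume "a \<in> vec.span {b, c, d, e}"
    then obtain i j k l where "a = i *s b + j *s c + k *s d + l *s e" by (auto simp: span4_iff)
    thus False using ind[of 1 "-i" "-j" "-k" "-l"] by simp
  qed
  have I: "vec.independent {a, b, c, d, e}"
    by (intro vec.independent_insertI a b c d vec.independent_empty) (simp add: e0)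
  have "a \<notin> {b, c, d, e}" "b \<notin> {c, d, e}" "c \<notin> {d, e}" "d \<notin> {e}"
    by (use a in \<open>blast intro: vec.span_base\<close>, use b in \<open>blast intro: vec.span_base\<close>,
        use c in \<open>blast intro: vec.span_base\<close>, use d in \<open>blast intro: vec.span_base\<close>)
  hence card: "card {a, b, c, d, e} = 5" by simp
  have "vec.dim (UNIV :: (complex ^ 5) set) \<le> card {a, b, c, d, e}" unfolding vec_dim_card card by simp
  hence "vec.span {a, b, c, d, e} = UNIV"
    using vec.card_ge_dim_independent[OF subset_UNIV I] by blast
  hence sp: "\<exists>i w. w \<in> vec.span {b, c, d, e} \<and> v = i *s a + w" for v
    using span_insert_iff[of v a "{b, c, d, e}"] by simp
  have "\<exists>i j k l m. v = i *s a + j *s b + k *s c + l *s d + m *s e" for v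
  proof -
    obtain i w where "w \<in> vec.span {b, c, d, e}" "v = i *s a + w" using sp by blast
    moreover from this(1) obtain j k l m where "w = j *s b + k *s c + l *s d + m *s e" by (auto simp: span4_iff)
    ultimately have "v = i *s a + j *s b + k *s c + l *s d + m *s e" by (simp add: add.assoc)
    thus ?thesis by blast
  qed
  hence "\<forall>v. \<exists>i j k l m. v = i *s a + j *s b + k *s c + l *s d + m *s e" by blast
  from this[unfolded choice_iff] obtain x1 x2 x3 x4 x5 where x: "\<And>v. v = x1 v *s a + x2 v *s b + x3 v *s c + x4 v *s d + x5 v *s e"
    by blast
  have uniq: "i = x1 v \<and> j = x2 v \<and> k = x3 v \<and> l = x4 v \<and> m = x5 v"
    if "v = i *s a + j *s b + k *s c + l *s d + m *s e" for v i j k l m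
  proof -
    have "(i - x1 v) *s a + (j - x2 v) *s b + (k - x3 v) *s c + (l - x4 v) *s d + (m - x5 v) *s e =
      (i *s a + j *s b + k *s c + l *s d + m *s e) - (x1 v *s a + x2 v *s b + x3 v *s c + x4 v *s d + x5 v *s e)"
      by (simp add: vec.scale_left_diff_distrib)
    also have "\<dots> = 0" using that x[of v] by simp
    finally have "(i - x1 v) *s a + (j - x2 v) *s b + (k - x3 v) *s c + (l - x4 v) *s d + (m - x5 v) *s e = 0" .
    from ind[OF this] show ?thesis by simp
  qed
  have "x1 v + x1 w = x1 (v + w) \<and> x2 v + x2 w = x2 (v + w) \<and> x3 v + x3 w = x3 (v + w) \<and>
      x4 v + x4 w = x4 (v + w) \<and> x5 v + x5 w = x5 (v + w)" for v w
  proof (rule uniq)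
    have "v + w = (x1 v *s a + x2 v *s b + x3 v *s c + x4 v *s d + x5 v *s e) +
      (x1 w *s a + x2 w *s b + x3 w *s c + x4 w *s d + x5 w *s e)"
      using x[of v] x[of w] by simp
    thus "v + w = (x1 v + x1 w) *s a + (x2 v + x2 w) *s b + (x3 v + x3 w) *s c + (x4 v + x4 w) *s d + (x5 v + x5 w) *s e"
      by (simp only: vec.scale_left_distrib ac_simps)
  qed
  moreover have "s * x1 v = x1 (s *s v) \<and> s * x2 v = x2 (s *s v) \<and> s * x3 v = x3 (s *s v) \<and>
      s * x4 v = x4 (s *s v) \<and> s * x5 v = x5 (s *s v)" for s v
  proof (rule uniq)
    have "s *s v = s *s (x1 v *s a + x2 v *s b + x3 v *s c + x4 v *s d + x5 v *s e)"
      using x[of v] by simp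
    thus "s *s v = (s * x1 v) *s a + (s * x2 v) *s b + (s * x3 v) *s c + (s * x4 v) *s d + (s * x5 v) *s e"
      by (simp only: vec.scale_right_distrib vec.scale_scale)
  qed
  ultimately show ?thesis using that[of x1 x2 x3 x4 x5] x by (simp add: linear_form_def)
qed

section \<open>Zeros of binary forms\<close>

definition polyfun :: "(complex \<Rightarrow> complex) \<Rightarrow> bool" where
  "polyfun h \<longleftrightarrow> (\<exists>p. h = poly p)"

lemma polyfun_intros [intro]:
  "polyfun (\<lambda>x. c)" "polyfun (\<lambda>x. x)"
  "polyfun f \<Longrightarrow> polyfun g \<Longrightarrow> polyfun (\<lambda>x. f x + g x)"
  "polyfun f \<Longrightarrow> polyfun g \<Longrightarrow> polyfun (\<lambda>x. f x - g x)"
  "polyfun f \<Longrightarrow> polyfun g \<Longrightarrow> polyfun (\<lambda>x. f x * g x)"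
  "polyfun f \<Longrightarrow> polyfun (\<lambda>x. - f x)"
  "polyfun f \<Longrightarrow> polyfun (\<lambda>x. f x ^ n)"
proof -
  show "polyfun (\<lambda>x. c)" unfolding polyfun_def by (rule exI[of _ "[:c:]"]) auto
  show "polyfun (\<lambda>x. x)" unfolding polyfun_def by (rule exI[of _ "[:0, 1:]"]) auto
  assume "polyfun f"
  then obtain p where p: "f = poly p" by (auto simp: polyfun_def)
  show "polyfun (\<lambda>x. - f x)" unfolding polyfun_def p by (rule exI[of _ "-p"]) auto
  show "polyfun (\<lambda>x. f x ^ n)" unfolding polyfun_def p by (rule exI[of _ "p ^ n"]) auto
  assume "polyfun g"
  then obtain q where q: "g = poly q" by (auto simp: polyfun_def)
  show "polyfun (\<lambda>x. f x + g x)" unfolding polyfun_def p q by (rule exI[of _ "p + q"]) auto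
  show "polyfun (\<lambda>x. f x - g x)" unfolding polyfun_def p q by (rule exI[of _ "p - q"]) auto
  show "polyfun (\<lambda>x. f x * g x)" unfolding polyfun_def p q by (rule exI[of _ "p * q"]) auto
qed

lemma polyfun_finite_zeros:
  assumes "polyfun h" "h a \<noteq> 0"
  shows "finite {x. h x = 0}"
proof -
  obtain p where p: "h = poly p" using assms(1) by (auto simp: polyfun_def)
  hence "p \<noteq> 0" using assms(2) by auto
  thus ?thesis unfolding p by (rule poly_roots_finite)
qed

text \<open>A root of the dehomogenisation \<open>h s 1\<close> is a zero. If there is none, it is a
  constant \<open>c\<close>; homogeneity then gives \<open>h 1 u = c * u ^ d\<close>, so that the
  point \<open>(1, 0)\<close> at infinity is a zero.\<close>

lemma binary_form_zero:
  fixes h :: "complex \<Rightarrow> complex \<Rightarrow> complex"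
  assumes hom: "\<And>k s u. h (k * s) (k * u) = k ^ d * h s u" and d: "d > 0"
    and "polyfun (\<lambda>s. h s 1)" "polyfun (\<lambda>u. h 1 u)"
  obtains s u where "s \<noteq> 0 \<or> u \<noteq> 0" "h s u = 0"
proof -
  obtain p q where p: "\<And>s. h s 1 = poly p s" and q: "\<And>u. h 1 u = poly q u"
    using assms(3,4) by (auto simp: polyfun_def fun_eq_iff)
  show ?thesis
  proof (cases "degree p = 0")
    case False
    then obtain s where "poly p s = 0" using alg_closed_imp_poly_has_root[of p] by auto
    thus ?thesis using p that[of s 1] by simp
  next
    case True
    then obtain c where c: "p = [:c:]" by (metis degree_0_id)
    have "poly (q - monom c d) u = 0" if "u \<noteq> 0" for u
      using hom[of u "1 / u" 1] that p[of "1 / u"] q[of u] by (simp add: c poly_monom)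
    hence "- {0} \<subseteq> {u. poly (q - monom c d) u = 0}" by auto
    moreover have "infinite (- {0 :: complex})"
      by (simp add: infinite_UNIV_char_0 Finite_Set.finite_compl)
    ultimately have "q - monom c d = 0"
      using poly_roots_finite[of "q - monom c d"] finite_subset by blast
    hence "poly q 0 = 0" using d by (simp add: poly_monom power_0_left)
    thus ?thesis using q[of 0] that[of 1 0] by simp
  qed
qed

lemma binary_quadratic_zero:
  obtains s u :: complex where "s \<noteq> 0 \<or> u \<noteq> 0" "a * s\<^sup>2 + b * s * u + c * u\<^sup>2 = 0"
  by (rule binary_form_zero[of "\<lambda>s u. a * s\<^sup>2 + b * s * u + c * u\<^sup>2" 2])
     (auto simp: power2_eq_square algebra_simps intro!: polyfun_intros)

lemma binary_cubic_zero:
  obtains s u :: complex where "s \<noteq> 0 \<or> u \<noteq> 0" "a * s ^ 3 + b * s\<^sup>2 * u + c * s * u\<^sup>2 + d * u ^ 3 = 0"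
  by (rule binary_form_zero[of "\<lambda>s u. a * s ^ 3 + b * s\<^sup>2 * u + c * s * u\<^sup>2 + d * u ^ 3" 3])
     (auto simp: power2_eq_square power3_eq_cube algebra_simps intro!: polyfun_intros)

section \<open>Restriction of the cubic to lines and conics\<close>

context symmetric_trilinear
begin

lemma add2: "t x (u + v) y = t x u y + t x v y"
  and scale2: "t x (c *s u) y = c * t x u y"
  by (metis add1 sym12, metis scale1 sym12)

lemma add3: "t x y (u + v) = t x y u + t x y v"
  and scale3: "t x y (c *s u) = c * t x y u"
  by (metis add2 sym23, metis scale2 sym23)

lemma zero1: "t 0 x y = 0" and zero2: "t x 0 y = 0" and zero3: "t x y 0 = 0"
  using scale1[of 0] scale2[of _ 0] scale3[of _ _ 0] by (metis mult_zero_left vec.scale_zero_left)+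

lemma minus1: "t (- x) y z = - t x y z"
  using add1[of x "- x" y z] by (simp add: zero1 eq_neg_iff_add_eq_0 add.commute)

lemma minus2: "t x (- y) z = - t x y z"
  using add2[of x y "- y" z] by (simp add: zero2 eq_neg_iff_add_eq_0 add.commute)

lemma minus3: "t x y (- z) = - t x y z"
  using add3[of x y z "- z"] by (simp add: zero3 eq_neg_iff_add_eq_0 add.commute)

lemma diff1: "t (x - w) y z = t x y z - t w y z"
  using add1[of x "- w" y z] by (simp add: minus1)

lemma diff2: "t x (y - w) z = t x y z - t x w z"
  using add2[of x y "- w" z] by (simp add: minus2)

lemma diff3: "t x y (z - w) = t x y z - t x y w"
  using add3[of x y z "- w"] by (simp add: minus3)

lemmas trilinear = add1 add2 add3 scale1 scale2 scale3 zero1 zero2 zero3 minus1 minus2 minus3 diff1 diff2 diff3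

lemmas symmetric = sym12 sym23

lemma linear_form_third [simp, intro]: "linear_form (t x y)"
  by (simp add: linear_form_def trilinear)

lemma polyfun_cubic:
  assumes "polyfun f" "polyfun g" "polyfun h"
  shows "polyfun (\<lambda>z. t (f z *s a + g z *s b + h z *s c) (f z *s a + g z *s b + h z *s c) (f z *s a + g z *s b + h z *s c))"
  unfolding add1 add2 add3 scale1 scale2 scale3 by (intro polyfun_intros assms)

lemma binary_cubic_form:
  "t (s *s a + u *s b) (s *s a + u *s b) (s *s a + u *s b) =
     t a a a * s ^ 3 + 3 * t a a b * s\<^sup>2 * u + 3 * t a b b * s * u\<^sup>2 + t b b b * u ^ 3"
  by (simp add: trilinear symmetric power2_eq_square power3_eq_cube algebra_simps)

lemma binary_quadratic_form:
  "t p (s *s a + u *s b) (s *s a + u *s b) = t p a a * s\<^sup>2 + 2 * t p a b * s * u + t p b b * u\<^sup>2"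
  by (simp add: trilinear symmetric power2_eq_square algebra_simps)

lemma ex_zero_on_line:
  obtains s u where "s \<noteq> 0 \<or> u \<noteq> 0" "t (s *s a + u *s b) (s *s a + u *s b) (s *s a + u *s b) = 0"
  using binary_cubic_zero[of "t a a a" "3 * t a a b" "3 * t a b b" "t b b b"] unfolding binary_cubic_form by blast

lemma ex_isotropic_on_line:
  obtains s u where "s \<noteq> 0 \<or> u \<noteq> 0" "t p (s *s a + u *s b) (s *s a + u *s b) = 0"
  using binary_quadratic_zero[of "t p a a" "2 * t p a b" "t p b b"] unfolding binary_quadratic_form by blast

text \<open>A conic with a point \<open>r\<close> is parametrised by the lines through \<open>r\<close>; a parameter value at which the
  parametrisation vanishes gives a line through \<open>r\<close> contained in the conic.\<close>

lemma pointed_conic_meets_cubic: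
  assumes r: "t p r r = 0"
  obtains x y z where "x \<noteq> 0 \<or> y \<noteq> 0 \<or> z \<noteq> 0"
    "t p (x *s r + y *s e + z *s f) (x *s r + y *s e + z *s f) = 0"
    "t (x *s r + y *s e + z *s f) (x *s r + y *s e + z *s f) (x *s r + y *s e + z *s f) = 0"
proof -
  define Q where "Q s u = t p e e * s\<^sup>2 + 2 * t p e f * s * u + t p f f * u\<^sup>2" for s u
  define L where "L s u = 2 * t p r e * s + 2 * t p r f * u" for s u
  have con: "t p (x *s r + y *s e + z *s f) (x *s r + y *s e + z *s f) = x * L y z + Q y z" for x y z
    using r by (simp add: L_def Q_def trilinear symmetric power2_eq_square algebra_simps)
  \<comment> \<open>The further point of the conic on the line joining \<open>r\<close> to
    \<open>s *s e + u *s f\<close>. It is quadratic in \<open>s, u\<close>, hence the cubic becomes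
    a binary sextic.\<close>
  define v where "v s u = (- Q s u) *s r + (s * L s u) *s e + (u * L s u) *s f" for s u
  have "\<exists>s u. (s \<noteq> 0 \<or> u \<noteq> 0) \<and> t (v s u) (v s u) (v s u) = 0"
  proof -
    have "v (k * s) (k * u) = k\<^sup>2 *s v s u" for k s u
      by (simp add: v_def Q_def L_def vec.scale_right_distrib power2_eq_square algebra_simps)
    hence "t (v (k * s) (k * u)) (v (k * s) (k * u)) (v (k * s) (k * u)) = k ^ 6 * t (v s u) (v s u) (v s u)" for k s u
      by (simp add: trilinear power2_eq_square eval_nat_numeral)
    moreover have "polyfun (\<lambda>s. t (v s 1) (v s 1) (v s 1))"
      unfolding v_def by (rule polyfun_cubic) (auto simp: Q_def L_def intro!: polyfun_intros)
    moreover have "polyfun (\<lambda>u. t (v 1 u) (v 1 u) (v 1 u))"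
      unfolding v_def by (rule polyfun_cubic) (auto simp: Q_def L_def intro!: polyfun_intros)
    ultimately show ?thesis using binary_form_zero[of "\<lambda>s u. t (v s u) (v s u) (v s u)" 6] by (metis zero_less_numeral)
  qed
  then obtain s u where su: "s \<noteq> 0 \<or> u \<noteq> 0" "t (v s u) (v s u) (v s u) = 0" by blast
  show ?thesis
  proof (cases "L s u = 0")
    case False
    have "- Q s u * L (s * L s u) (u * L s u) + Q (s * L s u) (u * L s u) = 0"
      by (simp add: Q_def L_def power2_eq_square algebra_simps)
    hence "t p (v s u) (v s u) = 0" unfolding v_def con .
    moreover have "s * L s u \<noteq> 0 \<or> u * L s u \<noteq> 0" using su(1) False by simp
    ultimately show ?thesis using that[of "- Q s u" "s * L s u" "u * L s u"] su(2) unfolding v_def by blast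
  next
    case L: True
    show ?thesis
    proof (cases "Q s u = 0")
      case False
      \<comment> \<open>Here the parametrisation passes through \<open>r\<close>:
        \<open>v s u\<close> is a nonzero multiple of it.\<close>
      hence "t r r r = 0" using su L by (simp add: v_def trilinear)
      thus ?thesis using that[of 1 0 0] r by simp
    next
      case True
      obtain k l where kl: "k \<noteq> 0 \<or> l \<noteq> 0"
        "t (k *s r + l *s (s *s e + u *s f)) (k *s r + l *s (s *s e + u *s f)) (k *s r + l *s (s *s e + u *s f)) = 0"
        by (rule ex_zero_on_line)
      have eq: "k *s r + l *s (s *s e + u *s f) = k *s r + (l * s) *s e + (l * u) *s f"
        by (simp add: vec.scale_right_distrib)
      have "k * L (l * s) (l * u) + Q (l * s) (l * u) = k * l * L s u + l\<^sup>2 * Q s u"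
        by (simp add: Q_def L_def power2_eq_square algebra_simps)
      thus ?thesis using that[of k "l * s" "l * u"] kl su L True con unfolding eq by auto
    qed
  qed
qed

end

section \<open>Lines through a point of the threefold\<close>

locale cubic_fourspace = symmetric_trilinear t for t :: "complex ^ 5 \<Rightarrow> complex ^ 5 \<Rightarrow> complex ^ 5 \<Rightarrow> complex"
begin

text \<open>The directions of lines through \<open>y\<close> form, inside the tangent hyperplane
  modulo \<open>y\<close>, the intersection of a conic and a cubic. With \<open>a, b, c\<close> as
  coordinates this takes place in a projective plane, where the two curves meet.\<close>

lemma ex_line_through:
  assumes y: "y \<noteq> 0" "t y y y = 0"
  obtains d where "d \<notin> vec.span {y}" "t y y d = 0" "t y d d = 0" "t d d d = 0"
proof -
  have lf: "\<forall>f\<in>set [t y y]. linear_form f" by simp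
  obtain a where a: "a \<notin> vec.span {y}" "t y y a = 0"
    using ex_kernel_not_in_span[OF lf, of "{y}"] by auto
  have "card {y, a} + length [t y y] < CARD(5)" by (simp add: card_insert_if)
  then obtain b where b: "b \<notin> vec.span {y, a}" "t y y b = 0"
    using ex_kernel_not_in_span[OF lf, of "{y, a}"] by auto
  have "card {y, a, b} + length [t y y] < CARD(5)" by (simp add: card_insert_if)
  then obtain c where c: "c \<notin> vec.span {y, a, b}" "t y y c = 0"
    using ex_kernel_not_in_span[OF lf, of "{y, a, b}"] by auto
  have "card {y, a, b, c} < CARD(5)" by (simp add: card_insert_if)
  then obtain h where h: "h \<notin> vec.span {y, a, b, c}"
    using ex_kernel_not_in_span[of "[]" "{y, a, b, c}"] by auto
  have ind: "i = 0 \<and> j = 0 \<and> k = 0 \<and> l = 0" if "i *s y + j *s a + k *s b + l *s c = 0" for i j k l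
    using independent_tupleI[OF y(1) a(1) b(1) c(1) h] that unfolding independent_tuple_def
    by (metis add.right_neutral vec.scale_zero_left)
  obtain s u where su: "s \<noteq> 0 \<or> u \<noteq> 0" "t y (s *s a + u *s b) (s *s a + u *s b) = 0"
    by (rule ex_isotropic_on_line)
  define r where "r = s *s a + u *s b"
  \<comment> \<open>Whichever of \<open>a, b\<close> is independent of the conic point
    \<open>r\<close>, so that \<open>r, e, c\<close> span the same plane as
    \<open>a, b, c\<close>.\<close>
  define e where "e = (if s = 0 then a else b)"
  obtain i j k where ijk: "i \<noteq> 0 \<or> j \<noteq> 0 \<or> k \<noteq> 0"
    "t y (i *s r + j *s e + k *s c) (i *s r + j *s e + k *s c) = 0"
    "t (i *s r + j *s e + k *s c) (i *s r + j *s e + k *s c) (i *s r + j *s e + k *s c) = 0"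
    using pointed_conic_meets_cubic[of y r e c] su by (auto simp: r_def)
  let ?d = "i *s r + j *s e + k *s c"
  have d: "?d = (i * s + (if s = 0 then j else 0)) *s a + (i * u + (if s = 0 then 0 else j)) *s b + k *s c"
    by (simp add: r_def e_def vec.scale_right_distrib vec.scale_left_distrib add_ac)
  have "?d \<notin> vec.span {y}"
  proof
    assume "?d \<in> vec.span {y}"
    then obtain m where "?d = m *s y" by (auto simp: span1_iff)
    hence "(i * s + (if s = 0 then j else 0)) *s a + (i * u + (if s = 0 then 0 else j)) *s b + k *s c = m *s y"
      by (simp only: d)
    hence "(- m) *s y + ((i * s + (if s = 0 then j else 0)) *s a + (i * u + (if s = 0 then 0 else j)) *s b + k *s c) = 0"
      by (simp only: vec.scale_minus_left add.left_inverse)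
    hence "(- m) *s y + (i * s + (if s = 0 then j else 0)) *s a + (i * u + (if s = 0 then 0 else j)) *s b + k *s c = 0"
      by (simp only: add.assoc)
    from ind[OF this] show False using ijk(1) su(1) by (auto split: if_splits)
  qed
  moreover have "t y y ?d = 0" using a b c by (simp add: r_def e_def trilinear)
  ultimately show ?thesis using that[of ?d] ijk(2,3) by simp
qed

end

text \<open>Row by row listing of the fifteen entries above the diagonal; a Pfaffian representation
  is then given by naming them in this order.\<close>

lemma pfaffian_functionI:
  assumes lin: "linear_form a01" "linear_form a02" "linear_form a03" "linear_form a04" "linear_form a05"
      "linear_form a12" "linear_form a13" "linear_form a14" "linear_form a15"
      "linear_form a23" "linear_form a24" "linear_form a25" "linear_form a34" "linear_form a35" "linear_form a45"
    and f: "\<And>x. f x =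
      a01 x * a23 x * a45 x - a01 x * a24 x * a35 x + a01 x * a25 x * a34 x
      - a02 x * a13 x * a45 x + a02 x * a14 x * a35 x - a02 x * a15 x * a34 x
      + a03 x * a12 x * a45 x - a03 x * a14 x * a25 x + a03 x * a15 x * a24 x
      - a04 x * a12 x * a35 x + a04 x * a13 x * a25 x - a04 x * a15 x * a23 x
      + a05 x * a12 x * a34 x - a05 x * a13 x * a24 x + a05 x * a14 x * a23 x"
  shows "pfaffian_function f"
proof -
  define a where "a i j = (
    if i = 0 then (if j = 1 then a01 else if j = 2 then a02 else if j = 3 then a03 else if j = 4 then a04 else a05)
    else if i = 1 then (if j = 2 then a12 else if j = 3 then a13 else if j = 4 then a14 else a15)
    else if i = 2 then (if j = 3 then a23 else if j = 4 then a24 else a25)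
    else if i = 3 then (if j = 4 then a34 else a35)
    else a45)" for i j :: nat
  have "linear_form (a i j)" for i j using lin by (simp add: a_def)
  moreover have "f x = pfaffian6 (\<lambda>i j. a i j x)" for x
    by (simp add: f pfaffian6_def a_def)
  ultimately show ?thesis unfolding pfaffian_function_def by blast
qed

section \<open>Quadratic forms as sums of products\<close>

lemma binary_quadratic_product:
  fixes m n :: "complex ^ 'n \<Rightarrow> complex"
  assumes "linear_form m" "linear_form n"
  obtains u v where "linear_form u" "linear_form v"
    "\<And>x. a * m x * m x + b * m x * n x + c * n x * n x = u x * v x"
proof (cases "a = 0")
  case True
  show ?thesis
    by (rule that[of n "\<lambda>x. b * m x + c * n x"]) (use assms True in \<open>auto simp: algebra_simps\<close>)
next
  case False
  define d where "d = csqrt (b\<^sup>2 - 4 * a * c)"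
  have d: "d * d = b\<^sup>2 - 4 * a * c" by (simp add: d_def power2_eq_square[symmetric])
  define k l where "k = (b - d) / (2 * a)" and "l = (b + d) / (2 * a)"
  have "a * (k + l) = b" using False by (simp add: k_def l_def field_simps)
  moreover have "a * (k * l) = c"
  proof -
    have "k * l = (b\<^sup>2 - d * d) / (4 * a * a)" by (simp add: k_def l_def power2_eq_square algebra_simps)
    thus ?thesis unfolding d using False by (simp add: field_simps)
  qed
  ultimately have "b = a * (k + l)" "c = a * (k * l)" by simp_all
  show ?thesis
    by (rule that[of "\<lambda>x. a * (m x + k * n x)" "\<lambda>x. m x + l * n x"])
       (use assms in \<open>auto simp: \<open>b = _\<close> \<open>c = _\<close> algebra_simps intro!: linear_form_intros\<close>)
qed

text \<open>If the square of \<open>l\<close> occurs, completing it leaves a binary form, which is a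
  product. Otherwise a mixed term with \<open>l\<close> allows a product to be split off and a
  square remains; without such a term the form is binary.\<close>

lemma ternary_quadratic_rank:
  fixes l m n :: "complex ^ 'n \<Rightarrow> complex"
  assumes "linear_form l" "linear_form m" "linear_form n"
  obtains u v w where "linear_form u" "linear_form v" "linear_form w"
    "\<And>x. a * l x * l x + b * l x * m x + c * l x * n x + d * m x * m x + e * m x * n x + f * n x * n x = u x * v x + w x * w x"
proof (cases "a = 0")
  case False
  define s where "s = csqrt a"
  have s: "s * s = a" "s \<noteq> 0" using False by (simp_all add: s_def power2_eq_square[symmetric])
  define g h where "g = b / (2 * s)" and "h = c / (2 * s)"
  have gh: "b = 2 * s * g" "c = 2 * s * h" using s(2) by (simp_all add: g_def h_def)
  obtain u v where uv: "linear_form u" "linear_form v"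
    "\<And>x. (d - g * g) * m x * m x + (e - 2 * g * h) * m x * n x + (f - h * h) * n x * n x = u x * v x"
    using binary_quadratic_product[OF assms(2,3)] by blast
  show ?thesis
  proof (rule that[of u v "\<lambda>x. s * l x + g * m x + h * n x"])
    show "a * l x * l x + b * l x * m x + c * l x * n x + d * m x * m x + e * m x * n x + f * n x * n x =
      u x * v x + (s * l x + g * m x + h * n x) * (s * l x + g * m x + h * n x)" for x
      unfolding uv(3)[symmetric] gh s(1)[symmetric] by (simp add: algebra_simps)
  qed (use assms uv in \<open>auto intro!: linear_form_intros\<close>)
next
  case a: True
  consider "b \<noteq> 0" | "b = 0" "c \<noteq> 0" | "b = 0" "c = 0" by blast
  thus ?thesis
  proof cases
    case 1
    define g p where "g = c / b" and "p = d / b"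
    define r where "r = e / b - g * p"
    have c: "c = b * g" "d = b * p" "e = b * (r + g * p)" using 1 by (simp_all add: g_def p_def r_def)
    define s where "s = csqrt (f - b * g * r)"
    have "s * s = f - b * g * r" by (simp add: s_def power2_eq_square[symmetric])
    hence f: "f = s * s + b * g * r" by simp
    show ?thesis
    proof (rule that[of "\<lambda>x. b * m x + c * n x" "\<lambda>x. l x + p * m x + r * n x" "\<lambda>x. s * n x"])
      show "a * l x * l x + b * l x * m x + c * l x * n x + d * m x * m x + e * m x * n x + f * n x * n x =
        (b * m x + c * n x) * (l x + p * m x + r * n x) + s * n x * (s * n x)" for x
        unfolding f c a by (simp add: algebra_simps)
    qed (use assms in \<open>auto intro!: linear_form_intros\<close>)
  next
    case 2
    define s where "s = csqrt d"
    have s: "s * s = d" by (simp add: s_def power2_eq_square[symmetric])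
    show ?thesis
    proof (rule that[of n "\<lambda>x. c * l x + e * m x + f * n x" "\<lambda>x. s * m x"])
      show "a * l x * l x + b * l x * m x + c * l x * n x + d * m x * m x + e * m x * n x + f * n x * n x =
        n x * (c * l x + e * m x + f * n x) + s * m x * (s * m x)" for x
        unfolding s[symmetric] a 2 by (simp add: algebra_simps)
    qed (use assms in \<open>auto intro!: linear_form_intros\<close>)
  next
    case 3
    obtain u v where "linear_form u" "linear_form v" "\<And>x. d * m x * m x + e * m x * n x + f * n x * n x = u x * v x"
      using binary_quadratic_product[OF assms(2,3)] by blast
    thus ?thesis by (intro that[of u v "\<lambda>_. 0"]) (auto simp: a 3)
  qed
qed

text \<open>Completing the square in \<open>k\<close> adds a square \<open>y^2\<close> to a ternary
  form \<open>u v + w^2\<close>, and \<open>w^2 + y^2\<close> factors as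
  \<open>(w + \<i> y) (w - \<i> y)\<close>. If the square of \<open>k\<close> is absent,
  \<open>k\<close> times a linear form is made part of one product.\<close>

lemma quaternary_quadratic_two_products:
  fixes k l m n :: "complex ^ 'n \<Rightarrow> complex"
  assumes "linear_form k" "linear_form l" "linear_form m" "linear_form n"
  obtains u v w z where "linear_form u" "linear_form v" "linear_form w" "linear_form z"
    "\<And>x. q * k x * k x + k x * (q1 * l x + q2 * m x + q3 * n x) +
      (a * l x * l x + b * l x * m x + c * l x * n x + d * m x * m x + e * m x * n x + f * n x * n x) = u x * v x + w x * z x"
proof (cases "q = 0")
  case False
  define s where "s = csqrt q"
  have s: "s * s = q" "s \<noteq> 0" using False by (simp_all add: s_def power2_eq_square[symmetric])
  define p1 p2 p3 where "p1 = q1 / (2 * s)" and "p2 = q2 / (2 * s)" and "p3 = q3 / (2 * s)"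
  have p: "q1 = 2 * s * p1" "q2 = 2 * s * p2" "q3 = 2 * s * p3" using s(2) by (simp_all add: p1_def p2_def p3_def)
  obtain u v w where uv: "linear_form u" "linear_form v" "linear_form w"
    "\<And>x. (a - p1 * p1) * l x * l x + (b - 2 * p1 * p2) * l x * m x + (c - 2 * p1 * p3) * l x * n x +
      (d - p2 * p2) * m x * m x + (e - 2 * p2 * p3) * m x * n x + (f - p3 * p3) * n x * n x = u x * v x + w x * w x"
    by (rule ternary_quadratic_rank[OF assms(2,3,4), where a = "a - p1 * p1" and b = "b - 2 * p1 * p2"
      and c = "c - 2 * p1 * p3" and d = "d - p2 * p2" and e = "e - 2 * p2 * p3" and f = "f - p3 * p3"])
      (rule that)
  define y where "y = (\<lambda>x. s * k x + p1 * l x + p2 * m x + p3 * n x)"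
  have y: "linear_form y" unfolding y_def using assms by (auto intro!: linear_form_intros)
  show ?thesis
  proof (rule that[of u v "\<lambda>x. w x + \<i> * y x" "\<lambda>x. w x - \<i> * y x"])
    show "q * k x * k x + k x * (q1 * l x + q2 * m x + q3 * n x) +
      (a * l x * l x + b * l x * m x + c * l x * n x + d * m x * m x + e * m x * n x + f * n x * n x) =
      u x * v x + (w x + \<i> * y x) * (w x - \<i> * y x)" for x
    proof -
      have "u x * v x + (w x + \<i> * y x) * (w x - \<i> * y x) = (u x * v x + w x * w x) + y x * y x"
        by (simp add: algebra_simps)
      also have "\<dots> = q * k x * k x + k x * (q1 * l x + q2 * m x + q3 * n x) +
        (a * l x * l x + b * l x * m x + c * l x * n x + d * m x * m x + e * m x * n x + f * n x * n x)"
        unfolding uv(4)[symmetric] p s(1)[symmetric] y_def by (simp add: algebra_simps)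
      finally show ?thesis by simp
    qed
  qed (use uv y in \<open>auto intro!: linear_form_intros\<close>)
next
  case q: True
  note obtained = that
  have ternary: thesis if "q1 = 0" "q2 = 0" "q3 = 0"
  proof -
    obtain u v w where "linear_form u" "linear_form v" "linear_form w"
      "\<And>x. a * l x * l x + b * l x * m x + c * l x * n x + d * m x * m x + e * m x * n x + f * n x * n x = u x * v x + w x * w x"
      by (rule ternary_quadratic_rank[OF assms(2,3,4), where a = a and b = b and c = c and d = d and e = e and f = f])
        (rule that)
    thus ?thesis by (intro obtained[of u v w w]) (auto simp: q \<open>q1 = 0\<close> \<open>q2 = 0\<close> \<open>q3 = 0\<close>)
  qed
  \<comment> \<open>The linear form multiplied by \<open>k\<close> replaces \<open>L\<close> as a
    variable. All terms divisible by it join one product, and a binary form in \<open>M, N\<close>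
    remains.\<close>
  have step: "\<exists>u v w z. linear_form u \<and> linear_form v \<and> linear_form w \<and> linear_form z \<and>
    (\<forall>x. k x * (r * L x + g * M x + h * N x) +
      (a' * L x * L x + b' * L x * M x + c' * L x * N x + d' * M x * M x + e' * M x * N x + f' * N x * N x) = u x * v x + w x * z x)"
    if r: "r \<noteq> 0" and lin: "linear_form L" "linear_form M" "linear_form N" for r g h a' b' c' d' e' f' L M N
  proof -
    define g' h' p where "g' = g / r" and "h' = h / r" and "p = a' / r"
    define p1 p2 where "p1 = b' / r - g' * p" and "p2 = c' / r - h' * p"
    have e: "g = r * g'" "h = r * h'" "a' = r * p" "b' = r * (p1 + g' * p)" "c' = r * (p2 + h' * p)"
      using r by (simp_all add: g'_def h'_def p_def p1_def p2_def)
    have "\<exists>w z. linear_form w \<and> linear_form z \<and> (\<forall>x. (d' - r * g' * p1) * M x * M x +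
        (e' - r * (g' * p2 + h' * p1)) * M x * N x + (f' - r * h' * p2) * N x * N x = w x * z x)"
      using binary_quadratic_product[OF lin(2,3)] by metis
    then obtain w z where wz: "linear_form w" "linear_form z" "\<And>x. (d' - r * g' * p1) * M x * M x +
        (e' - r * (g' * p2 + h' * p1)) * M x * N x + (f' - r * h' * p2) * N x * N x = w x * z x" by blast
    show ?thesis
    proof (intro exI conjI allI)
      show "linear_form (\<lambda>x. r * L x + g * M x + h * N x)" "linear_form (\<lambda>x. k x + p * L x + p1 * M x + p2 * N x)"
        using lin assms by (auto intro!: linear_form_intros)
      show "k x * (r * L x + g * M x + h * N x) +
        (a' * L x * L x + b' * L x * M x + c' * L x * N x + d' * M x * M x + e' * M x * N x + f' * N x * N x) =
        (r * L x + g * M x + h * N x) * (k x + p * L x + p1 * M x + p2 * N x) + w x * z x" for x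
        unfolding wz(3)[symmetric] e by (simp add: algebra_simps)
    qed (use wz in auto)
  qed
  consider "q1 \<noteq> 0" | "q2 \<noteq> 0" | "q3 \<noteq> 0" | "q1 = 0" "q2 = 0" "q3 = 0" by blast
  thus ?thesis
  proof cases
    case 1
    from step[OF this assms(2,3,4), of q2 q3 a b c d e f] that show ?thesis unfolding q by auto
  next
    case 2
    from step[OF this assms(3,2,4), of q1 q3 d b e a c f] obtain u v w z where "linear_form u" "linear_form v" "linear_form w" "linear_form z"
      "\<And>x. k x * (q2 * m x + q1 * l x + q3 * n x) +
      (d * m x * m x + b * m x * l x + e * m x * n x + a * l x * l x + c * l x * n x + f * n x * n x) = u x * v x + w x * z x" by blast
    thus ?thesis by (intro that[of u v w z]) (auto simp: q algebra_simps)
  next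
    case 3
    from step[OF this assms(4,2,3), of q1 q2 f c e a b d] obtain u v w z where "linear_form u" "linear_form v" "linear_form w" "linear_form z"
      "\<And>x. k x * (q3 * n x + q1 * l x + q2 * m x) +
      (f * n x * n x + c * n x * l x + e * n x * m x + a * l x * l x + b * l x * m x + d * m x * m x) = u x * v x + w x * z x" by blast
    thus ?thesis by (intro that[of u v w z]) (auto simp: q algebra_simps)
  qed (fact ternary)
qed

section \<open>Cubics that contain a plane\<close>

context cubic_fourspace
begin

text \<open>The polar form vanishes, not just the cubic, so that the property passes to other
  vectors of the span. Dependent vectors are allowed; independence is required separately.\<close>

definition plane_in :: "complex ^ 5 \<Rightarrow> complex ^ 5 \<Rightarrow> complex ^ 5 \<Rightarrow> bool" where
  "plane_in a b c \<longleftrightarrow> (\<forall>u\<in>vec.span {a, b, c}. \<forall>v\<in>vec.span {a, b, c}. \<forall>w\<in>vec.span {a, b, c}. t u v w = 0)"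

text \<open>Split \<open>v = a + h\<close> along the plane and the line. As \<open>t a a a\<close>
  and \<open>t h h h\<close> vanish, \<open>t v v v = 3 * t a v h\<close>: the cubic is
  \<open>Y\<close> and \<open>D\<close> times two quadrics, both in the ideal of
  \<open>x1, x2, x3\<close>.\<close>

lemma pfaffian_if_plane_and_skew_line:
  assumes ind: "independent_tuple a1 a2 a3 y d" and plane: "plane_in a1 a2 a3"
    and line: "t y y y = 0" "t y y d = 0" "t y d d = 0" "t d d d = 0"
  shows "pfaffian_function (\<lambda>x. t x x x)"
proof -
  obtain x1 x2 x3 Y D where lin: "linear_form x1" "linear_form x2" "linear_form x3" "linear_form Y" "linear_form D"
    and x: "\<And>v. v = x1 v *s a1 + x2 v *s a2 + x3 v *s a3 + Y v *s y + D v *s d"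
    using independent_tuple_coordinates[OF ind] by blast
  have F: "t v v v = Y v * (x1 v * (3 * t a1 v y) + x2 v * (3 * t a2 v y) + x3 v * (3 * t a3 v y))
      + D v * (x1 v * (3 * t a1 v d) + x2 v * (3 * t a2 v d) + x3 v * (3 * t a3 v d))" for v
  proof -
    define a where "a = x1 v *s a1 + x2 v *s a2 + x3 v *s a3"
    define h where "h = Y v *s y + D v *s d"
    have "v = a + h" using x[of v] by (simp add: a_def h_def add.assoc)
    have "a \<in> vec.span {a1, a2, a3}" unfolding span3_iff a_def by blast
    hence a0: "t a a a = 0" using plane by (simp add: plane_in_def)
    have h0: "t h h h = 0" using line by (simp add: h_def trilinear symmetric)
    have "t v v v = 3 * t a v h"
      unfolding \<open>v = a + h\<close> using a0 h0 by (simp add: trilinear symmetric)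
    also have "\<dots> = 3 * t (x1 v *s a1 + x2 v *s a2 + x3 v *s a3) v (Y v *s y + D v *s d)"
      by (simp add: a_def h_def)
    also have "\<dots> = Y v * (x1 v * (3 * t a1 v y) + x2 v * (3 * t a2 v y) + x3 v * (3 * t a3 v y))
      + D v * (x1 v * (3 * t a1 v d) + x2 v * (3 * t a2 v d) + x3 v * (3 * t a3 v d))"
      by (simp add: trilinear algebra_simps)
    finally show ?thesis .
  qed
  have l2: "linear_form (\<lambda>v. 3 * t a v b)" for a b
    using linear_form_third[of a b] by (simp add: sym23[of a _ b])
  \<comment> \<open>Row 0 contains only \<open>Y\<close> and \<open>D\<close>. Expansion along it
    gives two 4 by 4 Pfaffians that share the entries \<open>x1, x2, x3\<close> at the indices 3, 4,
    5.\<close>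
  show ?thesis
    by (rule pfaffian_functionI[of Y D "\<lambda>_. 0" "\<lambda>_. 0" "\<lambda>_. 0" "\<lambda>_. 0" "\<lambda>v. - (3 * t a1 v d)" "\<lambda>v. 3 * t a2 v d" "\<lambda>v. - (3 * t a3 v d)"
          "\<lambda>v. 3 * t a1 v y" "\<lambda>v. - (3 * t a2 v y)" "\<lambda>v. 3 * t a3 v y" x3 x2 x1])
       (use lin l2 in \<open>auto simp: F algebra_simps intro!: linear_form_intros(4)\<close>)
qed

text \<open>Here \<open>a1, a2, a3\<close> span the plane, which meets the line through \<open>a1\<close> and \<open>y\<close> in \<open>a1\<close> only.\<close>

lemma pfaffian_if_plane_and_meeting_line:
  assumes ind: "independent_tuple a1 a2 a3 y b" and plane: "plane_in a1 a2 a3"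
    and line: "t y y y = 0" "t y y a1 = 0" "t y a1 a1 = 0"
  shows "pfaffian_function (\<lambda>x. t x x x)"
proof -
  obtain x1 x2 x3 Y B where lin: "linear_form x1" "linear_form x2" "linear_form x3" "linear_form Y" "linear_form B"
    and x: "\<And>v. v = x1 v *s a1 + x2 v *s a2 + x3 v *s a3 + Y v *s y + B v *s b"
    using independent_tuple_coordinates[OF ind] by blast
  have pl: "t u v w = 0" if "u \<in> {a1, a2, a3}" "v \<in> {a1, a2, a3}" "w \<in> {a1, a2, a3}" for u v w
    using plane that unfolding plane_in_def by (blast intro: vec.span_base)
  note pl' = pl[of a1 a1 a1, simplified] pl[of a1 a1 a2, simplified] pl[of a1 a1 a3, simplified] pl[of a1 a2 a2, simplified]
    pl[of a1 a2 a3, simplified] pl[of a1 a3 a3, simplified] pl[of a2 a2 a2, simplified] pl[of a2 a2 a3, simplified]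
    pl[of a2 a3 a3, simplified] pl[of a3 a3 a3, simplified]
  \<comment> \<open>Modulo \<open>Y\<close> the cofactor of \<open>B\<close> is a quadratic form in
    \<open>B, x1, x2, x3\<close>.\<close>
  obtain u v w z where uv: "linear_form u" "linear_form v" "linear_form w" "linear_form z"
    and q: "\<And>x. t b b b * B x * B x + B x * (3 * t a1 b b * x1 x + 3 * t a2 b b * x2 x + 3 * t a3 b b * x3 x) +
      (3 * t a1 a1 b * x1 x * x1 x + 6 * t a1 a2 b * x1 x * x2 x + 6 * t a1 a3 b * x1 x * x3 x +
       3 * t a2 a2 b * x2 x * x2 x + 6 * t a2 a3 b * x2 x * x3 x + 3 * t a3 a3 b * x3 x * x3 x) = u x * v x + w x * z x"
    by (rule quaternary_quadratic_two_products[OF lin(5,1,2,3), where q = "t b b b" and ?q1.0 = "3 * t a1 b b"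
      and ?q2.0 = "3 * t a2 b b" and ?q3.0 = "3 * t a3 b b" and a = "3 * t a1 a1 b" and b = "6 * t a1 a2 b"
      and c = "6 * t a1 a3 b" and d = "3 * t a2 a2 b" and e = "6 * t a2 a3 b" and f = "3 * t a3 a3 b"])
      (rule that)
  \<comment> \<open>\<open>Y * f0\<close> is the rest of the cofactor of \<open>B\<close>. The terms
    without \<open>B\<close> are divisible by \<open>Y\<close> because of the plane and lie in the
    ideal of \<open>x2, x3\<close> because of the line; the mixed term in \<open>x2, x3\<close> is
    assigned to \<open>f2\<close>.\<close>
  define f0 where "f0 = (\<lambda>x. 6 * t a1 b y * x1 x + 6 * t a2 b y * x2 x + 6 * t a3 b y * x3 x + 3 * t b y y * Y x + 3 * t b b y * B x)"
  define f2 where "f2 = (\<lambda>x. 6 * t a1 a2 y * x1 x + 3 * t a2 a2 y * x2 x + 6 * t a2 a3 y * x3 x + 3 * t a2 y y * Y x)"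
  define f3 where "f3 = (\<lambda>x. 6 * t a1 a3 y * x1 x + 3 * t a3 a3 y * x3 x + 3 * t a3 y y * Y x)"
  have f: "linear_form f0" "linear_form f2" "linear_form f3" unfolding f0_def f2_def f3_def using lin by auto
  have exp: "t h h h = B * (t b b b * B * B + B * (3 * t a1 b b * x1 + 3 * t a2 b b * x2 + 3 * t a3 b b * x3) +
      (3 * t a1 a1 b * x1 * x1 + 6 * t a1 a2 b * x1 * x2 + 6 * t a1 a3 b * x1 * x3 +
       3 * t a2 a2 b * x2 * x2 + 6 * t a2 a3 b * x2 * x3 + 3 * t a3 a3 b * x3 * x3)
     + Y * (6 * t a1 b y * x1 + 6 * t a2 b y * x2 + 6 * t a3 b y * x3 + 3 * t b y y * Y + 3 * t b b y * B))
     + Y * (x2 * (6 * t a1 a2 y * x1 + 3 * t a2 a2 y * x2 + 6 * t a2 a3 y * x3 + 3 * t a2 y y * Y)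
          + x3 * (6 * t a1 a3 y * x1 + 3 * t a3 a3 y * x3 + 3 * t a3 y y * Y))"
    if h: "h = x1 *s a1 + x2 *s a2 + x3 *s a3 + Y *s y + B *s b" for h x1 x2 x3 Y B
  proof -
    define a where "a = x1 *s a1 + x2 *s a2 + x3 *s a3"
    define k where "k = Y *s y + B *s b"
    have hk: "h = a + k" using h by (simp add: a_def k_def add.assoc)
    have "t h h h = t a a a + 3 * t a a k + 3 * t a k k + t k k k"
      unfolding hk by (simp add: trilinear symmetric)
    moreover have "t a a a = 0" unfolding a_def using pl' by (simp add: trilinear symmetric)
    moreover have "t a a k = Y * t a a y + B * t a a b" by (simp add: k_def trilinear)
    moreover have "t a a y = x2 * (2 * t a1 a2 y * x1 + t a2 a2 y * x2 + 2 * t a2 a3 y * x3) + x3 * (2 * t a1 a3 y * x1 + t a3 a3 y * x3)"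
      using line by (simp add: a_def trilinear symmetric algebra_simps)
    moreover have "t a a b = t a1 a1 b * x1 * x1 + 2 * t a1 a2 b * x1 * x2 + 2 * t a1 a3 b * x1 * x3 +
       t a2 a2 b * x2 * x2 + 2 * t a2 a3 b * x2 * x3 + t a3 a3 b * x3 * x3"
      by (simp add: a_def trilinear symmetric algebra_simps)
    moreover have "t a k k = x1 * (2 * Y * B * t a1 b y + B * B * t a1 b b) + x2 * (Y * Y * t a2 y y + 2 * Y * B * t a2 b y + B * B * t a2 b b)
       + x3 * (Y * Y * t a3 y y + 2 * Y * B * t a3 b y + B * B * t a3 b b)"
      using line by (simp add: a_def k_def trilinear symmetric algebra_simps)
    moreover have "t k k k = B * (3 * t b y y * Y * Y + 3 * t b b y * Y * B + t b b b * B * B)"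
      using line by (simp add: k_def trilinear symmetric algebra_simps)
    ultimately show ?thesis by (simp add: algebra_simps)
  qed
  have F: "t x x x = B x * (u x * v x + w x * z x + Y x * f0 x) + Y x * (x2 x * f2 x + x3 x * f3 x)" for x
    unfolding exp[OF x[of x]] q[symmetric] f0_def f2_def f3_def ..
  \<comment> \<open>The entry \<open>B\<close> at (4, 5) multiplies the Pfaffian of the indices 0 to
    3, which is \<open>Y f0 + u v + w z\<close>; the other terms that survive give
    \<open>Y (x2 f2 + x3 f3)\<close>.\<close>
  show ?thesis
    by (rule pfaffian_functionI[of Y "\<lambda>x. - u x" w "\<lambda>_. 0" "\<lambda>_. 0" z v "\<lambda>_. 0" "\<lambda>_. 0" f0 "\<lambda>x. - x2 x" x3 f3 f2 B])
       (use lin uv f in \<open>auto simp: F algebra_simps\<close>)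
qed

lemma plane_in_mono:
  assumes "plane_in a b c" "a' \<in> vec.span {a, b, c}" "b' \<in> vec.span {a, b, c}" "c' \<in> vec.span {a, b, c}"
  shows "plane_in a' b' c'"
proof -
  have "vec.span {a', b', c'} \<subseteq> vec.span {a, b, c}"
    using assms(2-4) by (intro vec.span_minimal vec.subspace_span) simp
  thus ?thesis using assms(1) unfolding plane_in_def by blast
qed

text \<open>Polarisation: \<open>6 * t u v w\<close> is an alternating sum of values of the cubic at
  sums of \<open>u, v, w\<close>.\<close>

lemma plane_inI:
  assumes "\<And>x y z. t (x *s a + y *s b + z *s c) (x *s a + y *s b + z *s c) (x *s a + y *s b + z *s c) = 0"
  shows "plane_in a b c"
  unfolding plane_in_def
proof (intro ballI)
  fix u v w assume "u \<in> vec.span {a, b, c}" "v \<in> vec.span {a, b, c}" "w \<in> vec.span {a, b, c}"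
  moreover have z: "t r r r = 0" if "r \<in> vec.span {a, b, c}" for r
    using that assms unfolding span3_iff by blast
  ultimately have "t (u + v + w) (u + v + w) (u + v + w) = 0" "t (u + v) (u + v) (u + v) = 0" "t (u + w) (u + w) (u + w) = 0"
    "t (v + w) (v + w) (v + w) = 0" "t u u u = 0" "t v v v = 0" "t w w w = 0"
    by (blast intro: vec.span_add)+
  moreover have "6 * t u v w = t (u + v + w) (u + v + w) (u + v + w) - t (u + v) (u + v) (u + v) - t (u + w) (u + w) (u + w)
      - t (v + w) (v + w) (v + w) + t u u u + t v v v + t w w w"
    by (simp add: trilinear symmetric)
  ultimately show "t u v w = 0" by simp
qed

text \<open>On a line disjoint from the plane there is a point \<open>y\<close> of the cubic, and
  through \<open>y\<close> there is a line of the cubic. It either misses the plane or meets it in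
  one point.\<close>

lemma pfaffian_if_plane:
  assumes ind: "\<And>i j k. i *s a1 + j *s a2 + k *s a3 = 0 \<Longrightarrow> i = 0 \<and> j = 0 \<and> k = 0" and plane: "plane_in a1 a2 a3"
  shows "pfaffian_function (\<lambda>x. t x x x)"
proof -
  have a1: "a1 \<noteq> 0" using ind[of 1 0 0] by auto
  have a2: "a2 \<notin> vec.span {a1}"
  proof
    assume "a2 \<in> vec.span {a1}"
    then obtain i where "a2 = i *s a1" by (auto simp: span1_iff)
    thus False using ind[of i "-1" 0] by (simp add: vec.scale_minus_left)
  qed
  have a3: "a3 \<notin> vec.span {a1, a2}"
  proof
    assume "a3 \<in> vec.span {a1, a2}"
    then obtain i j where "a3 = i *s a1 + j *s a2" by (auto simp: span2_iff)
    thus False using ind[of i j "-1"] by (simp add: vec.scale_minus_left)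
  qed
  obtain b where b: "b \<notin> vec.span {a1, a2, a3}" using ex_not_in_span4[of a1 a2 a3 a3] by auto
  obtain c where c: "c \<notin> vec.span {a1, a2, a3, b}" by (rule ex_not_in_span4)
  have I: "independent_tuple a1 a2 a3 b c" by (rule independent_tupleI[OF a1 a2 a3 b c])
  obtain s u where su: "s \<noteq> 0 \<or> u \<noteq> 0" "t (s *s b + u *s c) (s *s b + u *s c) (s *s b + u *s c) = 0"
    by (rule ex_zero_on_line)
  define y where "y = s *s b + u *s c"
  have y: "y \<notin> vec.span {a1, a2, a3}"
  proof
    assume "y \<in> vec.span {a1, a2, a3}"
    then obtain i j k where "y = i *s a1 + j *s a2 + k *s a3" by (auto simp: span3_iff)
    hence "i *s a1 + j *s a2 + k *s a3 + (- s) *s b + (- u) *s c = 0"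
      by (simp add: y_def vec.scale_minus_left algebra_simps)
    thus False using I su(1) unfolding independent_tuple_def by fastforce
  qed
  have y0: "y \<noteq> 0" using y vec.span_zero by blast
  obtain d where d: "d \<notin> vec.span {y}" "t y y d = 0" "t y d d = 0" "t d d d = 0"
    using ex_line_through[OF y0] su(2) unfolding y_def by blast
  have yy: "t y y y = 0" using su(2) by (simp add: y_def)
  show ?thesis
  proof (cases "d \<in> vec.span {a1, a2, a3, y}")
    case False
    show ?thesis
      by (rule pfaffian_if_plane_and_skew_line[OF independent_tupleI[OF a1 a2 a3 y False] plane yy d(2-4)])
  next
    case True
    then obtain i j k l where ijk: "d = i *s a1 + j *s a2 + k *s a3 + l *s y" by (auto simp: span4_iff)
    \<comment> \<open>The point in which the line meets the plane.\<close>
    define a where "a = i *s a1 + j *s a2 + k *s a3"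
    have da: "a = d - l *s y" by (simp add: a_def ijk)
    have line: "t y y a = 0" "t y a a = 0" using d yy by (simp_all add: da trilinear symmetric)
    obtain e where e: "e \<notin> vec.span {a1, a2, a3, y}" by (rule ex_not_in_span4)
    have J: "p = 0 \<and> q = 0 \<and> r = 0 \<and> m = 0 \<and> n = 0"
      if "p *s a1 + q *s a2 + r *s a3 + m *s y + n *s e = 0" for p q r m n
      using independent_tupleI[OF a1 a2 a3 y e] that unfolding independent_tuple_def by blast
    have A: "a \<in> vec.span {a1, a2, a3}" unfolding span3_iff a_def by blast
    have S: "a1 \<in> vec.span {a1, a2, a3}" "a2 \<in> vec.span {a1, a2, a3}" "a3 \<in> vec.span {a1, a2, a3}"
      by (auto intro: vec.span_base)
    \<comment> \<open>So \<open>a\<close> is nonzero and may replace one of the spanning vectors of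
      the plane, one with a nonzero coefficient.\<close>
    have "i \<noteq> 0 \<or> j \<noteq> 0 \<or> k \<noteq> 0"
      using d(1) ijk by (auto simp: span1_iff)
    then consider "i \<noteq> 0" | "j \<noteq> 0" | "k \<noteq> 0" by blast
    thus ?thesis
    proof cases
      case 1
      have "independent_tuple a a2 a3 y e" unfolding independent_tuple_def
      proof (intro allI impI)
        fix p q r m n assume "p *s a + q *s a2 + r *s a3 + m *s y + n *s e = 0"
        hence "(p * i) *s a1 + (q + p * j) *s a2 + (r + p * k) *s a3 + m *s y + n *s e = 0"
          by (simp add: a_def vec.scale_right_distrib vec.scale_left_distrib algebra_simps)
        from J[OF this] 1 show "p = 0 \<and> q = 0 \<and> r = 0 \<and> m = 0 \<and> n = 0" by auto
      qed
      thus ?thesis by (rule pfaffian_if_plane_and_meeting_line[OF _ plane_in_mono[OF plane A S(2,3)] yy line])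
    next
      case 2
      have "independent_tuple a a1 a3 y e" unfolding independent_tuple_def
      proof (intro allI impI)
        fix p q r m n assume "p *s a + q *s a1 + r *s a3 + m *s y + n *s e = 0"
        hence "(q + p * i) *s a1 + (p * j) *s a2 + (r + p * k) *s a3 + m *s y + n *s e = 0"
          by (simp add: a_def vec.scale_right_distrib vec.scale_left_distrib algebra_simps)
        from J[OF this] 2 show "p = 0 \<and> q = 0 \<and> r = 0 \<and> m = 0 \<and> n = 0" by auto
      qed
      thus ?thesis by (rule pfaffian_if_plane_and_meeting_line[OF _ plane_in_mono[OF plane A S(1,3)] yy line])
    next
      case 3
      have "independent_tuple a a1 a2 y e" unfolding independent_tuple_def
      proof (intro allI impI)
        fix p q r m n assume "p *s a + q *s a1 + r *s a2 + m *s y + n *s e = 0"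
        hence "(q + p * i) *s a1 + (r + p * j) *s a2 + (p * k) *s a3 + m *s y + n *s e = 0"
          by (simp add: a_def vec.scale_right_distrib vec.scale_left_distrib algebra_simps)
        from J[OF this] 3 show "p = 0 \<and> q = 0 \<and> r = 0 \<and> m = 0 \<and> n = 0" by auto
      qed
      thus ?thesis by (rule pfaffian_if_plane_and_meeting_line[OF _ plane_in_mono[OF plane A S(1,2)] yy line])
    qed
  qed
qed

end

section \<open>Determinantal sections\<close>

text \<open>Linear factors are moved to \<open>f\<close> one at a time. Bounds instead of exact
  degrees take care of zeros of a binary form at infinity.\<close>

lemma poly_split_degrees:
  fixes p :: "complex poly"
  assumes "degree p \<le> m + n"
  obtains f g where "p = f * g" "degree f \<le> m" "degree g \<le> n"
proof -
  have "\<exists>f g. p = f * g \<and> degree f \<le> m \<and> degree g \<le> n"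
    using assms
  proof (induction m arbitrary: p)
    case 0
    thus ?case by (intro exI[of _ 1] exI[of _ p]) simp
  next
    case (Suc m)
    show ?case
    proof (cases "degree p \<le> m + n")
      case True
      thus ?thesis using Suc.IH[of p] le_SucI by blast
    next
      case False
      then obtain a where "poly p a = 0" using alg_closed_imp_poly_has_root[of p] by auto
      then obtain q where q: "p = [:- a, 1:] * q" by (metis poly_eq_0_iff_dvd dvdE)
      have "q \<noteq> 0" using False q by auto
      hence "degree p = Suc (degree q)" unfolding q by (subst degree_mult_eq) auto
      hence "degree q \<le> m + n" using Suc.prems by simp
      then obtain f g where fg: "q = f * g" "degree f \<le> m" "degree g \<le> n" using Suc.IH[of q] by blast
      have "degree ([:- a, 1:] * f) \<le> Suc m"
        using fg(2) degree_mult_le[of "[:- a, 1:]" f] by simp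
      moreover have "p = [:- a, 1:] * f * g" unfolding q fg(1) by (simp only: mult.assoc)
      ultimately show ?thesis using fg(3) by blast
    qed
  qed
  thus ?thesis using that by blast
qed

lemma poly_degree_le_1E:
  assumes "degree p \<le> 1" obtains a b where "p = [:a, b:]"
  using assms by (metis One_nat_def degree_pCons_eq_if le_zero_eq not_less_eq_eq pCons_cases degree_eq_zeroE pCons_0_0)

lemma poly_degree_le_SucE:
  assumes "degree p \<le> Suc n" obtains a q where "p = pCons a q" "degree q \<le> n"
proof (cases p)
  case (pCons a q)
  thus ?thesis using that[of a q] assms by (auto split: if_splits)
qed

lemma binary_quadratic_factors:
  fixes a0 a1 a2 :: complex
  obtains f0 f1 g0 g1 where "a0 = f0 * g0" "a1 = f0 * g1 + f1 * g0" "a2 = f1 * g1"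
proof -
  obtain f g where fg: "[:a0, a1, a2:] = f * g" "degree f \<le> 1" "degree g \<le> 1"
    by (rule poly_split_degrees[of "[:a0, a1, a2:]" 1 1]) (simp_all add: degree_pCons_eq_if)
  obtain f0 f1 g0 g1 where "f = [:f0, f1:]" "g = [:g0, g1:]" using fg(2,3) by (metis poly_degree_le_1E)
  thus ?thesis using that[of f0 g0 g1 f1] fg(1) by (simp add: algebra_simps)
qed

lemma binary_cubic_factors:
  fixes a0 a1 a2 a3 :: complex
  obtains f0 f1 g0 g1 g2 where "a0 = f0 * g0" "a1 = f0 * g1 + f1 * g0" "a2 = f0 * g2 + f1 * g1" "a3 = f1 * g2"
proof -
  obtain f g where fg: "[:a0, a1, a2, a3:] = f * g" "degree f \<le> 1" "degree g \<le> Suc 1"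
    by (rule poly_split_degrees[of "[:a0, a1, a2, a3:]" 1 "Suc 1"]) (simp_all add: degree_pCons_eq_if)
  obtain f0 f1 where "f = [:f0, f1:]" using fg(2) by (rule poly_degree_le_1E)
  moreover obtain g0 g' where "g = pCons g0 g'" "degree g' \<le> 1" using fg(3) by (rule poly_degree_le_SucE)
  moreover from this(2) obtain g1 g2 where "g' = [:g1, g2:]" by (rule poly_degree_le_1E)
  ultimately show ?thesis using that[of f0 g0 g1 f1 g2] fg(1) by (simp add: algebra_simps)
qed

lemma binary_sextic_factors:
  fixes a0 a1 a2 a3 a4 a5 a6 :: complex
  obtains f0 f1 f2 f3 g0 g1 g2 g3 where "a0 = f0 * g0" "a1 = f0 * g1 + f1 * g0" "a2 = f0 * g2 + f1 * g1 + f2 * g0"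
    "a3 = f0 * g3 + f1 * g2 + f2 * g1 + f3 * g0" "a4 = f1 * g3 + f2 * g2 + f3 * g1" "a5 = f2 * g3 + f3 * g2" "a6 = f3 * g3"
proof -
  obtain f g where fg: "[:a0, a1, a2, a3, a4, a5, a6:] = f * g" "degree f \<le> Suc (Suc 1)" "degree g \<le> Suc (Suc 1)"
    by (rule poly_split_degrees[of "[:a0, a1, a2, a3, a4, a5, a6:]" "Suc (Suc 1)" "Suc (Suc 1)"]) (simp_all add: degree_pCons_eq_if)
  have ex: "\<exists>a b c d. h = [:a, b, c, d:]" if "degree h \<le> Suc (Suc 1)" for h :: "complex poly"
    using that by (metis poly_degree_le_1E poly_degree_le_SucE)
  obtain f0 f1 f2 f3 where "f = [:f0, f1, f2, f3:]" using ex fg(2) by blast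
  moreover obtain g0 g1 g2 g3 where "g = [:g0, g1, g2, g3:]" using ex fg(3) by blast
  ultimately show ?thesis using that[of f0 g0 g1 f1 g2 f2 g3 f3] fg(1) by (simp add: algebra_simps)
qed

text \<open>The solutions of a system in binary forms: \<open>e, b, c, v, w, r, u\<close> are linear, \<open>q, m\<close> quadratic, \<open>n\<close> cubic.
  It says that the cubic surface \<open>P (Z\<^sup>2 + q) + Z m + n = 0\<close> is the determinant of the matrix with
  rows \<open>(Z + e, b, v)\<close>, \<open>(c, Z - e, w)\<close>, \<open>(u, r, P)\<close>.\<close>

definition determinantal_system ::
  "(complex \<Rightarrow> complex \<Rightarrow> complex) \<Rightarrow> (complex \<Rightarrow> complex \<Rightarrow> complex) \<Rightarrow> (complex \<Rightarrow> complex \<Rightarrow> complex) \<Rightarrow> bool" where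
  "determinantal_system q m n \<longleftrightarrow>
     (\<exists>e1 e2 b1 b2 c1 c2 v1 v2 w1 w2 r1 r2 u1 u2. \<forall>x y.
        let e = e1 * x + e2 * y; b = b1 * x + b2 * y; c = c1 * x + c2 * y; v = v1 * x + v2 * y;
            w = w1 * x + w2 * y; r = r1 * x + r2 * y; u = u1 * x + u2 * y
        in q x y = - (e * e + b * c) \<and> m x y = - (w * r + v * u) \<and>
           n x y = e * (v * u - w * r) + b * w * u + c * v * r)"

lemma determinantal_systemI:
  assumes "\<And>x y. q x y = - ((e1 * x + e2 * y) * (e1 * x + e2 * y) + (b1 * x + b2 * y) * (c1 * x + c2 * y))"
    "\<And>x y. m x y = - ((w1 * x + w2 * y) * (r1 * x + r2 * y) + (v1 * x + v2 * y) * (u1 * x + u2 * y))"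
    "\<And>x y. n x y = (e1 * x + e2 * y) * ((v1 * x + v2 * y) * (u1 * x + u2 * y) - (w1 * x + w2 * y) * (r1 * x + r2 * y)) +
        (b1 * x + b2 * y) * (w1 * x + w2 * y) * (u1 * x + u2 * y) + (c1 * x + c2 * y) * (v1 * x + v2 * y) * (r1 * x + r2 * y)"
  shows "determinantal_system q m n"
  unfolding determinantal_system_def Let_def using assms by blast

text \<open>With \<open>x = s\<^sup>2\<close> and \<open>y = u\<^sup>2\<close> the form \<open>n - s u m\<close> is a binary sextic; a factorisation into
  two cubics, sorted by parity, is a solution of the system.\<close>

lemma determinantal_system_nondegenerate:
  "determinantal_system (\<lambda>x y. - (x * y)) (\<lambda>x y. m0 * x\<^sup>2 + m1 * x * y + m2 * y\<^sup>2)
     (\<lambda>x y. n0 * x ^ 3 + n1 * x\<^sup>2 * y + n2 * x * y\<^sup>2 + n3 * y ^ 3)"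
proof -
  obtain w1 v1 w2 v2 u1 r1 u2 r2 where f: "n0 = w1 * u1" "- m0 = w1 * r1 + v1 * u1" "n1 = w1 * u2 + v1 * r1 + w2 * u1"
    "- m1 = w1 * r2 + v1 * u2 + w2 * r1 + v2 * u1" "n2 = v1 * r2 + w2 * u2 + v2 * r1" "- m2 = w2 * r2 + v2 * u2" "n3 = v2 * r2"
    by (rule binary_sextic_factors)
  have m: "m0 = - (w1 * r1 + v1 * u1)" "m1 = - (w1 * r2 + v1 * u2 + w2 * r1 + v2 * u1)" "m2 = - (w2 * r2 + v2 * u2)"
    using f(2,4,6) by (metis minus_minus)+
  show ?thesis
    by (rule determinantal_systemI[of _ 0 0 1 0 0 1 _ w1 w2 r1 r2 v1 v2 u1 u2])
       (simp_all add: f(1,3,5,7) m power2_eq_square power3_eq_cube algebra_simps)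
qed

text \<open>Take \<open>e = x\<close>, \<open>b = 0\<close> and for \<open>c\<close> a multiple of
  \<open>y\<close>. The system becomes \<open>n - x m = v (2 x u + c r)\<close> and
  \<open>n + x m = r (c v - 2 x w)\<close>, so two binary cubics are factored into a linear and a
  quadratic form, subject to a compatibility at \<open>x = 0\<close>.\<close>

lemma determinantal_system_rank_one:
  "determinantal_system (\<lambda>x y. - (x * x)) (\<lambda>x y. m0 * x\<^sup>2 + m1 * x * y + m2 * y\<^sup>2)
     (\<lambda>x y. n0 * x ^ 3 + n1 * x\<^sup>2 * y + n2 * x * y\<^sup>2 + n3 * y ^ 3)"
proof (cases "n3 = 0")
  case False
  obtain v1 v2 k0 k1 k2 where k: "n0 - m0 = v1 * k0" "n1 - m1 = v1 * k1 + v2 * k0" "n2 - m2 = v1 * k2 + v2 * k1" "n3 = v2 * k2"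
    by (rule binary_cubic_factors)
  obtain r1 r2 l0 l1 l2 where l: "n0 + m0 = r1 * l0" "n1 + m1 = r1 * l1 + r2 * l0" "n2 + m2 = r1 * l2 + r2 * l1" "n3 = r2 * l2"
    by (rule binary_cubic_factors)
  \<comment> \<open>Both cubics have the coefficient \<open>n3\<close> at \<open>y ^ 3\<close>. This
    value makes the quadratic factors agree with \<open>c y r\<close> and \<open>c y v\<close>
    modulo \<open>x\<close>, so that the differences can be divided by \<open>x\<close>.\<close>
  define c where "c = n3 / (v2 * r2)"
  have nz: "v2 \<noteq> 0" "r2 \<noteq> 0" using False k(4) l(4) by auto
  have c: "k2 = c * r2" "l2 = c * v2" using nz k(4) l(4) by (simp_all add: c_def field_simps)
  define u1 u2 w1 w2 where "u1 = k0 / 2" and "u2 = (k1 - c * r1) / 2" and "w1 = - l0 / 2" and "w2 = - (l1 - c * v1) / 2"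
  have e: "k0 = 2 * u1" "k1 = 2 * u2 + c * r1" "l0 = - 2 * w1" "l1 = c * v1 - 2 * w2"
    by (simp_all add: u1_def u2_def w1_def w2_def field_simps)
  have half: "a = ((a + b) + (a - b)) / 2" "b = ((a + b) - (a - b)) / 2" for a b :: complex by (simp_all add: field_simps)
  have n: "n0 = (r1 * l0 + v1 * k0) / 2" "n1 = (r1 * l1 + r2 * l0 + (v1 * k1 + v2 * k0)) / 2"
    "n2 = (r1 * l2 + r2 * l1 + (v1 * k2 + v2 * k1)) / 2" "n3 = v2 * (c * r2)"
    "m0 = (r1 * l0 - v1 * k0) / 2" "m1 = (r1 * l1 + r2 * l0 - (v1 * k1 + v2 * k0)) / 2"
    "m2 = (r1 * l2 + r2 * l1 - (v1 * k2 + v2 * k1)) / 2"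
    unfolding k(1-3)[symmetric] l(1-3)[symmetric] using k(4) c by (simp_all add: field_simps)
  show ?thesis
    by (rule determinantal_systemI[of _ 1 0 0 0 0 c _ w1 w2 r1 r2 v1 v2 u1 u2])
       (simp_all add: n e c power2_eq_square power3_eq_cube field_simps)
next
  \<comment> \<open>Now \<open>x\<close> divides both cubics; with \<open>c = 0\<close> it remains
    to factor two binary quadratic forms.\<close>
  case True
  obtain v1 v2 k0 k1 where k: "n0 - m0 = v1 * k0" "n1 - m1 = v1 * k1 + v2 * k0" "n2 - m2 = v2 * k1"
    by (rule binary_quadratic_factors)
  obtain r1 r2 l0 l1 where l: "n0 + m0 = r1 * l0" "n1 + m1 = r1 * l1 + r2 * l0" "n2 + m2 = r2 * l1"
    by (rule binary_quadratic_factors)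
  have n: "n0 = (r1 * l0 + v1 * k0) / 2" "n1 = (r1 * l1 + r2 * l0 + (v1 * k1 + v2 * k0)) / 2" "n2 = (r2 * l1 + v2 * k1) / 2"
    "m0 = (r1 * l0 - v1 * k0) / 2" "m1 = (r1 * l1 + r2 * l0 - (v1 * k1 + v2 * k0)) / 2" "m2 = (r2 * l1 - v2 * k1) / 2"
    unfolding k[symmetric] l[symmetric] by (simp_all add: field_simps)
  show ?thesis
    by (rule determinantal_systemI[of _ 1 0 0 0 0 0 _ "- l0 / 2" "- l1 / 2" r1 r2 v1 v2 "k0 / 2" "k1 / 2"])
       (simp_all add: n True power2_eq_square power3_eq_cube field_simps)
qed

text \<open>With \<open>e = b = 0\<close> the cubic is \<open>c v r\<close>. It vanishes at both
  coordinate points, which permits \<open>v = x\<close> and \<open>r = y\<close>; then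
  \<open>w\<close> and \<open>u\<close> are read off from \<open>m\<close>.\<close>

lemma determinantal_system_zero:
  "determinantal_system (\<lambda>x y. 0) (\<lambda>x y. m0 * x\<^sup>2 + m1 * x * y + m2 * y\<^sup>2) (\<lambda>x y. n1 * x\<^sup>2 * y + n2 * x * y\<^sup>2)"
  by (rule determinantal_systemI[of _ 0 0 0 0 n1 n2 _ 0 "- m2" 0 1 1 0 "- m0" "- m1"])
     (simp_all add: power2_eq_square algebra_simps)

section \<open>From a determinantal section to a Pfaffian\<close>

context cubic_fourspace
begin

text \<open>The conditions on \<open>p, x, y, z\<close> are what kills the unwanted terms of the
  section; \<open>1 / 3\<close> cancels the multinomial coefficient of \<open>P Z^2\<close>. By
  \<open>nolines\<close> no line of the section passes through \<open>z\<close>.\<close>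

lemma pfaffian_if_determinantal_section:
  assumes ind: "\<And>i j k l. i *s p + j *s x + k *s y + l *s z = 0 \<Longrightarrow> i = 0 \<and> j = 0 \<and> k = 0 \<and> l = 0"
    and pp: "t p p p = 0" "t p p x = 0" "t p p y = 0" "t p p z = 0"
    and z: "t p z z = 1 / 3" "t z z z = 0" "t p z x = 0" "t p z y = 0" "t z z x = 0" "t z z y = 0"
    and nolines: "\<And>i j. t z (i *s x + j *s y) (i *s x + j *s y) = 0 \<Longrightarrow>
        t (i *s x + j *s y) (i *s x + j *s y) (i *s x + j *s y) = 0 \<Longrightarrow> i = 0 \<and> j = 0"
    and sys: "determinantal_system (\<lambda>i j. 3 * t p (i *s x + j *s y) (i *s x + j *s y))
        (\<lambda>i j. 3 * t z (i *s x + j *s y) (i *s x + j *s y)) (\<lambda>i j. t (i *s x + j *s y) (i *s x + j *s y) (i *s x + j *s y))"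
  shows "pfaffian_function (\<lambda>x. t x x x)"
proof -
  have z0: "z \<noteq> 0" using z(1) by (auto simp: trilinear)
  obtain d where d: "d \<notin> vec.span {z}" "t z z d = 0" "t z d d = 0" "t d d d = 0"
    using ex_line_through[OF z0 z(2)] by blast
  \<comment> \<open>The line through \<open>z\<close> leaves the hyperplane: inside it, the
    direction would be, up to a multiple of \<open>z\<close>, a combination of \<open>x, y\<close>
    forbidden by \<open>nolines\<close>.\<close>
  have dT: "d \<notin> vec.span {p, x, y, z}"
  proof
    assume "d \<in> vec.span {p, x, y, z}"
    then obtain i j k l where de: "d = i *s p + j *s x + k *s y + l *s z" by (auto simp: span4_iff)
    have "t z z d = i / 3" using z symmetric by (simp add: de trilinear)
    hence i: "i = 0" using d by simp
    define u where "u = j *s x + k *s y"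
    have de': "d = u + l *s z" using de i by (simp add: u_def)
    have zu: "t z z u = 0" using z by (simp add: u_def trilinear)
    have "t z d d = t z u u" using zu z by (simp add: de' trilinear symmetric)
    moreover from this have "t d d d = t u u u" using zu z d by (simp add: de' trilinear symmetric)
    ultimately have "j = 0 \<and> k = 0" using nolines[of j k] d unfolding u_def by simp
    hence "d = l *s z" by (simp add: de' u_def)
    thus False using d(1) by (simp add: span1_iff)
  qed
  have "independent_tuple p x y z d" unfolding independent_tuple_def
  proof (intro allI impI)
    fix i j k l m assume *: "i *s p + j *s x + k *s y + l *s z + m *s d = 0"
    have "m = 0" by (rule coefficient_zero[OF * _ dT]) (unfold span4_iff, blast)
    thus "i = 0 \<and> j = 0 \<and> k = 0 \<and> l = 0 \<and> m = 0" using ind[of i j k l] * by simp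
  qed
  then obtain P A B Z W where lin: "linear_form P" "linear_form A" "linear_form B" "linear_form Z" "linear_form W"
    and co: "\<And>h. h = P h *s p + A h *s x + B h *s y + Z h *s z + W h *s d"
    by (rule independent_tuple_coordinates) (rule that)
  \<comment> \<open>The cofactor of \<open>W\<close> is a quadric without terms in
    \<open>Z, W\<close> alone, since the line of \<open>z\<close> and \<open>d\<close> lies on the
    threefold. Hence it lies in the ideal of \<open>P, A, B\<close>.\<close>
  define f0 f1 f2 where
    "f0 = (\<lambda>h. 3 * (P h * t p p d + A h * t p x d + B h * t p y d + 2 * Z h * t p z d + W h * t p d d))" and
    "f1 = (\<lambda>h. 3 * (P h * t x p d + A h * t x x d + B h * t x y d + 2 * Z h * t x z d + W h * t x d d))" and
    "f2 = (\<lambda>h. 3 * (P h * t y p d + A h * t y x d + B h * t y y d + 2 * Z h * t y z d + W h * t y d d))"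
  have flin: "linear_form f0" "linear_form f1" "linear_form f2" unfolding f0_def f1_def f2_def using lin by auto
  define q m n where "q i j = 3 * t p (i *s x + j *s y) (i *s x + j *s y)"
    and "m i j = 3 * t z (i *s x + j *s y) (i *s x + j *s y)"
    and "n i j = t (i *s x + j *s y) (i *s x + j *s y) (i *s x + j *s y)" for i j
  have F: "t h h h = P h * (Z h * Z h + q (A h) (B h)) + Z h * m (A h) (B h) + n (A h) (B h)
      + W h * (P h * f0 h + A h * f1 h + B h * f2 h)" for h
  proof -
    define u where "u = A h *s x + B h *s y"
    define s where "s = P h *s p + u + Z h *s z"
    have h: "h = s + W h *s d" using co[of h] by (simp add: s_def u_def add.assoc)
    have "t h h h = t (s + W h *s d) (s + W h *s d) (s + W h *s d)" using h by simp
    also have "\<dots> = t s s s + W h * (3 * t s s d + 3 * W h * t s d d)"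
      using d by (simp add: trilinear symmetric algebra_simps)
    finally have 1: "t h h h = t s s s + W h * (3 * t s s d + 3 * W h * t s d d)" .
    have u: "t p p u = 0" "t p z u = 0" "t z z u = 0" using pp z by (simp_all add: u_def trilinear)
    have "t s s s = P h * (Z h * Z h + 3 * t p u u) + Z h * (3 * t z u u) + t u u u"
      using pp z u by (simp add: s_def trilinear symmetric algebra_simps)
    hence 2: "t s s s = P h * (Z h * Z h + q (A h) (B h)) + Z h * m (A h) (B h) + n (A h) (B h)"
      by (simp add: q_def m_def n_def u_def)
    have 3: "3 * t s s d + 3 * W h * t s d d = P h * f0 h + A h * f1 h + B h * f2 h"
      using d by (simp add: s_def u_def f0_def f1_def f2_def trilinear symmetric algebra_simps)
    show ?thesis unfolding 1 2 3 ..
  qed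
  obtain e1 e2 b1 b2 c1 c2 v1 v2 w1 w2 r1 r2 u1 u2 where
    q: "\<And>x y. q x y = - ((e1 * x + e2 * y) * (e1 * x + e2 * y) + (b1 * x + b2 * y) * (c1 * x + c2 * y))" and
    m: "\<And>x y. m x y = - ((w1 * x + w2 * y) * (r1 * x + r2 * y) + (v1 * x + v2 * y) * (u1 * x + u2 * y))" and
    n: "\<And>x y. n x y = (e1 * x + e2 * y) * ((v1 * x + v2 * y) * (u1 * x + u2 * y) - (w1 * x + w2 * y) * (r1 * x + r2 * y)) +
        (b1 * x + b2 * y) * (w1 * x + w2 * y) * (u1 * x + u2 * y) + (c1 * x + c2 * y) * (v1 * x + v2 * y) * (r1 * x + r2 * y)"
    using sys unfolding determinantal_system_def Let_def q_def m_def n_def by blast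
  define D where "D = v1 * w2 - v2 * w1"
  \<comment> \<open>At a common zero of \<open>v\<close> and \<open>w\<close> both \<open>m\<close>
    and \<open>n\<close> would vanish, which is the direction of a line of the section through
    \<open>z\<close>.\<close>
  have D: "D \<noteq> 0"
  proof
    assume "D = 0"
    hence "\<exists>i j. (i \<noteq> 0 \<or> j \<noteq> 0) \<and> v1 * i + v2 * j = 0 \<and> w1 * i + w2 * j = 0"
    proof -
      assume D: "D = 0"
      consider "v1 \<noteq> 0 \<or> v2 \<noteq> 0" | "v1 = 0" "v2 = 0" "w1 \<noteq> 0 \<or> w2 \<noteq> 0" | "v1 = 0" "v2 = 0" "w1 = 0" "w2 = 0" by blast
      thus ?thesis
      proof cases
        case 1
        thus ?thesis using D by (intro exI[of _ v2] exI[of _ "- v1"]) (auto simp: D_def algebra_simps)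
      next
        case 2
        thus ?thesis by (intro exI[of _ w2] exI[of _ "- w1"]) auto
      next
        case 3
        thus ?thesis by (intro exI[of _ 1]) auto
      qed
    qed
    then obtain i j where ij: "i \<noteq> 0 \<or> j \<noteq> 0" "v1 * i + v2 * j = 0" "w1 * i + w2 * j = 0" by blast
    have "m i j = 0" "n i j = 0" unfolding m n using ij(2,3) by simp_all
    thus False using nolines[of i j] ij(1) by (simp add: m_def n_def)
  qed
  define v w r u e b c where "v = (\<lambda>h. v1 * A h + v2 * B h)" and "w = (\<lambda>h. w1 * A h + w2 * B h)"
    and "r = (\<lambda>h. r1 * A h + r2 * B h)" and "u = (\<lambda>h. u1 * A h + u2 * B h)" and "e = (\<lambda>h. e1 * A h + e2 * B h)"
    and "b = (\<lambda>h. b1 * A h + b2 * B h)" and "c = (\<lambda>h. c1 * A h + c2 * B h)"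
  \<comment> \<open>Cramer's rule: \<open>A\<close> and \<open>B\<close> are rewritten as
    combinations of \<open>v\<close> and \<open>w\<close>.\<close>
  define g1 g2 where "g1 = (\<lambda>h. (w2 * f1 h - w1 * f2 h) / D)" and "g2 = (\<lambda>h. (v1 * f2 h - v2 * f1 h) / D)"
  have vlin: "linear_form v" "linear_form w" "linear_form r" "linear_form u" "linear_form e" "linear_form b" "linear_form c"
    "linear_form g1" "linear_form g2"
    unfolding v_def w_def r_def u_def e_def b_def c_def g1_def g2_def using lin flin by auto
  have g: "A h * f1 h + B h * f2 h = v h * g1 h + w h * g2 h" for h
  proof -
    have "v h * g1 h + w h * g2 h = (D * (A h * f1 h + B h * f2 h)) / D"
      by (simp add: v_def w_def g1_def g2_def D_def add_divide_distrib[symmetric] algebra_simps)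
    thus ?thesis using D by simp
  qed
  have F': "t h h h = P h * ((Z h + e h) * (Z h - e h) - b h * c h + W h * f0 h) + v h * (c h * r h - (Z h - e h) * u h + W h * g1 h)
      + w h * (b h * u h - (Z h + e h) * r h + W h * g2 h)" for h
  proof -
    have qmn: "q (A h) (B h) = - (e h * e h + b h * c h)" "m (A h) (B h) = - (w h * r h + v h * u h)"
      "n (A h) (B h) = e h * (v h * u h - w h * r h) + b h * w h * u h + c h * v h * r h"
      unfolding q m n by (simp_all add: v_def w_def r_def u_def e_def b_def c_def)
    have "t h h h = P h * (Z h * Z h - (e h * e h + b h * c h)) - Z h * (w h * r h + v h * u h)
      + (e h * (v h * u h - w h * r h) + b h * w h * u h + c h * v h * r h) + W h * (P h * f0 h + (A h * f1 h + B h * f2 h))"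
      unfolding F qmn by (simp add: algebra_simps)
    thus ?thesis unfolding g by (simp add: algebra_simps)
  qed
  \<comment> \<open>The indices 0, 4, 5 against 1, 2, 3 carry the 3 by 3 matrix. Of the two diagonal
    blocks the one has only \<open>W\<close>, the other has \<open>f0, g1, g2\<close> up to
    sign.\<close>
  show ?thesis
    by (rule pfaffian_functionI[of P v w "\<lambda>_. 0" "\<lambda>_. 0" g2 "\<lambda>h. - g1 h" r u f0 b "\<lambda>h. Z h + e h" "\<lambda>h. Z h - e h" c W])
       (use lin flin vlin in \<open>auto simp: F' algebra_simps\<close>)
qed

text \<open>Independence of \<open>p, x, y, z\<close> is automatic: \<open>t p z\<close> isolates
  the coefficient of \<open>z\<close> and \<open>t z z\<close> that of \<open>p\<close>. The section
  is now described by an equation \<open>\<tau>\<close>, and lines through \<open>z\<close> by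
  arbitrary directions.\<close>

lemma pfaffian_if_section_basis:
  assumes tau: "linear_form \<tau>" "\<tau> p = 0" "\<tau> z = 0" "\<tau> x = 0" "\<tau> y = 0"
    and pT: "\<And>u. \<tau> u = 0 \<Longrightarrow> t p p u = 0"
    and z: "t p z z = 1 / 3" "t z z z = 0" "t p z x = 0" "t p z y = 0" "t z z x = 0" "t z z y = 0"
    and nolines: "\<And>d. \<tau> d = 0 \<Longrightarrow> t z z d = 0 \<Longrightarrow> t z d d = 0 \<Longrightarrow> t d d d = 0 \<Longrightarrow> d \<in> vec.span {z}"
    and xy: "\<And>i j. i *s x + j *s y = 0 \<Longrightarrow> i = 0 \<and> j = 0"
    and sys: "determinantal_system (\<lambda>i j. 3 * t p (i *s x + j *s y) (i *s x + j *s y))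
        (\<lambda>i j. 3 * t z (i *s x + j *s y) (i *s x + j *s y)) (\<lambda>i j. t (i *s x + j *s y) (i *s x + j *s y) (i *s x + j *s y))"
  shows "pfaffian_function (\<lambda>x. t x x x)"
proof (rule pfaffian_if_determinantal_section[OF _ _ _ _ _ z _ sys])
  show pp: "t p p p = 0" "t p p x = 0" "t p p y = 0" "t p p z = 0" using pT tau by simp_all
  fix i j k l
  assume *: "i *s p + j *s x + k *s y + l *s z = 0"
  have "t p z (i *s p + j *s x + k *s y + l *s z) = l / 3"
    using pp z by (simp add: trilinear symmetric)
  hence l: "l = 0" unfolding * by (simp add: trilinear)
  have "t z z (i *s p + j *s x + k *s y + l *s z) = i / 3"
    using pp z by (simp add: trilinear symmetric)
  hence i: "i = 0" unfolding * by (simp add: trilinear)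
  show "i = 0 \<and> j = 0 \<and> k = 0 \<and> l = 0" using xy[of j k] * i l by simp
next
  fix i j
  let ?u = "i *s x + j *s y"
  assume u: "t z ?u ?u = 0" "t ?u ?u ?u = 0"
  have "\<tau> ?u = 0" using tau by (simp add: linear_form_add linear_form_scale)
  moreover have "t z z ?u = 0" using z by (simp add: trilinear)
  ultimately obtain c where c: "?u = c *s z" using nolines u by (auto simp: span1_iff)
  have "t p z ?u = c / 3" unfolding c using z by (simp add: trilinear)
  moreover have "t p z ?u = 0" using z by (simp add: trilinear)
  ultimately show "i = 0 \<and> j = 0" using xy[of i j] c by simp
qed

text \<open>The vectors \<open>x, y\<close> are sought in the section, in the kernels of
  \<open>t p z\<close> and \<open>t z z\<close>. There \<open>a\<close> shows that the binary form
  \<open>t p\<close> is nonzero, so over the complex numbers it can be normalised to a product or a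
  square.\<close>

lemma pfaffian_if_section_point:
  assumes tau: "linear_form \<tau>" "\<tau> p = 0" "\<tau> z = 0"
    and pT: "\<And>u. \<tau> u = 0 \<Longrightarrow> t p p u = 0"
    and z: "t p z z \<noteq> 0" "t z z z = 0"
    and nolines: "\<And>d. \<tau> d = 0 \<Longrightarrow> t z z d = 0 \<Longrightarrow> t z d d = 0 \<Longrightarrow> t d d d = 0 \<Longrightarrow> d \<in> vec.span {z}"
    and a: "\<tau> a = 0" "t p z a = 0" "t z z a = 0" "t p a a \<noteq> 0"
  shows "pfaffian_function (\<lambda>x. t x x x)"
proof -
  define k where "k = 1 / (3 * t p z z)"
  define P where "P = k *s p"
  have k: "k \<noteq> 0" using z by (simp add: k_def)
  have P: "\<tau> P = 0" "\<And>u. \<tau> u = 0 \<Longrightarrow> t P P u = 0" "t P z z = 1 / 3" "\<And>u v. t P u v = k * t p u v"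
    using tau pT z by (simp_all add: P_def linear_form_scale trilinear k_def)
  have sysI: "pfaffian_function (\<lambda>x. t x x x)"
    if xy: "\<tau> x = 0" "\<tau> y = 0" "t p z x = 0" "t p z y = 0" "t z z x = 0" "t z z y = 0" "\<And>i j. i *s x + j *s y = 0 \<Longrightarrow> i = 0 \<and> j = 0"
      and q: "t P x x = q0" "t P x y = q1" "t P y y = q2" "q0 = 0 \<and> q1 = - (1 / 6) \<and> q2 = 0 \<or> q0 = - (1 / 3) \<and> q1 = 0 \<and> q2 = 0"
    for x y q0 q1 q2
  proof (rule pfaffian_if_section_basis[OF tau(1) P(1) tau(3) xy(1,2) P(2,3) z(2) _ _ xy(5,6) nolines xy(7)])
    have m: "(\<lambda>i j. 3 * t z (i *s x + j *s y) (i *s x + j *s y)) = (\<lambda>i j. (3 * t z x x) * i\<^sup>2 + (6 * t z x y) * i * j + (3 * t z y y) * j\<^sup>2)"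
      by (simp add: binary_quadratic_form fun_eq_iff algebra_simps)
    have n: "(\<lambda>i j. t (i *s x + j *s y) (i *s x + j *s y) (i *s x + j *s y)) =
       (\<lambda>i j. t x x x * i ^ 3 + (3 * t x x y) * i\<^sup>2 * j + (3 * t x y y) * i * j\<^sup>2 + t y y y * j ^ 3)"
      by (simp add: binary_cubic_form fun_eq_iff)
    show "determinantal_system (\<lambda>i j. 3 * t P (i *s x + j *s y) (i *s x + j *s y))
        (\<lambda>i j. 3 * t z (i *s x + j *s y) (i *s x + j *s y)) (\<lambda>i j. t (i *s x + j *s y) (i *s x + j *s y) (i *s x + j *s y))"
      using q(4)
    proof
      assume "q0 = 0 \<and> q1 = - (1 / 6) \<and> q2 = 0"
      hence "(\<lambda>i j. 3 * t P (i *s x + j *s y) (i *s x + j *s y)) = (\<lambda>i j. - (i * j))"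
        using q(1-3) by (simp add: binary_quadratic_form fun_eq_iff)
      thus ?thesis unfolding m n using determinantal_system_nondegenerate by simp
    next
      assume "q0 = - (1 / 3) \<and> q1 = 0 \<and> q2 = 0"
      hence "(\<lambda>i j. 3 * t P (i *s x + j *s y) (i *s x + j *s y)) = (\<lambda>i j. - (i * i))"
        using q(1-3) by (simp add: binary_quadratic_form fun_eq_iff power2_eq_square)
      thus ?thesis unfolding m n using determinantal_system_rank_one by simp
    qed
  qed (use P xy in simp_all)
  obtain y0 where y0: "y0 \<notin> vec.span {a}" "\<tau> y0 = 0" "t p z y0 = 0" "t z z y0 = 0"
    by (rule ex_kernel_not_in_span1[OF tau(1) linear_form_third[of p z] linear_form_third[of z z]])
  define y where "y = y0 - (t p a y0 / t p a a) *s a"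
  have y: "\<tau> y = 0" "t p z y = 0" "t z z y = 0" "t p a y = 0"
    using y0 a tau(1) linear_form_add[OF tau(1), of y "(t p a y0 / t p a a) *s a"]
    by (simp_all add: y_def trilinear linear_form_scale)
  have ind: "i = 0 \<and> j = 0" if "i *s a + j *s y = 0" for i j
  proof -
    have "t p a (i *s a + j *s y) = i * t p a a" using y by (simp add: trilinear)
    hence i: "i = 0" unfolding that using a by (simp add: trilinear)
    have "y \<noteq> 0" using y0(1) by (auto simp: y_def span1_iff)
    thus ?thesis using that i by simp
  qed
  show ?thesis
  proof (cases "t p y y = 0")
    case True
    \<comment> \<open>Rank one: \<open>s\<close> scales the form to \<open>- 1 / 3\<close> on
      \<open>a\<close>, so that \<open>q\<close> becomes \<open>- i * i\<close>.\<close>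
    define s where "s = csqrt (- 1 / (3 * k * t p a a))"
    have s: "s * s = - 1 / (3 * k * t p a a)" by (simp add: s_def power2_eq_square[symmetric])
    hence s0: "s \<noteq> 0" using k a by auto
    show ?thesis
    proof (rule sysI[of "s *s a" y "- (1 / 3)" 0 0])
      have "t P (s *s a) (s *s a) = k * (s * s) * t p a a" by (simp add: P trilinear)
      thus "t P (s *s a) (s *s a) = - (1 / 3)" unfolding s using k a by simp
      fix i j assume "i *s (s *s a) + j *s y = 0"
      thus "i = 0 \<and> j = 0" using ind[of "i * s" j] s0 by simp
    qed (use a y True tau P in \<open>simp_all add: trilinear linear_form_scale\<close>)
  next
    case False
    \<comment> \<open>Rank two: \<open>a + s *s y\<close> and \<open>a - s *s y\<close> are
      isotropic, and \<open>c\<close> scales their product to \<open>- 1 / 6\<close>, so that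
      \<open>q\<close> becomes \<open>- i * j\<close>.\<close>
    define s where "s = csqrt (- (t p a a / t p y y))"
    have s: "s * s = - (t p a a / t p y y)" by (simp add: s_def power2_eq_square[symmetric])
    hence s0: "s \<noteq> 0" using False a by auto
    define c where "c = - 1 / (12 * k * t p a a)"
    have c0: "c \<noteq> 0" using k a by (simp add: c_def)
    have iso: "t p a a + s * s * t p y y = 0" unfolding s using False by simp
    show ?thesis
    proof (rule sysI[of "c *s (a + s *s y)" "a - s *s y" 0 "- (1 / 6)" 0])
      have "t p (a + s *s y) (a + s *s y) = t p a a + s * s * t p y y" "t p (a - s *s y) (a - s *s y) = t p a a + s * s * t p y y"
        using y(4) by (simp_all add: trilinear symmetric algebra_simps)
      thus "t P (c *s (a + s *s y)) (c *s (a + s *s y)) = 0" "t P (a - s *s y) (a - s *s y) = 0"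
        using iso by (simp_all only: P scale2 scale3 mult_zero_right)
      have "t p (a + s *s y) (a - s *s y) = t p a a - s * s * t p y y"
        using y(4) by (simp add: trilinear symmetric algebra_simps)
      also have "\<dots> = 2 * t p a a" using iso by (simp add: eq_neg_iff_add_eq_0[symmetric])
      finally have "t P (c *s (a + s *s y)) (a - s *s y) = k * (c * (2 * t p a a))"
        by (simp only: P(4) scale2 ac_simps)
      thus "t P (c *s (a + s *s y)) (a - s *s y) = - (1 / 6)"
        using k a by (simp add: c_def)
      fix i j assume "i *s (c *s (a + s *s y)) + j *s (a - s *s y) = 0"
      hence "(i * c + j) *s a + (s * (i * c - j)) *s y = 0"
        by (simp add: vec.scale_right_distrib vec.scale_left_distrib vec.scale_right_diff_distrib vec.scale_left_diff_distrib algebra_simps)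
      note h = ind[OF this]
      have e: "i * c + j = 0" "i * c = j" using conjunct1[OF h] conjunct2[OF h] s0 by simp_all
      from e(1) have "2 * j = 0" unfolding e(2) by (simp only: mult_2)
      hence "i * c = 0 \<and> j = 0" using e(2) by simp
      thus "i = 0 \<and> j = 0" using c0 by simp
    qed (use a y tau linear_form_add[OF tau(1)] linear_form_scale[OF tau(1)] linear_form_add[OF tau(1), of "a - s *s y" "s *s y"] in \<open>simp_all add: trilinear\<close>)
  qed
qed

end

section \<open>Singular hyperplane sections\<close>

context cubic_fourspace
begin

definition contains_plane :: bool where
  "contains_plane \<longleftrightarrow> (\<exists>a b c. (\<forall>i j k. i *s a + j *s b + k *s c = 0 \<longrightarrow> i = 0 \<and> j = 0 \<and> k = 0) \<and> plane_in a b c)"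

lemma pfaffian_if_contains_plane: "contains_plane \<Longrightarrow> pfaffian_function (\<lambda>x. t x x x)"
  unfolding contains_plane_def using pfaffian_if_plane by blast

text \<open>The section spanned by \<open>p, r1, r2, r3\<close> is singular at \<open>p\<close>,
  with tangent cone \<open>x1 * x2 = k * x3^2\<close>. It is used for \<open>k = 1\<close>, a smooth
  conic, and \<open>k = 0\<close>, two lines meeting in the node \<open>r3\<close>.\<close>

definition singular_section :: "complex ^ 5 \<Rightarrow> complex ^ 5 \<Rightarrow> complex ^ 5 \<Rightarrow> complex ^ 5 \<Rightarrow> complex \<Rightarrow> bool" where
  "singular_section p r1 r2 r3 k \<longleftrightarrow>
     p \<noteq> 0 \<and> r3 \<notin> vec.span {p} \<and> t p p p = 0 \<and> t p p r1 = 0 \<and> t p p r2 = 0 \<and> t p p r3 = 0 \<and>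
     t p r1 r1 = 0 \<and> t p r2 r2 = 0 \<and> t p r1 r2 = 1 / 2 \<and> t p r1 r3 = 0 \<and> t p r2 r3 = 0 \<and> t p r3 r3 = - k"

text \<open>\<open>t p\<close> detects \<open>r1\<close> and \<open>r2\<close>, but for
  \<open>k = 0\<close> it does not see \<open>r3\<close>; therefore \<open>r3\<close> is separated
  from \<open>p\<close> by the definition.\<close>

lemma singular_section_independent:
  assumes "singular_section p r1 r2 r3 k" "i *s p + x1 *s r1 + x2 *s r2 + x3 *s r3 = 0"
  shows "i = 0 \<and> x1 = 0 \<and> x2 = 0 \<and> x3 = 0"
proof -
  note s = assms(1)[unfolded singular_section_def]
  have "t p r2 (i *s p + x1 *s r1 + x2 *s r2 + x3 *s r3) = x1 / 2"
    using s sym12 sym23 by (simp add: trilinear symmetric)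
  hence 1: "x1 = 0" unfolding assms(2) by (simp add: trilinear)
  have "t p r1 (i *s p + x1 *s r1 + x2 *s r2 + x3 *s r3) = x2 / 2"
    using s by (simp add: trilinear symmetric)
  hence 2: "x2 = 0" unfolding assms(2) by (simp add: trilinear)
  have e: "i *s p + x3 *s r3 = 0" using assms(2) 1 2 by simp
  have x3: "x3 = 0" by (rule coefficient_zero[OF e, of "{p}"]) (use s in \<open>auto simp: span1_iff\<close>)
  thus ?thesis using 1 2 e s by simp
qed

lemma singular_section_conic:
  assumes "singular_section p r1 r2 r3 k"
  shows "t p (x1 *s r1 + x2 *s r2 + x3 *s r3) (y1 *s r1 + y2 *s r2 + y3 *s r3) = (x1 * y2 + x2 * y1) / 2 - k * (x3 * y3)"
  using assms unfolding singular_section_def by (simp add: trilinear symmetric field_simps)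

lemma singular_section_cubic:
  assumes "singular_section p r1 r2 r3 k"
  shows "t (i *s p + (x1 *s r1 + x2 *s r2 + x3 *s r3)) (i *s p + (x1 *s r1 + x2 *s r2 + x3 *s r3)) (i *s p + (x1 *s r1 + x2 *s r2 + x3 *s r3)) =
    3 * i * (x1 * x2 - k * (x3 * x3)) + t (x1 *s r1 + x2 *s r2 + x3 *s r3) (x1 *s r1 + x2 *s r2 + x3 *s r3) (x1 *s r1 + x2 *s r2 + x3 *s r3)"
proof -
  let ?r = "x1 *s r1 + x2 *s r2 + x3 *s r3"
  have exp: "t (i *s p + r) (i *s p + r) (i *s p + r) = 3 * i * t p r r + t r r r" if "t p p r = 0" "t p p p = 0" for r
    using that by (simp add: trilinear symmetric algebra_simps)
  have "t p p ?r = 0" "t p p p = 0" using assms unfolding singular_section_def by (simp_all add: trilinear)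
  hence "t (i *s p + ?r) (i *s p + ?r) (i *s p + ?r) = 3 * i * t p ?r ?r + t ?r ?r ?r" by (rule exp)
  thus ?thesis unfolding singular_section_conic[OF assms] by simp
qed

text \<open>It remains to find a point of the section off the cone over the conic that lies on no line of the section.
  Such a line would project to a line that meets the conic in zeros of the cubic.\<close>

lemma pfaffian_if_singular_section:
  assumes S: "singular_section p r1 r2 r3 k"
    and w: "w2 - k * w3\<^sup>2 \<noteq> 0"
    and nolines: "\<And>i x1 x2 x3.
      \<lbrakk>x1 \<noteq> 0 \<or> x2 \<noteq> 0 \<or> x3 \<noteq> 0; x1 * x2 = k * x3\<^sup>2;
       t (x1 *s r1 + x2 *s r2 + x3 *s r3) (x1 *s r1 + x2 *s r2 + x3 *s r3) (x1 *s r1 + x2 *s r2 + x3 *s r3) = 0;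
       \<And>c. 2 * c * ((x2 + w2 * x1) / 2 - k * (w3 * x3)) + (w2 - k * w3\<^sup>2) = 0 \<Longrightarrow>
         t ((1 + c * x1) *s r1 + (w2 + c * x2) *s r2 + (w3 + c * x3) *s r3) ((1 + c * x1) *s r1 + (w2 + c * x2) *s r2 + (w3 + c * x3) *s r3)
           ((1 + c * x1) *s r1 + (w2 + c * x2) *s r2 + (w3 + c * x3) *s r3) = 0;
       x1 = 0 \<Longrightarrow> x2 = 0 \<Longrightarrow> k = 0 \<Longrightarrow> t r1 r3 r3 + w2 * t r2 r3 r3 + w3 * t r3 r3 r3 = 0\<rbrakk> \<Longrightarrow> False"
  shows "pfaffian_function (\<lambda>x. t x x x)"
proof -
  note s = S[unfolded singular_section_def]
  define w0 where "w0 = 1 *s r1 + w2 *s r2 + w3 *s r3"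
  define b where "b = w2 - k * w3\<^sup>2"
  have bw: "t p w0 w0 = b" unfolding w0_def singular_section_conic[OF S] by (simp add: b_def power2_eq_square)
  have b: "b \<noteq> 0" using w by (simp add: b_def)
  \<comment> \<open>The cubic is linear along the line from \<open>p\<close> through
    \<open>w0\<close>, so this line has one point \<open>z\<close> of the section besides
    \<open>p\<close>.\<close>
  define j where "j = - t w0 w0 w0 / (3 * b)"
  define z where "z = j *s p + w0"
  have ppw: "t p p w0 = 0" using s by (simp add: w0_def trilinear)
  have zz: "t z z z = 0"
  proof -
    have "t z z z = 3 * j * b + t w0 w0 w0"
      using singular_section_cubic[OF S, of j 1 w2 w3] by (simp add: z_def w0_def b_def power2_eq_square)
    thus ?thesis using b by (simp add: j_def)
  qed
  have pzz: "t p z z = b" using bw ppw s by (simp add: z_def trilinear symmetric)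
  obtain e where e: "e \<notin> vec.span {p, r1, r2, r3}" by (rule ex_not_in_span4)
  have "independent_tuple p r1 r2 r3 e" unfolding independent_tuple_def
  proof (intro allI impI)
    fix i x1 x2 x3 m assume *: "i *s p + x1 *s r1 + x2 *s r2 + x3 *s r3 + m *s e = 0"
    have "m = 0" by (rule coefficient_zero[OF * _ e]) (unfold span4_iff, blast)
    thus "i = 0 \<and> x1 = 0 \<and> x2 = 0 \<and> x3 = 0 \<and> m = 0"
      using singular_section_independent[OF S, of i x1 x2 x3] * by simp
  qed
  then obtain P R1 R2 R3 \<tau> where "linear_form P" "linear_form R1" "linear_form R2" "linear_form R3" and
    tau: "linear_form \<tau>" and co: "\<And>v. v = P v *s p + R1 v *s r1 + R2 v *s r2 + R3 v *s r3 + \<tau> v *s e"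
    by (rule independent_tuple_coordinates) (rule that)
  have tau_ker: "\<exists>i x1 x2 x3. v = i *s p + (x1 *s r1 + x2 *s r2 + x3 *s r3)" if "\<tau> v = 0" for v
  proof -
    have "v = P v *s p + (R1 v *s r1 + R2 v *s r2 + R3 v *s r3)"
      by (rule trans[OF co[of v]]) (simp add: that add.assoc)
    thus ?thesis by blast
  qed
  have tau0: "\<tau> v = 0" if "v \<in> vec.span {p, r1, r2, r3}" for v
  proof (rule ccontr)
    assume "\<tau> v \<noteq> 0"
    have sp: "P v *s p + R1 v *s r1 + R2 v *s r2 + R3 v *s r3 - v \<in> vec.span {p, r1, r2, r3}"
      by (rule vec.span_diff[OF _ that]) (unfold span4_iff, blast)
    have "(P v *s p + R1 v *s r1 + R2 v *s r2 + R3 v *s r3 - v) + \<tau> v *s e =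
        (P v *s p + R1 v *s r1 + R2 v *s r2 + R3 v *s r3 + \<tau> v *s e) - v"
      by (simp only: diff_add_eq)
    also have "\<dots> = 0" by (rule iffD2[OF right_minus_eq co[of v, symmetric]])
    finally have "(P v *s p + R1 v *s r1 + R2 v *s r2 + R3 v *s r3 - v) + \<tau> v *s e = 0" .
    from coefficient_zero[OF this sp e] show False using \<open>\<tau> v \<noteq> 0\<close> by simp
  qed
  have zspan: "z = j *s p + 1 *s r1 + w2 *s r2 + w3 *s r3" by (simp add: z_def w0_def add.assoc)
  have "z \<in> vec.span {p, r1, r2, r3}" unfolding span4_iff using zspan by blast
  hence tauz: "\<tau> p = 0" "\<tau> z = 0" by (auto intro!: tau0 vec.span_base)
  have pT: "t p p u = 0" if "\<tau> u = 0" for u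
    using tau_ker[OF that] s by (auto simp: trilinear)
  have nl: "d \<in> vec.span {z}" if d: "\<tau> d = 0" "t z z d = 0" "t z d d = 0" "t d d d = 0" for d
  proof (rule ccontr)
    assume dz: "d \<notin> vec.span {z}"
    \<comment> \<open>The line of \<open>z\<close> and \<open>d\<close> meets the tangent cone at
      \<open>p\<close> in a point \<open>v\<close>. Its projection \<open>r\<close> lies on the
      conic, and since \<open>v\<close> is on the section, \<open>r\<close> is also a zero of the
      cubic.\<close>
    obtain f g where fg: "f \<noteq> 0 \<or> g \<noteq> 0" "t p (f *s z + g *s d) (f *s z + g *s d) = 0" by (rule ex_isotropic_on_line)
    define v where "v = f *s z + g *s d"
    have v: "t z z v = 0" "t z v v = 0" "t v v v = 0" using d zz by (simp_all add: v_def trilinear symmetric)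
    have v0: "v \<noteq> 0"
    proof
      assume "v = 0"
      hence g: "g = 0" using coefficient_zero[of "f *s z" g d "{z}"] dz by (auto simp: v_def span1_iff)
      moreover have "z \<noteq> 0" using pzz b by (auto simp: trilinear)
      ultimately show False using \<open>v = 0\<close> fg(1) by (simp add: v_def)
    qed
    have "\<tau> v = 0" using tau tauz d by (simp add: v_def linear_form_add linear_form_scale)
    then obtain i x1 x2 x3 where vi: "v = i *s p + (x1 *s r1 + x2 *s r2 + x3 *s r3)" using tau_ker by blast
    define r where "r = x1 *s r1 + x2 *s r2 + x3 *s r3"
    have vi': "v = i *s p + r" by (simp add: vi r_def)
    have ppr: "t p p r = 0" using s by (simp add: r_def trilinear)
    have "t p r r = t p v v" using s ppr by (simp add: vi' trilinear symmetric)
    hence prr: "t p r r = 0" using fg(2) by (simp add: v_def)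
    hence conic: "x1 * x2 = k * x3\<^sup>2" unfolding r_def singular_section_conic[OF S] by (simp add: power2_eq_square)
    have rrr: "t r r r = 0"
      using v(3) singular_section_cubic[OF S, of i x1 x2 x3] conic by (simp add: vi r_def power2_eq_square)
    have "t z z p = b" using pzz sym12 sym23 by metis
    have r0: "r \<noteq> 0"
    proof
      assume "r = 0"
      hence "v = i *s p" by (simp add: vi')
      hence "i * t z z p = 0" using v(1) by (simp add: trilinear)
      hence "i = 0" using \<open>t z z p = b\<close> b by simp
      thus False using \<open>v = i *s p\<close> v0 by simp
    qed
    hence x: "x1 \<noteq> 0 \<or> x2 \<noteq> 0 \<or> x3 \<noteq> 0" by (auto simp: r_def)
    have pwr: "t p w0 r = (x2 + w2 * x1) / 2 - k * (w3 * x3)"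
      unfolding w0_def r_def singular_section_conic[OF S] by (simp add: algebra_simps)
    show False
    proof (rule nolines[OF x conic])
      show "t (x1 *s r1 + x2 *s r2 + x3 *s r3) (x1 *s r1 + x2 *s r2 + x3 *s r3) (x1 *s r1 + x2 *s r2 + x3 *s r3) = 0"
        using rrr by (simp add: r_def)
    next
      \<comment> \<open>This \<open>c\<close> makes \<open>w0 + c *s r\<close> the second point of
        the conic on the projected line. The point above it on the line of the section forces the
        cubic to vanish there.\<close>
      fix c assume c: "2 * c * ((x2 + w2 * x1) / 2 - k * (w3 * x3)) + (w2 - k * w3\<^sup>2) = 0"
      have r': "w0 + c *s r = (1 + c * x1) *s r1 + (w2 + c * x2) *s r2 + (w3 + c * x3) *s r3"
        by (simp add: w0_def r_def vec.scale_right_distrib vec.scale_left_distrib algebra_simps)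
      have "t p (w0 + c *s r) (w0 + c *s r) = t p w0 w0 + 2 * c * t p w0 r"
        using prr by (simp add: trilinear symmetric)
      hence q: "t p (w0 + c *s r) (w0 + c *s r) = 0" using c by (simp add: bw pwr b_def add.commute)
      hence q': "(1 + c * x1) * (w2 + c * x2) - k * ((w3 + c * x3) * (w3 + c * x3)) = 0"
        unfolding r' singular_section_conic[OF S] by simp
      have "z + c *s v = (j + c * i) *s p + (w0 + c *s r)"
        by (simp add: z_def vi' vec.scale_right_distrib vec.scale_left_distrib algebra_simps)
      moreover have "t (z + c *s v) (z + c *s v) (z + c *s v) = 0" using v zz by (simp add: trilinear symmetric)
      ultimately have "t ((j + c * i) *s p + (w0 + c *s r)) ((j + c * i) *s p + (w0 + c *s r)) ((j + c * i) *s p + (w0 + c *s r)) = 0" by simp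
      thus "t ((1 + c * x1) *s r1 + (w2 + c * x2) *s r2 + (w3 + c * x3) *s r3) ((1 + c * x1) *s r1 + (w2 + c * x2) *s r2 + (w3 + c * x3) *s r3)
           ((1 + c * x1) *s r1 + (w2 + c * x2) *s r2 + (w3 + c * x3) *s r3) = 0"
        unfolding r' singular_section_cubic[OF S] q' by simp
    next
      \<comment> \<open>At the node no such \<open>c\<close> exists, because \<open>t p w0 r\<close>
        vanishes; the condition is taken from \<open>t z v v = 0\<close> instead.\<close>
      assume x12: "x1 = 0" "x2 = 0" and k: "k = 0"
      hence x3: "x3 \<noteq> 0" using x by simp
      have ve: "v = i *s p + x3 *s r3" using x12 by (simp add: vi)
      have "t z v v = x3 * x3 * t w0 r3 r3"
        using s k unfolding z_def ve w0_def by (simp add: trilinear symmetric algebra_simps)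
      hence "t w0 r3 r3 = 0" using v(2) x3 by simp
      thus "t r1 r3 r3 + w2 * t r2 r3 r3 + w3 * t r3 r3 r3 = 0" by (simp add: w0_def trilinear)
    qed
  qed
  \<comment> \<open>Coordinates of a vector that is orthogonal to \<open>w0\<close> and not
    isotropic for the conic.\<close>
  obtain a1 a2 a3 where a123: "a2 + w2 * a1 = 2 * k * (w3 * a3)" "a1 * a2 - k * (a3 * a3) \<noteq> 0"
  proof (cases "k = 0")
    case True
    thus ?thesis using that[of "- w2" 1 0] w by simp
  next
    case False
    thus ?thesis using that[of "2 * k * w3" 0 1] by simp
  qed
  define a where "a = a1 *s r1 + a2 *s r2 + a3 *s r3"
  have a_w0: "t p w0 a = 0"
    unfolding w0_def a_def singular_section_conic[OF S] using a123(1) by (simp add: field_simps)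
  have paa: "t p a a \<noteq> 0" unfolding a_def singular_section_conic[OF S] using a123(2) by (simp add: algebra_simps)
  have ppa: "t p p a = 0" using s by (simp add: a_def trilinear)
  have "a = 0 *s p + a1 *s r1 + a2 *s r2 + a3 *s r3" by (simp add: a_def)
  hence taua: "\<tau> a = 0" by (intro tau0) (unfold span4_iff, blast)
  \<comment> \<open>The multiple of \<open>p\<close> corrects the value of \<open>t z z\<close> and
    leaves the values of \<open>t p\<close> on the section unchanged.\<close>
  define a' where "a' = a - (t z z a / b) *s p"
  show ?thesis
  proof (rule pfaffian_if_section_point[OF tau tauz pT _ zz nl, of a'])
    show "t p z z \<noteq> 0" using pzz b by simp
    show "\<tau> a' = 0" using tau taua tauz linear_form_add[OF tau, of a' "(t z z a / b) *s p"] by (simp add: a'_def linear_form_scale)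
    have "t z z p = b" using pzz sym12 sym23 by metis
    thus "t z z a' = 0" using b by (simp add: a'_def trilinear)
    have "t p p z = 0" using pT tauz by simp
    thus "t p z a' = 0" using a_w0 ppa by (simp add: a'_def z_def trilinear symmetric)
    show "t p a' a' \<noteq> 0" using paa ppa s by (simp add: a'_def trilinear symmetric)
  qed
qed

section \<open>Sections with a smooth tangent conic\<close>

lemma cubic_scale: "t (c *s v) (c *s v) (c *s v) = c ^ 3 * t v v v"
  by (simp add: trilinear power3_eq_cube)

text \<open>A cubic that vanishes along the conic is \<open>3 l (x y - z^2)\<close> with a linear
  form \<open>l\<close>. The section is then a product, and its factor \<open>i + l\<close> defines
  a plane of the threefold, spanned by \<open>a1, a2, a3\<close>.\<close>

lemma ex_conic_point_off_cubic:
  assumes S: "singular_section p r1 r2 r3 1" and noplane: "\<not> contains_plane"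
  shows "\<exists>s. t (1 *s r1 + s\<^sup>2 *s r2 + s *s r3) (1 *s r1 + s\<^sup>2 *s r2 + s *s r3) (1 *s r1 + s\<^sup>2 *s r2 + s *s r3) \<noteq> 0"
proof (rule ccontr)
  assume *: "\<not> ?thesis"
  let ?c = "[: t r1 r1 r1, 3 * t r1 r1 r3, 3 * t r1 r1 r2 + 3 * t r1 r3 r3, 6 * t r1 r2 r3 + t r3 r3 r3,
    3 * t r1 r2 r2 + 3 * t r2 r3 r3, 3 * t r2 r2 r3, t r2 r2 r2 :]"
  have "poly ?c s = 0" for s
  proof -
    have "t (1 *s r1 + s\<^sup>2 *s r2 + s *s r3) (1 *s r1 + s\<^sup>2 *s r2 + s *s r3) (1 *s r1 + s\<^sup>2 *s r2 + s *s r3) = poly ?c s"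
      by (simp add: trilinear symmetric power2_eq_square algebra_simps)
    thus ?thesis using * by simp
  qed
  hence "?c = 0" by (simp add: poly_all_0_iff_0[symmetric])
  hence h: "t r1 r1 r1 = 0" "3 * t r1 r1 r3 = 0" "3 * t r1 r1 r2 + 3 * t r1 r3 r3 = 0" "6 * t r1 r2 r3 + t r3 r3 r3 = 0"
    "3 * t r1 r2 r2 + 3 * t r2 r3 r3 = 0" "3 * t r2 r2 r3 = 0" "t r2 r2 r2 = 0"
    by (simp_all only: pCons_eq_0_iff)
  have neg: "y = - x" if "3 * x + 3 * y = 0" for x y :: complex
  proof -
    have "3 * (x + y) = 0" using that by (simp only: distrib_left)
    hence "x + y = 0" by (simp only: mult_eq_0_iff) simp
    thus ?thesis by (simp add: eq_neg_iff_add_eq_0 add.commute)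
  qed
  have "t r3 r3 r3 = - (6 * t r1 r2 r3)" using h(4) by (simp add: eq_neg_iff_add_eq_0 add.commute)
  note c = h(1,7) neg[OF h(3)] neg[OF h(5)] this
  have c': "t r1 r1 r3 = 0" "t r2 r2 r3 = 0" using h(2,6) by simp_all
  define a1 a2 a3 where "a1 = r1 - t r1 r1 r2 *s p" and "a2 = r2 - t r1 r2 r2 *s p" and "a3 = r3 - (2 * t r1 r2 r3) *s p"
  have a: "x *s a1 + y *s a2 + z *s a3 = (- (x * t r1 r1 r2 + y * t r1 r2 r2 + z * (2 * t r1 r2 r3))) *s p + (x *s r1 + y *s r2 + z *s r3)" for x y z
    by (simp add: a1_def a2_def a3_def vec.scale_right_diff_distrib vec.scale_left_distrib vec.scale_left_diff_distrib vec.scale_minus_left algebra_simps)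
  have "plane_in a1 a2 a3"
  proof (rule plane_inI)
    fix x y z
    define l where "l = x * t r1 r1 r2 + y * t r1 r2 r2 + z * (2 * t r1 r2 r3)"
    have "t (x *s r1 + y *s r2 + z *s r3) (x *s r1 + y *s r2 + z *s r3) (x *s r1 + y *s r2 + z *s r3) =
      3 * l * (x * y - z * z)"
      by (simp add: l_def trilinear symmetric c c' algebra_simps)
    thus "t (x *s a1 + y *s a2 + z *s a3) (x *s a1 + y *s a2 + z *s a3) (x *s a1 + y *s a2 + z *s a3) = 0"
      unfolding a singular_section_cubic[OF S] l_def[symmetric] by simp
  qed
  moreover have "x = 0 \<and> y = 0 \<and> z = 0" if "x *s a1 + y *s a2 + z *s a3 = 0" for x y z
    using singular_section_independent[OF S] that unfolding a add.assoc[symmetric] by blast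
  ultimately show False using noplane unfolding contains_plane_def by blast
qed

text \<open>The set \<open>N\<close> of parameters of zeros of the cubic on the conic is finite. It
  suffices that \<open>w0\<close> avoids the conic and the lines joining two zeros, tangents
  included; for the parameters \<open>s, s'\<close> this line is
  \<open>w2 = (s + s') * w3 - s * s'\<close>.\<close>

lemma pfaffian_if_section_rank_three:
  assumes S: "singular_section p r1 r2 r3 1" and noplane: "\<not> contains_plane"
  shows "pfaffian_function (\<lambda>x. t x x x)"
proof -
  define g where "g s = t (1 *s r1 + s\<^sup>2 *s r2 + s *s r3) (1 *s r1 + s\<^sup>2 *s r2 + s *s r3) (1 *s r1 + s\<^sup>2 *s r2 + s *s r3)" for s
  define N where "N = {s. g s = 0}"
  have "polyfun g" unfolding g_def by (rule polyfun_cubic) auto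
  moreover obtain s0 where "g s0 \<noteq> 0" using ex_conic_point_off_cubic[OF assms] unfolding g_def by blast
  ultimately have fin: "finite N" unfolding N_def by (rule polyfun_finite_zeros)
  \<comment> \<open>The parametrisation misses the point \<open>r2\<close> of the conic. The line
    through \<open>r2\<close> and \<open>w0\<close> meets the conic again at the parameter
    \<open>w3\<close>, so this choice excludes it.\<close>
  obtain w3 where w3: "w3 \<notin> N" using ex_new_if_finite[OF infinite_UNIV_char_0 fin] by blast
  have "finite (insert (w3\<^sup>2) ((\<lambda>(s, s'). (s + s') * w3 - s * s') ` (N \<times> N)))" using fin by simp
  then obtain w2 where w2: "w2 \<notin> insert (w3\<^sup>2) ((\<lambda>(s, s'). (s + s') * w3 - s * s') ` (N \<times> N))"
    using ex_new_if_finite[OF infinite_UNIV_char_0] by blast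
  have w2N: "w2 \<noteq> (s + s') * w3 - s * s'" if "s \<in> N" "s' \<in> N" for s s' using w2 that by force
  have point: "s \<in> N" if "f \<noteq> 0" "x1 = f" "x2 = f * s\<^sup>2" "x3 = f * s"
    "t (x1 *s r1 + x2 *s r2 + x3 *s r3) (x1 *s r1 + x2 *s r2 + x3 *s r3) (x1 *s r1 + x2 *s r2 + x3 *s r3) = 0" for f s x1 x2 x3
  proof -
    have "x1 *s r1 + x2 *s r2 + x3 *s r3 = f *s (1 *s r1 + s\<^sup>2 *s r2 + s *s r3)"
      using that(2-4) by (simp add: vec.scale_right_distrib)
    thus ?thesis using that(1,5) by (simp only: cubic_scale) (simp add: N_def g_def)
  qed
  show ?thesis
  proof (rule pfaffian_if_singular_section[OF S, of w2 w3])
    show "w2 - 1 * w3\<^sup>2 \<noteq> 0" using w2 by simp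
    fix i x1 x2 x3
    assume x: "x1 \<noteq> 0 \<or> x2 \<noteq> 0 \<or> x3 \<noteq> 0" and con: "x1 * x2 = 1 * x3\<^sup>2"
      and cub: "t (x1 *s r1 + x2 *s r2 + x3 *s r3) (x1 *s r1 + x2 *s r2 + x3 *s r3) (x1 *s r1 + x2 *s r2 + x3 *s r3) = 0"
      and second: "\<And>c. 2 * c * ((x2 + w2 * x1) / 2 - 1 * (w3 * x3)) + (w2 - 1 * w3\<^sup>2) = 0 \<Longrightarrow>
         t ((1 + c * x1) *s r1 + (w2 + c * x2) *s r2 + (w3 + c * x3) *s r3) ((1 + c * x1) *s r1 + (w2 + c * x2) *s r2 + (w3 + c * x3) *s r3)
           ((1 + c * x1) *s r1 + (w2 + c * x2) *s r2 + (w3 + c * x3) *s r3) = 0"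
    show False
    proof (cases "x1 = 0")
      case True
      hence x': "x3 = 0" "x2 \<noteq> 0" using con x by auto
      define c where "c = - (w2 - w3\<^sup>2) / x2"
      have "2 * c * ((x2 + w2 * x1) / 2 - 1 * (w3 * x3)) + (w2 - 1 * w3\<^sup>2) = 0" using x' True by (simp add: c_def)
      from point[OF _ _ _ _ second[OF this], of 1 w3] have "w3 \<in> N" using x' True by (simp add: c_def)
      thus False using w3 by simp
    next
      case False
      define s where "s = x3 / x1"
      have x3: "x3 = x1 * s" using False by (simp add: s_def)
      have x2: "x2 = x1 * s\<^sup>2" using con False unfolding x3 by (simp add: power2_eq_square)
      have s: "s \<in> N" using point[OF False refl x2 x3 cub] .
      \<comment> \<open>Twice the polar form at \<open>w0\<close> and the conic point with parameter
        \<open>s\<close>; it vanishes only if the tangent there passes through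
        \<open>w0\<close>.\<close>
      define B where "B = s\<^sup>2 + w2 - 2 * w3 * s"
      have B: "B \<noteq> 0"
      proof
        assume "B = 0"
        hence "w2 = (s + s) * w3 - s * s" by (simp add: B_def power2_eq_square algebra_simps)
        thus False using w2N[OF s s] by simp
      qed
      define f where "f = - (w2 - w3\<^sup>2) / B"
      have f: "f * B = - (w2 - w3\<^sup>2)" using B by (simp add: f_def)
      have "2 * (f / x1) * ((x2 + w2 * x1) / 2 - 1 * (w3 * x3)) + (w2 - 1 * w3\<^sup>2) = f * B + (w2 - w3\<^sup>2)"
        using False unfolding x2 x3 B_def by (simp add: field_simps)
      hence "2 * (f / x1) * ((x2 + w2 * x1) / 2 - 1 * (w3 * x3)) + (w2 - 1 * w3\<^sup>2) = 0" using f by simp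
      note pt = second[OF this]
      have co: "1 + f / x1 * x1 = 1 + f" "w2 + f / x1 * x2 = w2 + f * s\<^sup>2" "w3 + f / x1 * x3 = w3 + f * s"
        using False unfolding x2 x3 by simp_all
      show False
      proof (cases "1 + f = 0")
        \<comment> \<open>The second intersection would be \<open>r2\<close>, and then
          \<open>s\<close> is \<open>w3\<close>.\<close>
        case True
        hence "f = - 1" by (simp add: eq_neg_iff_add_eq_0 add.commute)
        hence "(s - w3)\<^sup>2 = 0" using f by (simp add: B_def power2_eq_square algebra_simps)
        thus False using s w3 by simp
      next
        case f1: False
        define s' where "s' = (w3 + f * s) / (1 + f)"
        have s': "w3 + f * s = (1 + f) * s'" using f1 by (simp add: s'_def)
        have "(1 + f) * (w2 + f * s\<^sup>2) = (w3 + f * s)\<^sup>2"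
          using f by (simp add: B_def power2_eq_square algebra_simps)
        hence e: "w2 + f * s\<^sup>2 = (1 + f) * s'\<^sup>2" unfolding s' using f1 by (simp add: power2_eq_square)
        have "s' \<in> N" by (rule point[OF f1 co(1) _ _ pt]) (simp_all only: co e s')
        moreover have "(1 + f) * w2 = (1 + f) * ((s + s') * w3 - s * s')"
        proof -
          have "(1 + f) * ((s + s') * w3 - s * s') = (1 + f) * s * w3 + ((1 + f) * s') * (w3 - s)" by (simp add: algebra_simps)
          also have "\<dots> = w3\<^sup>2 + f * (2 * s * w3 - s\<^sup>2)" unfolding s'[symmetric] by (simp add: power2_eq_square algebra_simps)
          also have "\<dots> = (1 + f) * w2" using f by (simp add: B_def power2_eq_square algebra_simps)
          finally show ?thesis by (rule sym)
        qed
        hence "w2 = (s + s') * w3 - s * s'" using f1 by (metis mult_left_cancel)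
        ultimately show False using w2N[OF s] by blast
      qed
    qed
  qed
qed

section \<open>Sections whose tangent conic is a pair of lines\<close>

lemma ex_point_on_component:
  assumes S: "singular_section p r1 r2 r3 0" and noplane: "\<not> contains_plane"
  shows "\<exists>a. t (r2 + a *s r3) (r2 + a *s r3) (r2 + a *s r3) \<noteq> 0"
proof (rule ccontr)
  assume *: "\<not> ?thesis"
  let ?c = "[: t r2 r2 r2, 3 * t r2 r2 r3, 3 * t r2 r3 r3, t r3 r3 r3 :]"
  have "poly ?c a = 0" for a
  proof -
    have "t (r2 + a *s r3) (r2 + a *s r3) (r2 + a *s r3) = poly ?c a"
      by (simp add: trilinear symmetric power2_eq_square algebra_simps)
    thus ?thesis using * by simp
  qed
  hence "?c = 0" by (simp add: poly_all_0_iff_0[symmetric])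
  hence c: "t r2 r2 r2 = 0" "t r2 r2 r3 = 0" "t r2 r3 r3 = 0" "t r3 r3 r3 = 0" by simp_all
  \<comment> \<open>For \<open>x1 = 0\<close> and \<open>k = 0\<close> the part linear in
    \<open>p\<close> disappears, so a cubic vanishing on the line of \<open>r2, r3\<close> vanishes
    on the whole plane over it.\<close>
  have "plane_in p r2 r3"
  proof (rule plane_inI)
    fix x y z
    have "t (y *s r2 + z *s r3) (y *s r2 + z *s r3) (y *s r2 + z *s r3) = 0" using c by (simp add: trilinear symmetric)
    thus "t (x *s p + y *s r2 + z *s r3) (x *s p + y *s r2 + z *s r3) (x *s p + y *s r2 + z *s r3) = 0"
      using singular_section_cubic[OF S, of x 0 y z] by (simp add: add.assoc)
  qed
  moreover have "i = 0 \<and> j = 0 \<and> k = 0" if "i *s p + j *s r2 + k *s r3 = 0" for i j k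
    using singular_section_independent[OF S, of i 0 j k] that by simp
  ultimately show False using noplane unfolding contains_plane_def by blast
qed

lemma singular_section_swap: "singular_section p r1 r2 r3 k \<Longrightarrow> singular_section p r2 r1 r3 k"
  unfolding singular_section_def by (simp add: sym23[of p r2 r1])

text \<open>The cubic has finitely many zeros \<open>r2 + a *s r3\<close> and
  \<open>r1 + b *s r3\<close> on the two components, and the line joining such a pair contains
  \<open>w0\<close> only if \<open>w3 = b + w2 * a\<close>. The hypothesis on \<open>r3\<close>
  takes care of lines through the node.\<close>

lemma pfaffian_if_section_rank_two:
  assumes S: "singular_section p r1 r2 r3 0" and noplane: "\<not> contains_plane"
    and r3: "t r3 r3 r3 \<noteq> 0 \<or> t r1 r3 r3 \<noteq> 0 \<or> t r2 r3 r3 \<noteq> 0"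
  shows "pfaffian_function (\<lambda>x. t x x x)"
proof -
  have pf: "polyfun (\<lambda>a. t (r + a *s r3) (r + a *s r3) (r + a *s r3))" for r
    unfolding add1 add2 add3 scale1 scale2 scale3 by (intro polyfun_intros)
  define N1 N2 where "N1 = {a. t (r2 + a *s r3) (r2 + a *s r3) (r2 + a *s r3) = 0}"
    and "N2 = {a. t (r1 + a *s r3) (r1 + a *s r3) (r1 + a *s r3) = 0}"
  have fin: "finite N1" "finite N2"
    using ex_point_on_component[OF S noplane] ex_point_on_component[OF singular_section_swap[OF S] noplane]
      polyfun_finite_zeros[OF pf] unfolding N1_def N2_def by blast+
  \<comment> \<open>If the node is a zero of the cubic, \<open>w2\<close> must violate the condition
    for lines through it; one of 1 and -1 does.\<close>
  obtain w2 where w2: "w2 \<noteq> 0" "t r3 r3 r3 = 0 \<Longrightarrow> t r1 r3 r3 + w2 * t r2 r3 r3 \<noteq> 0"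
  proof (cases "t r1 r3 r3 + t r2 r3 r3 = 0")
    case False
    thus ?thesis using that[of 1] by simp
  next
    case True
    hence e: "t r1 r3 r3 = - t r2 r3 r3" by (simp add: eq_neg_iff_add_eq_0)
    show ?thesis by (rule that[of "- 1"]) (use r3 e in auto)
  qed
  have "finite ((\<lambda>(a, b). b + w2 * a) ` (N1 \<times> N2))" using fin by simp
  then obtain w3 where w3: "w3 \<notin> (\<lambda>(a, b). b + w2 * a) ` (N1 \<times> N2)"
    using ex_new_if_finite[OF infinite_UNIV_char_0] by blast
  have w3N: "w3 \<noteq> b + w2 * a" if "a \<in> N1" "b \<in> N2" for a b using w3 that by force
  have pt: "a \<in> {a. t (r + a *s r3) (r + a *s r3) (r + a *s r3) = 0}"
    if "f \<noteq> 0" "v = f *s (r + a *s r3)" "t v v v = 0" for f a v r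
    using that(1,3) unfolding that(2) cubic_scale by simp
  show ?thesis
  proof (rule pfaffian_if_singular_section[OF S, of w2 w3])
    show "w2 - 0 * w3\<^sup>2 \<noteq> 0" using w2 by simp
    fix i x1 x2 x3
    assume x: "x1 \<noteq> 0 \<or> x2 \<noteq> 0 \<or> x3 \<noteq> 0" and con: "x1 * x2 = 0 * x3\<^sup>2"
      and cub: "t (x1 *s r1 + x2 *s r2 + x3 *s r3) (x1 *s r1 + x2 *s r2 + x3 *s r3) (x1 *s r1 + x2 *s r2 + x3 *s r3) = 0"
      and second: "\<And>c. 2 * c * ((x2 + w2 * x1) / 2 - 0 * (w3 * x3)) + (w2 - 0 * w3\<^sup>2) = 0 \<Longrightarrow>
         t ((1 + c * x1) *s r1 + (w2 + c * x2) *s r2 + (w3 + c * x3) *s r3) ((1 + c * x1) *s r1 + (w2 + c * x2) *s r2 + (w3 + c * x3) *s r3)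
           ((1 + c * x1) *s r1 + (w2 + c * x2) *s r2 + (w3 + c * x3) *s r3) = 0"
      and node: "x1 = 0 \<Longrightarrow> x2 = 0 \<Longrightarrow> (0::complex) = 0 \<Longrightarrow> t r1 r3 r3 + w2 * t r2 r3 r3 + w3 * t r3 r3 r3 = 0"
    consider "x1 = 0" "x2 \<noteq> 0" | "x1 \<noteq> 0" "x2 = 0" | "x1 = 0" "x2 = 0" "x3 \<noteq> 0" using con x by auto
    thus False
    proof cases
      case 1
      define a c where "a = x3 / x2" and "c = - w2 / x2"
      have "2 * c * ((x2 + w2 * x1) / 2 - 0 * (w3 * x3)) + (w2 - 0 * w3\<^sup>2) = 0" using 1 by (simp add: c_def)
      note sec = second[OF this]
      have "a \<in> N1" unfolding N1_def
        by (rule pt[OF 1(2) _ cub]) (use 1 in \<open>simp add: a_def vec.scale_right_distrib\<close>)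
      moreover have "w3 - w2 * a \<in> N2" unfolding N2_def
        by (rule pt[of 1, OF _ _ sec]) (use 1 in \<open>simp_all add: a_def c_def\<close>)
      ultimately show False using w3N[of a "w3 - w2 * a"] by simp
    next
      case 2
      define b c where "b = x3 / x1" and "c = - 1 / x1"
      have "2 * c * ((x2 + w2 * x1) / 2 - 0 * (w3 * x3)) + (w2 - 0 * w3\<^sup>2) = 0" using 2 by (simp add: c_def)
      note sec = second[OF this]
      have "b \<in> N2" unfolding N2_def
        by (rule pt[OF 2(1) _ cub]) (use 2 in \<open>simp add: b_def vec.scale_right_distrib\<close>)
      moreover have "(w3 - b) / w2 \<in> N1" unfolding N1_def
        by (rule pt[OF w2(1) _ sec]) (use 2 w2(1) in \<open>simp add: b_def c_def vec.scale_right_distrib\<close>)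
      ultimately show False using w3N[of "(w3 - b) / w2" b] w2(1) by simp
    next
      case 3
      have "t (x3 *s r3) (x3 *s r3) (x3 *s r3) = 0" using cub 3 by simp
      hence "t r3 r3 r3 = 0" using 3(3) unfolding cubic_scale by simp
      thus False using node[OF 3(1,2) refl] w2(2) by simp
    qed
  qed
qed

end

section \<open>The case distinction on the cubic\<close>

text \<open>Finitely many hyperplanes do not cover the space: on the line of all
  \<open>v + s *s u\<close> each form has finitely many zeros.\<close>

lemma ex_nonzero_all_forms:
  fixes fs :: "(complex ^ 'n \<Rightarrow> complex) list"
  assumes "\<forall>f\<in>set fs. linear_form f \<and> (\<exists>v. f v \<noteq> 0)"
  shows "\<exists>v. \<forall>f\<in>set fs. f v \<noteq> 0"
  using assms
proof (induction fs)
  case (Cons f fs)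
  then obtain v where v: "\<forall>g\<in>set fs. g v \<noteq> 0" by auto
  obtain u where u: "f u \<noteq> 0" using Cons.prems by auto
  have "finite {s. f v + s * f u = 0}"
  proof (rule finite_subset)
    show "{s. f v + s * f u = 0} \<subseteq> {- f v / f u}"
      using u by (auto simp: field_simps eq_neg_iff_add_eq_0)
  qed simp
  moreover have "finite (\<Union>g\<in>set fs. {s. g v + s * g u = 0})"
  proof (intro finite_UN_I finite_set)
    fix g assume "g \<in> set fs"
    hence "g v + 0 * g u \<noteq> 0" using v by simp
    moreover have "polyfun (\<lambda>s. g v + s * g u)" by (intro polyfun_intros)
    ultimately show "finite {s. g v + s * g u = 0}" using polyfun_finite_zeros by blast
  qed
  ultimately have "finite ({s. f v + s * f u = 0} \<union> (\<Union>g\<in>set fs. {s. g v + s * g u = 0}))" by (rule finite_UnI)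
  from ex_new_if_finite[OF infinite_UNIV_char_0 this]
  obtain s where s: "s \<notin> {s. f v + s * f u = 0} \<union> (\<Union>g\<in>set fs. {s. g v + s * g u = 0})" by blast
  have "g (v + s *s u) = g v + s * g u" if "g \<in> set (f # fs)" for g
  proof -
    have "linear_form g" using Cons.prems that by auto
    thus ?thesis by (simp add: linear_form_add linear_form_scale)
  qed
  thus ?case using s by (intro exI[of _ "v + s *s u"]) auto
qed simp

lemma linear_form_multiple:
  fixes f g :: "complex ^ 'n \<Rightarrow> complex"
  assumes "linear_form f" "linear_form g" "\<And>v. f v = 0 \<Longrightarrow> g v = 0"
  obtains c where "\<And>v. g v = c * f v"
proof (cases "\<exists>u. f u \<noteq> 0")
  case True
  then obtain u where u: "f u \<noteq> 0" by blast
  show ?thesis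
  proof (rule that[of "g u / f u"])
    fix v
    have "f (v - (f v / f u) *s u) = 0"
      using linear_form_add[OF assms(1), of "v - (f v / f u) *s u" "(f v / f u) *s u"] u
      by (simp add: linear_form_scale[OF assms(1)])
    hence "g (v - (f v / f u) *s u) = 0" by (rule assms(3))
    thus "g v = g u / f u * f v"
      using linear_form_add[OF assms(2), of "v - (f v / f u) *s u" "(f v / f u) *s u"]
      by (simp add: linear_form_scale[OF assms(2)])
  qed
next
  case False
  thus ?thesis using assms(3) that[of 0] by simp
qed

context cubic_fourspace
begin

text \<open>The vector \<open>k\<close> is isotropic for \<open>t p\<close> and not in its radical
  on the tangent hyperplane, since it pairs with \<open>v\<close>; it extends to a hyperbolic
  pair.\<close>

lemma singular_sectionI:
  assumes "p \<noteq> 0" "t p p p = 0" "t p p k = 0" "t p k k = 0" "t p p v = 0" "t p k v \<noteq> 0"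
  obtains r1 r2 where "t p p r1 = 0" "t p p r2 = 0" "t p r1 r1 = 0" "t p r2 r2 = 0" "t p r1 r2 = 1 / 2"
proof -
  define r1 where "r1 = (1 / (2 * t p k v)) *s k"
  define r2 where "r2 = v - (t p v v / (2 * t p k v)) *s k"
  show ?thesis
    by (rule that[of r1 r2]) (use assms in \<open>simp_all add: r1_def r2_def trilinear sym23[of p v k]\<close>)
qed

lemma singular_section_normalise:
  assumes "p \<noteq> 0" "t p p p = 0" "t p p r1 = 0" "t p p r2 = 0" "t p r1 r1 = 0" "t p r2 r2 = 0" "t p r1 r2 = 1 / 2"
    "r \<notin> vec.span {p}" "t p p r = 0" "t p r1 r = 0" "t p r2 r = 0" "t p r r \<noteq> 0"
  obtains r3 where "singular_section p r1 r2 r3 1"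
proof -
  define s where "s = csqrt (- 1 / t p r r)"
  have s: "s * s = - 1 / t p r r" by (simp add: s_def power2_eq_square[symmetric])
  have s0: "s \<noteq> 0" using s assms(12) by auto
  have "t p (s *s r) (s *s r) = s * s * t p r r" by (simp add: trilinear)
  hence "t p (s *s r) (s *s r) = - 1" unfolding s using assms(12) by simp
  moreover have "s *s r \<notin> vec.span {p}"
  proof
    assume "s *s r \<in> vec.span {p}"
    hence "(1 / s) *s (s *s r) \<in> vec.span {p}" by (rule vec.span_scale)
    thus False using s0 assms(8) by simp
  qed
  ultimately have "singular_section p r1 r2 (s *s r) 1"
    using assms unfolding singular_section_def by (simp add: trilinear)
  thus ?thesis by (rule that)
qed

text \<open>Every hyperplane through the singular point \<open>p\<close> gives a singular section,
  so the third vector is free. If all vectors orthogonal to \<open>r1, r2\<close> are isotropic, one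
  of them has \<open>t u u u\<close> nonzero, as otherwise a plane through \<open>p\<close> would
  lie on the threefold.\<close>

lemma pfaffian_if_singular_rank_two:
  assumes p: "p \<noteq> 0" "\<And>v. t p p v = 0"
    and r: "t p r1 r1 = 0" "t p r2 r2 = 0" "t p r1 r2 = 1 / 2"
    and noplane: "\<not> contains_plane"
  shows "pfaffian_function (\<lambda>x. t x x x)"
proof (cases "\<exists>u. u \<notin> vec.span {p} \<and> t p r1 u = 0 \<and> t p r2 u = 0 \<and> t p u u \<noteq> 0")
  case True
  then obtain u where "u \<notin> vec.span {p}" "t p r1 u = 0" "t p r2 u = 0" "t p u u \<noteq> 0" by blast
  then obtain r3 where "singular_section p r1 r2 r3 1"
    using singular_section_normalise[of p r1 r2 u] p r by blast
  thus ?thesis using pfaffian_if_section_rank_three noplane by blast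
next
  case False
  obtain a where a: "a \<notin> vec.span {p}" "t p r1 a = 0" "t p r2 a = 0"
    by (rule ex_kernel_not_in_span1[OF linear_form_third[of p r1] linear_form_third[of p r2] linear_form_third[of p r2]])
  obtain b where b: "b \<notin> vec.span {p, a}" "t p r1 b = 0" "t p r2 b = 0"
    by (rule ex_kernel_not_in_span2[OF linear_form_third[of p r1] linear_form_third[of p r2]])
  have ind: "k = 0 \<and> i = 0 \<and> j = 0" if e: "k *s p + i *s a + j *s b = 0" for k i j
  proof -
    have j: "j = 0" by (rule coefficient_zero[OF e _ b(1)]) (unfold span2_iff, blast)
    hence e': "k *s p + i *s a = 0" using e by simp
    have "i = 0" by (rule coefficient_zero[OF e' _ a(1)]) (unfold span1_iff, blast)
    thus ?thesis using e' j p by simp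
  qed
  have null: "t p u u = 0" if u: "u = i *s a + j *s b" for u i j
  proof (cases "u \<in> vec.span {p}")
    case True
    then obtain k where "u = k *s p" by (auto simp: span1_iff)
    thus ?thesis using p by (simp add: trilinear)
  next
    case nu: False
    have "t p r1 u = 0" "t p r2 u = 0" using a b by (simp_all add: u trilinear)
    thus ?thesis using False nu by blast
  qed
  have "\<not> plane_in p a b"
    using noplane ind unfolding contains_plane_def by blast
  then obtain k i j where kij: "t (k *s p + i *s a + j *s b) (k *s p + i *s a + j *s b) (k *s p + i *s a + j *s b) \<noteq> 0"
    using plane_inI by blast
  define u where "u = i *s a + j *s b"
  have "t (k *s p + u) (k *s p + u) (k *s p + u) = t u u u"
    using p(2)[of u] p(2)[of p] null[OF u_def] by (simp add: trilinear symmetric)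
  hence uuu: "t u u u \<noteq> 0" using kij by (simp add: u_def add.assoc)
  have "u \<notin> vec.span {p}"
  proof
    assume "u \<in> vec.span {p}"
    then obtain k where "u = k *s p" by (auto simp: span1_iff)
    thus False using uuu p by (simp add: trilinear)
  qed
  hence "singular_section p r1 r2 u 0"
    using p r a b null[OF u_def] unfolding singular_section_def by (simp add: trilinear u_def)
  thus ?thesis using pfaffian_if_section_rank_two noplane uuu by blast
qed

text \<open>Normalise \<open>a\<close> to \<open>t p a a = 1\<close>. Either \<open>t p\<close> is
  the square of \<open>t p a\<close>, or some \<open>c\<close> orthogonal to \<open>a\<close> is not
  isotropic, and the sum and difference of \<open>a\<close> and a multiple of \<open>c\<close> are
  isotropic.\<close>

lemma symmetric_form_rank:
  fixes p
  obtains (hyperbolic) r1 r2 where "t p r1 r1 = 0" "t p r2 r2 = 0" "t p r1 r2 = 1 / 2"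
  | (square) z where "linear_form z" "\<And>u v. t p u v = z u * z v"
proof (cases "\<forall>a. t p a a = 0")
  case True
  have "t p u v = 0" for u v
  proof -
    have "t p (u + v) (u + v) = t p u u + 2 * t p u v + t p v v" by (simp add: trilinear symmetric)
    thus ?thesis using True by simp
  qed
  thus ?thesis by (intro square[of "\<lambda>_. 0"]) auto
next
  case False
  then obtain a' where a': "t p a' a' \<noteq> 0" by blast
  define s where "s = csqrt (1 / t p a' a')"
  have s: "s * s = 1 / t p a' a'" by (simp add: s_def power2_eq_square[symmetric])
  define a where "a = s *s a'"
  have "t p a a = s * s * t p a' a'" by (simp add: a_def trilinear)
  hence a: "t p a a = 1" unfolding s using a' by simp
  show ?thesis
  proof (cases "\<forall>u. t p u u = t p a u * t p a u")
    case True
    have sq: "t p u v = t p a u * t p a v" for u v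
    proof -
      have "t p (u + v) (u + v) = t p u u + 2 * t p u v + t p v v" by (simp add: trilinear symmetric)
      moreover have "t p a (u + v) * t p a (u + v) = t p a u * t p a u + 2 * (t p a u * t p a v) + t p a v * t p a v"
        by (simp add: trilinear algebra_simps)
      moreover have "t p (u + v) (u + v) = t p a (u + v) * t p a (u + v)" "t p u u = t p a u * t p a u" "t p v v = t p a v * t p a v"
        using True by blast+
      ultimately have "2 * t p u v = 2 * (t p a u * t p a v)" by simp
      thus ?thesis by simp
    qed
    show ?thesis by (rule square[OF linear_form_third sq])
  next
    case False
    then obtain b' where b': "t p b' b' \<noteq> t p a b' * t p a b'" by blast
    define c where "c = b' - t p a b' *s a"
    have ac: "t p a c = 0" using a by (simp add: c_def trilinear)
    have "t p c c = t p b' c - t p a b' * t p a c" by (simp only: c_def diff2 scale2)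
    also have "\<dots> = t p b' b' - t p a b' * t p b' a" by (simp only: ac mult_zero_right diff_zero) (simp only: c_def diff3 scale3)
    finally have cc: "t p c c \<noteq> 0" using b' by (simp add: sym23[of p b' a])
    define k where "k = csqrt (- 1 / t p c c)"
    have k: "k * k = - 1 / t p c c" by (simp add: k_def power2_eq_square[symmetric])
    have "k * k * t p c c = - 1" unfolding k using cc by simp
    hence kc: "t p (k *s c) (k *s c) = - 1" by (simp only: scale2 scale3 mult.assoc)
    have akc: "t p a (k *s c) = 0" "t p (k *s c) a = 0" using ac sym23[of p c a] by (simp_all add: trilinear)
    have 1: "t p (a + k *s c) (a + k *s c) = 0" "t p (a - k *s c) (a - k *s c) = 0" "t p (a + k *s c) (a - k *s c) = 2"
      using a kc akc by (simp_all add: add2 add3 diff2 diff3)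
    show ?thesis
      by (rule hyperbolic[of "(1 / 4) *s (a + k *s c)" "a - k *s c"]) (simp_all only: scale2 scale3 1, simp_all)
  qed
qed

text \<open>Here \<open>p\<close> is a singular point whose tangent cone is the double hyperplane \<open>\<zeta> = 0\<close>; the section is spanned
  by \<open>p\<close>, two further points \<open>b1, b2\<close> of the hyperplane and a general point \<open>z\<close>.\<close>

lemma pfaffian_if_singular_rank_one:
  assumes p: "p \<noteq> 0" "\<And>v. t p p v = 0"
    and zeta: "linear_form \<zeta>" "\<And>u v. t p u v = \<zeta> u * \<zeta> v" "\<exists>u. \<zeta> u \<noteq> 0"
    and noplane: "\<not> contains_plane"
  shows "pfaffian_function (\<lambda>x. t x x x)"
proof -
  have zp: "\<zeta> p = 0" using p(2) zeta(2,3) by (metis mult_eq_0_iff)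
  have zlin: "\<zeta> (u + v) = \<zeta> u + \<zeta> v" "\<zeta> (c *s u) = c * \<zeta> u" "\<zeta> (u - v) = \<zeta> u - \<zeta> v" for u v c
    using linear_form_add[OF zeta(1)] linear_form_scale[OF zeta(1)] linear_form_add[OF zeta(1), of "u - v" v] by simp_all
  \<comment> \<open>On the hyperplane \<open>\<zeta> = 0\<close> the cubic is a cone with vertex
    \<open>p\<close>. If it vanishes on the line of \<open>a, b\<close>, it vanishes on the plane
    over that line.\<close>
  have plane: False if b: "\<zeta> a = 0" "\<zeta> b = 0" "\<And>k i j. k *s p + i *s a + j *s b = 0 \<Longrightarrow> k = 0 \<and> i = 0 \<and> j = 0"
    "t a a a = 0" "t b b b = 0" "t a a b = 0" "t a b b = 0" for a b
  proof -
    have "plane_in p a b"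
    proof (rule plane_inI)
      fix k i j
      have "\<zeta> (i *s a + j *s b) = 0" using b by (simp add: zlin)
      hence 1: "t p (i *s a + j *s b) (i *s a + j *s b) = 0" by (simp add: zeta)
      have "t (i *s a + j *s b) (i *s a + j *s b) (i *s a + j *s b) = 0" using b by (simp add: binary_cubic_form)
      moreover have "t (k *s p + u) (k *s p + u) (k *s p + u) = t u u u" if "t p u u = 0" for u
        using that p(2)[of u] p(2)[of p] by (simp add: trilinear symmetric)
      ultimately show "t (k *s p + i *s a + j *s b) (k *s p + i *s a + j *s b) (k *s p + i *s a + j *s b) = 0"
        using 1 by (simp add: add.assoc)
    qed
    thus False using noplane b(3) unfolding contains_plane_def by blast
  qed
  have ind_span: "k = 0 \<and> i = 0 \<and> j = 0" if "a \<notin> vec.span {p}" "b \<notin> vec.span {p, a}" "k *s p + i *s a + j *s b = 0" for a b k i j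
  proof -
    have j: "j = 0" by (rule coefficient_zero[OF that(3) _ that(2)]) (unfold span2_iff, blast)
    hence e': "k *s p + i *s a = 0" using that(3) by simp
    have "i = 0" by (rule coefficient_zero[OF e' _ that(1)]) (unfold span1_iff, blast)
    thus ?thesis using e' j p by simp
  qed
  have span_mono: "v \<notin> vec.span {p, a}" if "v \<notin> vec.span {p, a, b}" for v a b
    using that vec.span_mono[of "{p, a}" "{p, a, b}"] by blast
  obtain n1 where n1: "n1 \<notin> vec.span {p}" "\<zeta> n1 = 0" by (rule ex_kernel_not_in_span1[OF zeta(1) zeta(1) zeta(1)])
  obtain n2 where n2: "n2 \<notin> vec.span {p, n1}" "\<zeta> n2 = 0" by (rule ex_kernel_not_in_span2[OF zeta(1) zeta(1)])
  \<comment> \<open>Three zeros \<open>c1, c2, c3\<close> of the cubic with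
    \<open>\<zeta> = 0\<close> are needed, any two of them independent modulo \<open>p\<close>. No
    two can both satisfy \<open>sing\<close>, so two of the three do not.\<close>
  obtain s1 u1 where su1: "s1 \<noteq> 0 \<or> u1 \<noteq> 0" "t (s1 *s n1 + u1 *s n2) (s1 *s n1 + u1 *s n2) (s1 *s n1 + u1 *s n2) = 0"
    by (rule ex_zero_on_line)
  define c1 where "c1 = s1 *s n1 + u1 *s n2"
  have c1: "c1 \<notin> vec.span {p}" "\<zeta> c1 = 0" "t c1 c1 c1 = 0"
  proof -
    show "c1 \<notin> vec.span {p}"
    proof
      assume "c1 \<in> vec.span {p}"
      then obtain k where "c1 = k *s p" by (auto simp: span1_iff)
      hence "s1 *s n1 + u1 *s n2 = k *s p" by (simp only: c1_def)
      hence "(- k) *s p + (s1 *s n1 + u1 *s n2) = 0" by (simp only: vec.scale_minus_left add.left_inverse)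
      hence "(- k) *s p + s1 *s n1 + u1 *s n2 = 0" by (simp only: add.assoc)
      from ind_span[OF n1(1) n2(1) this] su1(1) show False by simp
    qed
  qed (use n1 n2 su1 in \<open>simp_all add: c1_def zlin\<close>)
  obtain e where e: "e \<notin> vec.span {p, c1}" "\<zeta> e = 0" by (rule ex_kernel_not_in_span2[OF zeta(1) zeta(1)])
  obtain f where f: "f \<notin> vec.span {p, c1, e}" "\<zeta> f = 0" by (rule ex_kernel_not_in_span3[OF zeta(1)])
  obtain s2 u2 where su2: "s2 \<noteq> 0 \<or> u2 \<noteq> 0" "t (s2 *s e + u2 *s f) (s2 *s e + u2 *s f) (s2 *s e + u2 *s f) = 0"
    by (rule ex_zero_on_line)
  define c2 where "c2 = s2 *s e + u2 *s f"
  have c2: "c2 \<notin> vec.span {p, c1}" "\<zeta> c2 = 0" "t c2 c2 c2 = 0"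
  proof -
    show "c2 \<notin> vec.span {p, c1}"
    proof
      assume "c2 \<in> vec.span {p, c1}"
      then obtain k l where "c2 = k *s p + l *s c1" by (auto simp: span2_iff)
      hence "((- k) *s p + (- l) *s c1 + s2 *s e) + u2 *s f = 0" by (simp add: c2_def vec.scale_minus_left algebra_simps)
      moreover from this have "u2 = 0" by (rule coefficient_zero[OF _ _ f(1)]) (unfold span3_iff, blast)
      ultimately have "(- k) *s p + (- l) *s c1 + s2 *s e = 0" by simp
      from ind_span[OF c1(1) e(1) this] \<open>u2 = 0\<close> su2(1) show False by simp
    qed
  qed (use e f su2 in \<open>simp_all add: c2_def zlin\<close>)
  obtain d where d: "d \<notin> vec.span {p, c1, c2}" "\<zeta> d = 0" by (rule ex_kernel_not_in_span3[OF zeta(1)])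
  \<comment> \<open>A line through \<open>c1 + c2\<close> keeps \<open>c3\<close> independent of
    each of \<open>c1\<close> and \<open>c2\<close> modulo \<open>p\<close>, even if
    \<open>u3 = 0\<close>.\<close>
  obtain s3 u3 where su3: "s3 \<noteq> 0 \<or> u3 \<noteq> 0" "t (s3 *s (c1 + c2) + u3 *s d) (s3 *s (c1 + c2) + u3 *s d) (s3 *s (c1 + c2) + u3 *s d) = 0"
    by (rule ex_zero_on_line)
  define c3 where "c3 = s3 *s (c1 + c2) + u3 *s d"
  have c3: "\<zeta> c3 = 0" "t c3 c3 c3 = 0" using c1 c2 d su3 by (simp_all add: c3_def zlin)
  have ind12: "k = 0 \<and> i = 0 \<and> j = 0" if "k *s p + i *s c1 + j *s c2 = 0" for k i j
    by (rule ind_span[OF c1(1) c2(1) that])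
  have ind3: "k = 0 \<and> i = 0 \<and> j = 0 \<and> l = 0" if e: "k *s p + i *s c1 + j *s c2 + l *s d = 0" for k i j l
  proof -
    have "l = 0" by (rule coefficient_zero[OF e _ d(1)]) (unfold span3_iff, blast)
    thus ?thesis using ind12[of k i j] e by simp
  qed
  have ind13: "k = 0 \<and> i = 0 \<and> j = 0" if e: "k *s p + i *s c1 + j *s c3 = 0" for k i j
  proof -
    have "k *s p + (i + j * s3) *s c1 + (j * s3) *s c2 + (j * u3) *s d = 0"
      using e by (simp add: c3_def vec.scale_right_distrib vec.scale_left_distrib algebra_simps)
    from ind3[OF this] su3(1) show ?thesis by auto
  qed
  have ind23: "k = 0 \<and> i = 0 \<and> j = 0" if e: "k *s p + i *s c2 + j *s c3 = 0" for k i j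
  proof -
    have "k *s p + (j * s3) *s c1 + (i + j * s3) *s c2 + (j * u3) *s d = 0"
      using e by (simp add: c3_def vec.scale_right_distrib vec.scale_left_distrib algebra_simps)
    from ind3[OF this] su3(1) show ?thesis by auto
  qed
  define sing where "sing c \<longleftrightarrow> (\<forall>v. t c c v = 0)" for c
  have sing: "\<not> (sing a \<and> sing b)"
    if "\<zeta> a = 0" "\<zeta> b = 0" "\<And>k i j. k *s p + i *s a + j *s b = 0 \<Longrightarrow> k = 0 \<and> i = 0 \<and> j = 0" for a b
  proof
    assume ab: "sing a \<and> sing b"
    hence "t b b a = 0" by (simp add: sing_def)
    hence "t a b b = 0" using sym12 sym23 by metis
    thus False using plane[OF that] ab by (simp add: sing_def)
  qed
  have "\<exists>b1 b2. \<zeta> b1 = 0 \<and> \<zeta> b2 = 0 \<and> t b1 b1 b1 = 0 \<and> t b2 b2 b2 = 0 \<and> \<not> sing b1 \<and> \<not> sing b2 \<and>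
      (\<forall>k i j. k *s p + i *s b1 + j *s b2 = 0 \<longrightarrow> k = 0 \<and> i = 0 \<and> j = 0)"
  proof -
    consider "\<not> sing c1" "\<not> sing c2" | "\<not> sing c1" "\<not> sing c3" | "\<not> sing c2" "\<not> sing c3"
      using sing[OF c1(2) c2(2) ind12] sing[OF c1(2) c3(1) ind13] sing[OF c2(2) c3(1) ind23] by blast
    thus ?thesis
    proof cases
      case 1
      thus ?thesis using c1 c2 ind12 by blast
    next
      case 2
      thus ?thesis using c1 c3 ind13 by blast
    next
      case 3
      thus ?thesis using c2 c3 ind23 by blast
    qed
  qed
  then obtain b1 b2 where b: "\<zeta> b1 = 0" "\<zeta> b2 = 0" "t b1 b1 b1 = 0" "t b2 b2 b2 = 0" "\<not> sing b1" "\<not> sing b2"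
    and indb: "\<And>k i j. k *s p + i *s b1 + j *s b2 = 0 \<Longrightarrow> k = 0 \<and> i = 0 \<and> j = 0" by blast
  \<comment> \<open>On the span of \<open>b1, b2\<close> the cubic is
    \<open>3 x y (g x + h y)\<close>, and \<open>b3\<close> below is its third zero.\<close>
  define g h where "g = t b1 b1 b2" and "h = t b1 b2 b2"
  have gh: "g \<noteq> 0 \<or> h \<noteq> 0" using plane[OF b(1,2) indb b(3,4)] by (auto simp: g_def h_def)
  define b3 where "b3 = h *s b1 - g *s b2"
  have "\<not> sing b3"
  proof
    assume s: "sing b3"
    show False
    proof (cases "g = 0 \<or> h = 0")
      case True
      then consider "g = 0" "h \<noteq> 0" | "h = 0" "g \<noteq> 0" using gh by blast
      thus False
      proof cases
        case 1
        hence "t b3 b3 v = h * h * t b1 b1 v" for v by (simp add: b3_def trilinear)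
        thus False using s b(5) 1 by (simp add: sing_def)
      next
        case 2
        hence "t b3 b3 v = g * g * t b2 b2 v" for v by (simp add: b3_def trilinear)
        thus False using s b(6) 2 by (simp add: sing_def)
      qed
    next
      case False
      have "t b3 b3 b1 = - (g * g * h)"
        using b(3,4) by (simp add: b3_def trilinear symmetric g_def[symmetric] h_def[symmetric] algebra_simps)
      thus False using s False by (simp add: sing_def)
    qed
  qed
  hence "\<forall>f\<in>set [\<zeta>, t b1 b1, t b2 b2, t b3 b3]. linear_form f \<and> (\<exists>v. f v \<noteq> 0)"
    using b(5,6) zeta by (simp add: sing_def)
  \<comment> \<open>A line of the section through \<open>z\<close> would have one of the three zeros
    as direction, up to a multiple of \<open>p\<close>, and \<open>t z\<close> would vanish on it
    twice. A general \<open>z0\<close> prevents this.\<close>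
  from ex_nonzero_all_forms[OF this] obtain z0 where z0: "\<zeta> z0 \<noteq> 0" "t b1 b1 z0 \<noteq> 0" "t b2 b2 z0 \<noteq> 0" "t b3 b3 z0 \<noteq> 0" by auto
  define k where "k = csqrt (1 / (3 * \<zeta> z0 * \<zeta> z0))"
  have k: "k * k = 1 / (3 * \<zeta> z0 * \<zeta> z0)" by (simp add: k_def power2_eq_square[symmetric])
  have k0: "k \<noteq> 0" using k z0 by auto
  define z1 where "z1 = k *s z0"
  \<comment> \<open>Moves \<open>z1\<close> towards \<open>p\<close> onto the threefold; as
    \<open>3 * t p z1 z1 = 1\<close>, the coefficient is the value of the cubic.\<close>
  define z where "z = z1 - t z1 z1 z1 *s p"
  have zz1: "\<zeta> z1 * \<zeta> z1 = 1 / 3"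
  proof -
    have "\<zeta> z1 * \<zeta> z1 = k * k * (\<zeta> z0 * \<zeta> z0)" by (simp add: z1_def zlin)
    thus ?thesis unfolding k using z0(1) by simp
  qed
  have zz: "\<zeta> z = \<zeta> z1" by (simp add: z_def zlin zp)
  have zetaz: "\<zeta> z \<noteq> 0" using zz zz1 by auto
  have pzz: "t p z z = 1 / 3" using zz zz1 by (simp add: zeta)
  have zzp: "t z z p = 1 / 3" using pzz sym12 sym23 by metis
  have zzz: "t z z z = 0"
  proof -
    define m where "m = t z1 z1 z1"
    have "t p z1 z1 = 1 / 3" using zz1 by (simp add: zeta)
    hence z1p: "t z1 p z1 = 1 / 3" "t z1 z1 p = 1 / 3" "t p z1 z1 = 1 / 3" using sym12 sym23 by metis+
    have ppz: "t p p v = 0" "t p v p = 0" "t v p p = 0" for v using p(2)[of v] sym12[of v p p] sym23[of p v p] by simp_all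
    have "t z z z = t z1 z1 z1 - m * t z1 z1 p - m * t z1 p z1 - m * t p z1 z1"
      by (simp add: z_def m_def[symmetric] diff1 diff2 diff3 scale1 scale2 scale3 ppz algebra_simps)
    thus ?thesis unfolding z1p m_def by simp
  qed
  have zb: "t z v v = k * t v v z0" if "\<zeta> v = 0" for v
  proof -
    have "t p v v = 0" using that by (simp add: zeta)
    hence "t z v v = k * t z0 v v" by (simp add: z_def z1_def trilinear)
    thus ?thesis using sym12 sym23 by metis
  qed
  have zb_nz: "t z b1 b1 \<noteq> 0" "t z b2 b2 \<noteq> 0" "t z b3 b3 \<noteq> 0"
    using zb[of b1] zb[of b2] zb[of b3] b z0 k0 by (simp_all add: b3_def zlin)
  \<comment> \<open>Because \<open>t z z p = 1 / 3\<close>, these shifts make \<open>t z z\<close>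
    vanish on \<open>x\<close> and \<open>y\<close>.\<close>
  define x y where "x = b1 - (3 * t z z b1) *s p" and "y = b2 - (3 * t z z b2) *s p"
  have u: "i *s x + j *s y = (i *s b1 + j *s b2) - (3 * (i * t z z b1 + j * t z z b2)) *s p" for i j
    by (simp add: x_def y_def vec.scale_right_diff_distrib vec.scale_left_distrib algebra_simps)
  have zxy: "\<zeta> x = 0" "\<zeta> y = 0" using b zp by (simp_all add: x_def y_def zlin)
  have shift: "t z (v - c *s p) (v - c *s p) = t z v v" "t (v - c *s p) (v - c *s p) (v - c *s p) = t v v v" if "\<zeta> v = 0" for v c
  proof -
    have "t p z v = 0" "t p v v = 0" "t p p v = 0" "t p p z = 0" "t p p p = 0" using that p by (simp_all add: zeta zp)
    thus "t z (v - c *s p) (v - c *s p) = t z v v" "t (v - c *s p) (v - c *s p) (v - c *s p) = t v v v"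
      by (simp_all add: trilinear symmetric)
  qed
  have zb12: "\<zeta> (i *s b1 + j *s b2) = 0" for i j using b by (simp add: zlin)
  have n: "t (i *s x + j *s y) (i *s x + j *s y) (i *s x + j *s y) = (3 * g) * i\<^sup>2 * j + (3 * h) * i * j\<^sup>2" for i j
    unfolding u shift(2)[OF zb12] by (simp add: binary_cubic_form b g_def h_def)
  show ?thesis
  proof (rule pfaffian_if_determinantal_section[of p x y z])
    show "t p p p = 0" "t p p x = 0" "t p p y = 0" "t p p z = 0" "t p z z = 1 / 3" "t z z z = 0" using p pzz zzz by simp_all
    show "t p z x = 0" "t p z y = 0" using zxy by (simp_all add: zeta)
    show "t z z x = 0" "t z z y = 0" by (simp_all add: x_def y_def diff3 scale3 zzp)
  next
    fix i j l m assume e: "i *s p + j *s x + l *s y + m *s z = 0"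
    have "\<zeta> (i *s p + j *s x + l *s y + m *s z) = m * \<zeta> z" using zxy zp by (simp add: zlin)
    moreover have "\<zeta> 0 = 0" by (rule linear_form_zero[OF zeta(1)])
    ultimately have m: "m = 0" unfolding e using zetaz by simp
    have "(i - 3 * (j * t z z b1 + l * t z z b2)) *s p + j *s b1 + l *s b2 = i *s p + (j *s x + l *s y)"
      unfolding u by (simp add: vec.scale_left_diff_distrib algebra_simps)
    also have "\<dots> = 0" using e m by (simp add: add.assoc)
    finally show "i = 0 \<and> j = 0 \<and> l = 0 \<and> m = 0" using indb[of "i - 3 * (j * t z z b1 + l * t z z b2)" j l] m by auto
  next
    fix i j
    assume zu: "t z (i *s x + j *s y) (i *s x + j *s y) = 0" and uuu: "t (i *s x + j *s y) (i *s x + j *s y) (i *s x + j *s y) = 0"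
    have zu': "t z (i *s b1 + j *s b2) (i *s b1 + j *s b2) = 0" using zu unfolding u shift(1)[OF zb12] .
    have "3 * (i * j * (g * i + h * j)) = 0" using uuu unfolding n by (simp add: power2_eq_square algebra_simps)
    then consider "i = 0" | "j = 0" | "g * i + h * j = 0" by auto
    thus "i = 0 \<and> j = 0"
    proof cases
      case 1
      thus ?thesis using zu' zb_nz(2) by (simp add: trilinear)
    next
      case 2
      thus ?thesis using zu' zb_nz(1) by (simp add: trilinear)
    next
      case 3
      have "\<exists>c. i = c * h \<and> j = - (c * g)"
      proof (cases "g = 0")
        case True
        hence "h \<noteq> 0" "j = 0" using gh 3 by auto
        thus ?thesis using True by (intro exI[of _ "i / h"]) simp
      next
        case False
        have "g * i = - (h * j)" using 3 by (simp add: eq_neg_iff_add_eq_0)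
        thus ?thesis using False by (intro exI[of _ "- j / g"]) (simp add: field_simps)
      qed
      then obtain c where c: "i = c * h" "j = - (c * g)" by blast
      have "i *s b1 + j *s b2 = c *s b3" by (simp add: c b3_def vec.scale_right_diff_distrib vec.scale_minus_left)
      hence "c * c * t z b3 b3 = 0" using zu' by (simp add: trilinear)
      thus ?thesis using zb_nz(3) c by simp
    qed
  next
    have 1: "(\<lambda>i j. 3 * t p (i *s x + j *s y) (i *s x + j *s y)) = (\<lambda>i j. 0)"
      using zxy by (simp add: zeta zlin)
    have 2: "(\<lambda>i j. 3 * t z (i *s x + j *s y) (i *s x + j *s y)) = (\<lambda>i j. (3 * t z x x) * i\<^sup>2 + (6 * t z x y) * i * j + (3 * t z y y) * j\<^sup>2)"
      by (simp add: binary_quadratic_form fun_eq_iff algebra_simps)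
    show "determinantal_system (\<lambda>i j. 3 * t p (i *s x + j *s y) (i *s x + j *s y))
        (\<lambda>i j. 3 * t z (i *s x + j *s y) (i *s x + j *s y)) (\<lambda>i j. t (i *s x + j *s y) (i *s x + j *s y) (i *s x + j *s y))"
      unfolding 1 2 n by (rule determinantal_system_zero)
  qed
qed

text \<open>On a line \<open>\<langle>e, f\<rangle>\<close> inside a smooth hypersurface the tangent hyperplane is not constant to first order.\<close>

lemma ex_nonparabolic_point:
  assumes smooth: "\<And>v. v \<noteq> 0 \<Longrightarrow> \<exists>u. t v v u \<noteq> 0"
  obtains p k v where "p \<noteq> 0" "t p p p = 0" "t p p k = 0" "t p k k = 0" "t p p v = 0" "t p k v \<noteq> 0"
proof -
  obtain n1 :: "complex ^ 5" where n1: "n1 \<notin> vec.span {0}" using ex_not_in_span4[of 0 0 0 0] by auto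
  obtain n2 where n2: "n2 \<notin> vec.span {n1}" using ex_not_in_span4[of n1 n1 n1 n1] by auto
  obtain i j where ij: "i \<noteq> 0 \<or> j \<noteq> 0" "t (i *s n1 + j *s n2) (i *s n1 + j *s n2) (i *s n1 + j *s n2) = 0" by (rule ex_zero_on_line)
  define e where "e = i *s n1 + j *s n2"
  have e0: "e \<noteq> 0"
  proof
    assume "e = 0"
    hence "i *s n1 + j *s n2 = 0" by (simp add: e_def)
    moreover from this have "j = 0" by (rule coefficient_zero[OF _ _ n2]) (unfold span1_iff, blast)
    ultimately show False using ij(1) n1 by (auto simp: span1_iff)
  qed
  have e: "t e e e = 0" using ij(2) by (simp add: e_def)
  obtain f where f: "f \<notin> vec.span {e}" "t e e f = 0" "t e f f = 0" "t f f f = 0" using ex_line_through[OF e0 e] by blast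
  have ef0: "e + c *s f \<noteq> 0" for c
  proof
    assume a: "e + c *s f = 0"
    have "c = 0" by (rule coefficient_zero[OF a _ f(1)]) (auto simp: vec.span_base)
    thus False using a e0 by simp
  qed
  have f0: "f \<noteq> 0" using f(1) vec.span_zero by auto
  have ffe: "t f f e = 0" "t f e e = 0" "t f e f = 0" "t e f e = 0" using f sym12 sym23 by metis+
  note that' = that
  \<comment> \<open>Three points of the line, each with a direction along it: \<open>f\<close> at
    \<open>e\<close>, \<open>e\<close> at \<open>f\<close>, and \<open>e - f\<close> at
    \<open>e + f\<close>.\<close>
  consider v where "t e e v = 0" "t e f v \<noteq> 0" | v where "t f f v = 0" "t f e v \<noteq> 0"
    | v where "t (e + f) (e + f) v = 0" "t (e + f) (e - f) v \<noteq> 0"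
  proof -
    assume no: "\<And>v. t e e v = 0 \<Longrightarrow> t e f v \<noteq> 0 \<Longrightarrow> thesis" "\<And>v. t f f v = 0 \<Longrightarrow> t f e v \<noteq> 0 \<Longrightarrow> thesis"
      "\<And>v. t (e + f) (e + f) v = 0 \<Longrightarrow> t (e + f) (e - f) v \<noteq> 0 \<Longrightarrow> thesis"
    show thesis
    proof (rule ccontr)
      assume "\<not> thesis"
      hence h: "\<And>v. t e e v = 0 \<Longrightarrow> t e f v = 0" "\<And>v. t f f v = 0 \<Longrightarrow> t f e v = 0"
        "\<And>v. t (e + f) (e + f) v = 0 \<Longrightarrow> t (e + f) (e - f) v = 0" using no by blast+
      \<comment> \<open>If all three points fail, every form \<open>t q q\<close> with
        \<open>q\<close> on the line becomes a multiple of \<open>t e e\<close>. The multiplier at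
        \<open>e + s *s f\<close> is a quadratic polynomial in \<open>s\<close>, and its root is a
        singular point.\<close>
      obtain b where b: "\<And>v. t e f v = b * t e e v" using linear_form_multiple[OF linear_form_third linear_form_third h(1)] by blast
      obtain b' where b': "\<And>v. t f e v = b' * t f f v" using linear_form_multiple[OF linear_form_third linear_form_third h(2)] by blast
      have "\<exists>c. c \<noteq> 0 \<and> (\<forall>v. t f f v = c * t e e v)"
      proof (cases "b' = 0")
        case False
        have c: "t f f v = (b / b') * t e e v" for v using b[of v] b'[of v] False by (simp add: sym12[of f e] field_simps)
        moreover have "b / b' \<noteq> 0" using smooth[OF f0] c by auto
        ultimately show ?thesis by blast
      next
        \<comment> \<open>Here \<open>t e f\<close> vanishes, so \<open>e\<close> and
          \<open>f\<close> alone do not relate \<open>t e e\<close> to \<open>t f f\<close>; the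
          third point does.\<close>
        case True
        hence ef: "t e f v = 0" "t f e v = 0" for v using b'[of v] by (simp_all add: sym12[of e f])
        obtain l where "\<And>v. t (e + f) (e - f) v = l * t (e + f) (e + f) v"
          using linear_form_multiple[OF linear_form_third linear_form_third h(3)] by blast
        hence l: "t e e v - t f f v = l * (t e e v + t f f v)" for v
          using ef by (simp add: add1 add2 diff2)
        have l': "(1 + l) * t f f v = (1 - l) * t e e v" for v using l[of v] by (simp add: algebra_simps)
        have l1: "1 + l \<noteq> 0"
        proof
          assume "1 + l = 0"
          hence "l = - 1" by (simp add: eq_neg_iff_add_eq_0 add.commute)
          hence "t e e v = 0" for v using l'[of v] by simp
          thus False using smooth[OF e0] by blast
        qed
        have c: "t f f v = ((1 - l) / (1 + l)) * t e e v" for v using l'[of v] l1 by (simp add: field_simps)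
        moreover have "(1 - l) / (1 + l) \<noteq> 0" using smooth[OF f0] c by auto
        ultimately show ?thesis by blast
      qed
      then obtain c where c: "c \<noteq> 0" "\<And>v. t f f v = c * t e e v" by blast
      have "degree [:1, 2 * b, c:] > 0" using c(1) by simp
      then obtain s where "poly [:1, 2 * b, c:] s = 0" using alg_closed_imp_poly_has_root by blast
      hence s: "1 + 2 * b * s + c * s * s = 0" by (simp add: algebra_simps)
      have "t (e + s *s f) (e + s *s f) v = (1 + 2 * b * s + c * s * s) * t e e v" for v
        by (simp add: trilinear sym12[of f e] b c(2) algebra_simps)
      hence "t (e + s *s f) (e + s *s f) v = 0" for v using s by simp
      thus False using smooth[OF ef0] by blast
    qed
  qed
  thus ?thesis
  proof cases
    case 1
    show ?thesis by (rule that'[OF e0 e f(2,3) 1])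
  next
    case 2
    show ?thesis by (rule that'[OF f0 f(4) ffe(1,2) 2])
  next
    case 3
    have "e + f \<noteq> 0" using ef0[of 1] by simp
    thus ?thesis by (rule that'[OF _ _ _ _ 3]) (use e f ffe in \<open>simp_all add: trilinear\<close>)
  qed
qed

text \<open>At a nonparabolic point the tangent section has a tangent conic of rank at least two. In
  rank two, failure of the condition at the node \<open>r\<close> would produce a singular point on
  the line of \<open>p\<close> and \<open>r\<close>.\<close>

lemma pfaffian_if_smooth:
  assumes smooth: "\<And>v. v \<noteq> 0 \<Longrightarrow> \<exists>u. t v v u \<noteq> 0" and noplane: "\<not> contains_plane"
  shows "pfaffian_function (\<lambda>x. t x x x)"
proof -
  obtain p k v where p: "p \<noteq> 0" "t p p p = 0" "t p p k = 0" "t p k k = 0" "t p p v = 0" "t p k v \<noteq> 0"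
    by (rule ex_nonparabolic_point[OF smooth])
  obtain r1 r2 where r: "t p p r1 = 0" "t p p r2 = 0" "t p r1 r1 = 0" "t p r2 r2 = 0" "t p r1 r2 = 1 / 2"
    by (rule singular_sectionI[OF p])
  obtain r where r3: "r \<notin> vec.span {p}" "t p p r = 0" "t p r1 r = 0" "t p r2 r = 0"
    by (rule ex_kernel_not_in_span1[OF linear_form_third[of p p] linear_form_third[of p r1] linear_form_third[of p r2]])
  show ?thesis
  proof (cases "t p r r = 0")
    case False
    then obtain r3 where "singular_section p r1 r2 r3 1"
      using singular_section_normalise[OF p(1,2) r r3] by blast
    thus ?thesis using pfaffian_if_section_rank_three noplane by blast
  next
    case True
    hence S: "singular_section p r1 r2 r 0" using p r r3 unfolding singular_section_def by simp
    have "t r r r \<noteq> 0 \<or> t r1 r r \<noteq> 0 \<or> t r2 r r \<noteq> 0"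
    proof (rule ccontr)
      assume "\<not> ?thesis"
      hence n: "t r r r = 0" "t r1 r r = 0" "t r2 r r = 0" by simp_all
      obtain w where w: "t p p w \<noteq> 0" using smooth[OF p(1)] by blast
      have "independent_tuple p r1 r2 r w" unfolding independent_tuple_def
      proof (intro allI impI)
        fix i x1 x2 x3 m assume *: "i *s p + x1 *s r1 + x2 *s r2 + x3 *s r + m *s w = 0"
        have "t p p (i *s p + x1 *s r1 + x2 *s r2 + x3 *s r + m *s w) = m * t p p w" using p r r3 by (simp add: trilinear)
        hence "m = 0" unfolding * using w by (simp add: trilinear)
        thus "i = 0 \<and> x1 = 0 \<and> x2 = 0 \<and> x3 = 0 \<and> m = 0"
          using singular_section_independent[OF S, of i x1 x2 x3] * by simp
      qed
      then obtain P R1 R2 R3 W where "linear_form P" "linear_form R1" "linear_form R2" "linear_form R3" "linear_form W"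
        and co: "\<And>v. v = P v *s p + R1 v *s r1 + R2 v *s r2 + R3 v *s r + W v *s w"
        by (rule independent_tuple_coordinates) (rule that)
      \<comment> \<open>Forms that vanish on the tangent hyperplane are multiples of its equation
        \<open>W\<close>. This applies to \<open>t p p\<close>, \<open>t p r\<close> and
        \<open>t r r\<close>, so a quadratic equation in \<open>s\<close> annihilates
        \<open>t q q\<close> for \<open>q = p + s *s r\<close>.\<close>
      have ker: "t a b v = W v * t a b w" if "t a b p = 0" "t a b r1 = 0" "t a b r2 = 0" "t a b r = 0" for a b v
      proof -
        have "t a b v = t a b (P v *s p + R1 v *s r1 + R2 v *s r2 + R3 v *s r + W v *s w)"
          by (rule arg_cong[OF co])
        thus ?thesis using that by (simp add: trilinear)
      qed
      have k: "t p r p = 0" "t p r r1 = 0" "t p r r2 = 0" "t r r p = 0" "t r r r1 = 0" "t r r r2 = 0"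
        using r3 n True sym23[of p r p] sym23[of p r r1] sym23[of p r r2] sym12[of r r p] sym23[of r r p] sym12[of r p r]
          sym23[of r r r1] sym12[of r r1 r] sym23[of r r r2] sym12[of r r2 r] by simp_all
      have 1: "t p p v = W v * t p p w" "t p r v = W v * t p r w" "t r r v = W v * t r r w" for v
        by (rule ker; (fact p r r3 n True k))+
      have r0: "r \<noteq> 0" using r3(1) vec.span_zero by auto
      have c0: "t r r w \<noteq> 0"
      proof
        assume "t r r w = 0"
        hence "t r r v = 0" for v using 1(3)[of v] by simp
        thus False using smooth[OF r0] by blast
      qed
      have "degree [:t p p w, 2 * t p r w, t r r w:] > 0" using c0 by simp
      then obtain s where "poly [:t p p w, 2 * t p r w, t r r w:] s = 0" using alg_closed_imp_poly_has_root by blast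
      hence s: "t p p w + 2 * s * t p r w + s * s * t r r w = 0" by (simp add: algebra_simps)
      have "t (p + s *s r) (p + s *s r) v = 0" for v
      proof -
        have "t (p + s *s r) (p + s *s r) v = t p p v + 2 * s * t p r v + s * s * t r r v"
          by (simp add: add1 add2 scale1 scale2 sym12[of r p] algebra_simps)
        hence "t (p + s *s r) (p + s *s r) v = W v * (t p p w + 2 * s * t p r w + s * s * t r r w)"
          by (simp only: 1[of v] distrib_left mult.assoc mult.left_commute)
        thus ?thesis unfolding s by simp
      qed
      moreover have "p + s *s r \<noteq> 0"
      proof
        assume a: "p + s *s r = 0"
        have "s = 0" by (rule coefficient_zero[OF a _ r3(1)]) (auto simp: vec.span_base)
        thus False using a p(1) by simp
      qed
      ultimately show False using smooth by blast
    qed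
    thus ?thesis using pfaffian_if_section_rank_two[OF S noplane] by blast
  qed
qed

text \<open>At a singular point \<open>p\<close> the form \<open>t p\<close> is nonzero by
  assumption, so its rank is either one or at least two, and both cases have been settled.\<close>

theorem pfaffian_if_not_degenerate:
  assumes nd: "\<And>p. p \<noteq> 0 \<Longrightarrow> \<exists>u v. t p u v \<noteq> 0"
  shows "pfaffian_function (\<lambda>x. t x x x)"
proof (cases "contains_plane")
  case True
  thus ?thesis by (rule pfaffian_if_contains_plane)
next
  case noplane: False
  show ?thesis
  proof (cases "\<exists>p. p \<noteq> 0 \<and> (\<forall>v. t p p v = 0)")
    case True
    then obtain p where p: "p \<noteq> 0" "\<And>v. t p p v = 0" by blast
    show ?thesis
    proof (cases p rule: symmetric_form_rank)
      case (hyperbolic r1 r2)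
      thus ?thesis using pfaffian_if_singular_rank_two[OF p _ _ _ noplane] by blast
    next
      case (square \<zeta>)
      moreover have "\<exists>u. \<zeta> u \<noteq> 0" using nd[OF p(1)] square(2) by auto
      ultimately show ?thesis using pfaffian_if_singular_rank_one[OF p _ _ _ noplane] by blast
    qed
  next
    case False
    thus ?thesis using pfaffian_if_smooth[OF _ noplane] by blast
  qed
qed

end

theorem theorem5p2:
  fixes F :: "5 mpoly"
  assumes "cubic_form F"
    and "normal_hypersurface F"
    and "\<not> is_cone F"
  shows "is_pfaffian_cubic F"
proof -
  obtain t where t: "symmetric_trilinear t" and F: "\<And>x. mpoly_eval F (vec_nth x) = t x x x"
    using cubic_form_trilinear[of F] assms(1) unfolding cubic_form_def by blast
  interpret symmetric_trilinear t by (rule t)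
  interpret cubic_fourspace t ..
  \<comment> \<open>A vector in the radical of \<open>t\<close> can be added to any vector without
    changing the cubic, which makes it a vertex.\<close>
  have "\<exists>u v. t p u v \<noteq> 0" if "p \<noteq> 0" for p
  proof (rule ccontr)
    assume "\<not> ?thesis"
    hence p: "t p u v = 0" for u v by blast
    have "is_cone F" unfolding is_cone_def
    proof (intro exI conjI allI impI)
      show "vec_nth p \<noteq> (\<lambda>_. 0)" using that by (auto simp: vec_eq_iff fun_eq_iff)
      show "mpoly_eval F (vec_nth p) = 0" by (simp add: F p)
      fix x a b assume x: "mpoly_eval F x = 0"
      define y where "y = vec_lambda x"
      have y: "vec_nth y = x" by (simp add: y_def vec_lambda_inverse)
      have "(\<lambda>i. a * vec_nth p i + b * x i) = vec_nth (a *s p + b *s y)" by (simp add: fun_eq_iff y)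
      moreover have "t (a *s p + b *s y) (a *s p + b *s y) (a *s p + b *s y) = 0"
        using p x F[of y] by (simp add: binary_cubic_form y sym12[of y p] sym23[of y y p])
      ultimately show "mpoly_eval F (\<lambda>i. a * vec_nth p i + b * x i) = 0" by (simp only: F)
    qed
    thus False using assms(3) by blast
  qed
  thus ?thesis by (intro is_pfaffian_cubicI) (simp add: F pfaffian_if_not_degenerate)
qed

end
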